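(* Let $T>0$, $0<p_1,p_2,q_1,q_2\le\infty$, $0<\alpha<1$, $\gamma>1\vee\frac1{p_2}$, and let $A:\Delta_2(0,T)\to\mathbb R^m$ be measurable with $$\|A\|_{\mathbb B^\alpha_{p_1,q_1}([0,T])}+\|\delta A\|_{\overline{\mathbb B}^\gamma_{p_2,q_2}([0,T])}<\infty .$$ Then there exist $\mathscr IA\in B^\alpha_{p_1\wedge p_2,\,q_1\vee q_2}([0,T])$ and $\mathscr RA\in\mathbb B^\gamma_{p_2,q_2}([0,T])$ such that $$\lim_{\|P\|\to0}\|\mathscr I_PA-\delta\mathscr IA\|_{\mathbb B^\gamma_{p_2,r}([0,T])}=\lim_{\|P\|\to0}\|\mathscr R_PA-\mathscr RA\|_{\mathbb B^\gamma_{p_2,r}([0,T])}=0\quad\text{for all } r\ge q_2 \text{ with } r>\tfrac1\gamma .$$ Moreover, $$\|\mathscr RA\|_{\mathbb B^\gamma_{p_2,q_2}([0,T])}\lesssim_{p_2,q_2,\gamma}\|\delta A\|_{\overline{\mathbb B}^\gamma_{p_2,q_2}([0,T])}$$ and $$[\mathscr IA]_{B^\alpha_{p_1\wedge p_2,q_1\vee q_2}([0,T])}\lesssim_{T,p_1,p_2,q_1,q_2,\gamma}\|A\|_{\mathbb B^\alpha_{p_1,q_1}([0,T])}+T^{\gamma-\alpha}\|\delta A\|_{\overline{\mathbb B}^\gamma_{p_2,q_2}([0,T])}.$$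
   Context: Notation: $\Delta_2(0,T)=\{(s,t)\in[0,T]^2:s\le t\}$, $\Delta_3(0,T)=\{(s,u,t)\in[0,T]^3: s\le u\le t\}$. For a path $f$, $\delta f_{st}=f_t-f_s$; for $A:\Delta_2(0,T)\to\mathbb R^m$, $\delta A_{sut}=A_{st}-A_{su}-A_{ut}$ on $\Delta_3(0,T)$. $\lesssim_{a,b,\dots}$ means $\le C\,\cdot$ with $C$ depending only on $a,b,\dots$. $a\vee b=\max$, $a\wedge b=\min$; $1/\infty=0$. When an integrability exponent equals $\infty$ the corresponding integral is replaced by an (essential) supremum. Functions are identified if equal Lebesgue-a.e. One-parameter Besov spaces: for measurable $f:[0,T]\to\mathbb R^m$, $\omega_p(f,\tau)=\sup_{0\le h\le\tau}\big(\int_0^{T-h}|f_{s+h}-f_s|^p\,ds\big)^{1/p}$, $[f]_{B^\alpha_{pq}([0,T])}=\big[\int_0^T(\omega_p(f,\tau)/\tau^\alpha)^q\frac{d\tau}\tau\big]^{1/q}$, and $f\in B^\alpha_{pq}([0,T])$ iff $f\in L^p([0,T])$ and $[f]_{B^\alpha_{pq}}<\infty$. Two/three-parameter spaces: for $A:\Delta_2(0,T)\to\mathbb R^m$ measurable, $\Omega_p(A,\tau)=\sup_{0\le h\le\tau}\big(\int_0^{T-h}|A_{r,r+h}|^p\,dr\big)^{1/p}$ and $\|A\|_{\mathbb B^\alpha_{pq}([0,T])}=\big[\int_0^T(\Omega_p(A,\tau)/\tau^\alpha)^q\frac{d\tau}\tau\big]^{1/q}$; $\mathbb B^\alpha_{pq}([0,T])$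 is the set of $A$ with this quantity finite. For $B:\Delta_3(0,T)\to\mathbb R^m$, $\overline\Omega_p(B,\tau)=\sup_{0\le\theta\le1}\sup_{0\le h\le\tau}\big(\int_0^{T-h}|B_{r,r+\theta h,r+h}|^p\,dr\big)^{1/p}$ and $\|B\|_{\overline{\mathbb B}^\gamma_{pq}([0,T])}=\big[\int_0^T(\overline\Omega_p(B,\tau)/\tau^\gamma)^q\frac{d\tau}\tau\big]^{1/q}$. Riemann sums: for a partition $P=\{0=\tau_0<\tau_1<\dots<\tau_N=1\}$ of $[0,1]$ with mesh $\|P\|=\max_i(\tau_i-\tau_{i-1})$, $\mathscr I_PA_{st}=\sum_{i=1}^NA_{s+\tau_{i-1}(t-s),\,s+\tau_i(t-s)}$ and $\mathscr R_PA=\mathscr I_PA-A$, for $(s,t)\in\Delta_2(0,T)$. *)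

theory Defs
  imports "HOL-Probability.Essential_Supremum" "HOL-Library.Function_Algebras"
begin

text \<open>
  Since the constants in the estimates must not depend on the dimension, \<open>\<real>\<^sup>m\<close> is represented by
  functions \<^typ>\<open>nat \<Rightarrow> real\<close> of which only the components below \<open>m\<close> matter, so that \<open>m\<close> can be
  quantified inside a formula. Addition and subtraction are the pointwise ones.
  Exponents in \<open>(0,\<infinity>]\<close> are of type \<^typ>\<open>ennreal\<close>.
\<close>

definition vnorm :: "nat \<Rightarrow> (nat \<Rightarrow> real) \<Rightarrow> real" where
  "vnorm m v = L2_set v {..<m}"


text \<open>Powers on \<open>[0,\<infinity>]\<close> are only used with a positive exponent, whence \<open>\<infinity>\<^sup>a = \<infinity>\<close>.\<close>

definition epowr :: "ennreal \<Rightarrow> real \<Rightarrow> ennreal" where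
  "epowr x a = (if x = \<infinity> then \<infinity> else ennreal (enn2real x powr a))"

definition Lp_norm :: "ennreal \<Rightarrow> 'a measure \<Rightarrow> ('a \<Rightarrow> ennreal) \<Rightarrow> ennreal" where
  "Lp_norm p M g =
     (if p = \<infinity> then esssup M g
      else epowr (\<integral>\<^sup>+ x. epowr (g x) (enn2real p) \<partial>M) (1 / enn2real p))"

text \<open>\<open>Besov_scale T \<alpha> q w\<close> is \<open>[\<integral>\<^sub>0\<^sup>T (w(\<tau>) / \<tau>\<^sup>\<alpha>)\<^sup>q d\<tau>/\<tau>]\<close> to the power \<open>1/q\<close>; the density below is
  the measure \<open>d\<tau>/\<tau>\<close>.\<close>

definition Besov_scale :: "real \<Rightarrow> real \<Rightarrow> ennreal \<Rightarrow> (real \<Rightarrow> ennreal) \<Rightarrow> ennreal" where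
  "Besov_scale T \<alpha> q w =
     Lp_norm q (density (lebesgue_on {0<..T}) (\<lambda>\<tau>. ennreal (1 / \<tau>)))
       (\<lambda>\<tau>. w \<tau> / ennreal (\<tau> powr \<alpha>))"


definition omega :: "real \<Rightarrow> nat \<Rightarrow> ennreal \<Rightarrow> (real \<Rightarrow> nat \<Rightarrow> real) \<Rightarrow> real \<Rightarrow> ennreal" where
  "omega T m p f \<tau> =
     (SUP h\<in>{0..\<tau>}. Lp_norm p (lebesgue_on {0..T - h}) (\<lambda>s. ennreal (vnorm m (f (s + h) - f s))))"

definition Besov_seminorm ::
    "real \<Rightarrow> nat \<Rightarrow> real \<Rightarrow> ennreal \<Rightarrow> ennreal \<Rightarrow> (real \<Rightarrow> nat \<Rightarrow> real) \<Rightarrow> ennreal" where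
  "Besov_seminorm T m \<alpha> p q f = Besov_scale T \<alpha> q (omega T m p f)"

definition Besov ::
    "real \<Rightarrow> nat \<Rightarrow> real \<Rightarrow> ennreal \<Rightarrow> ennreal \<Rightarrow> (real \<Rightarrow> nat \<Rightarrow> real) set" where
  "Besov T m \<alpha> p q =
     {f. (\<forall>i<m. (\<lambda>t. f t i) \<in> borel_measurable (lebesgue_on {0..T})) \<and>
         Lp_norm p (lebesgue_on {0..T}) (\<lambda>t. ennreal (vnorm m (f t))) < \<infinity> \<and>
         Besov_seminorm T m \<alpha> p q f < \<infinity>}"


definition Delta2 :: "real \<Rightarrow> (real \<times> real) set" where
  "Delta2 T = {(s, t). 0 \<le> s \<and> s \<le> t \<and> t \<le> T}"

text \<open>
  The integrals defining \<open>Omega\<close> run over the segments \<open>t - s = h\<close>, which are Lebesgue null sets in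
  the plane, so Lebesgue measurability in \<open>(s,t)\<close> does not by itself give them a meaning.
  Measurability of a two-parameter map therefore includes measurability along each of these segments.
  Borel measurable maps satisfy both conditions.
\<close>

definition measurable2 :: "real \<Rightarrow> nat \<Rightarrow> (real \<Rightarrow> real \<Rightarrow> nat \<Rightarrow> real) \<Rightarrow> bool" where
  "measurable2 T m A \<longleftrightarrow>
     (\<forall>i<m. (\<lambda>(s, t). A s t i) \<in> borel_measurable (lebesgue_on (Delta2 T)) \<and>
       (\<forall>h\<in>{0..T}. (\<lambda>r. A r (r + h) i) \<in> borel_measurable (lebesgue_on {0..T - h})))"

definition Omega ::
    "real \<Rightarrow> nat \<Rightarrow> ennreal \<Rightarrow> (real \<Rightarrow> real \<Rightarrow> nat \<Rightarrow> real) \<Rightarrow> real \<Rightarrow> ennreal" where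
  "Omega T m p A \<tau> =
     (SUP h\<in>{0..\<tau>}. Lp_norm p (lebesgue_on {0..T - h}) (\<lambda>r. ennreal (vnorm m (A r (r + h)))))"

definition BB_norm ::
    "real \<Rightarrow> nat \<Rightarrow> real \<Rightarrow> ennreal \<Rightarrow> ennreal \<Rightarrow> (real \<Rightarrow> real \<Rightarrow> nat \<Rightarrow> real) \<Rightarrow> ennreal" where
  "BB_norm T m \<alpha> p q A = Besov_scale T \<alpha> q (Omega T m p A)"

definition BB ::
    "real \<Rightarrow> nat \<Rightarrow> real \<Rightarrow> ennreal \<Rightarrow> ennreal \<Rightarrow> (real \<Rightarrow> real \<Rightarrow> nat \<Rightarrow> real) set" where
  "BB T m \<alpha> p q = {A. measurable2 T m A \<and> BB_norm T m \<alpha> p q A < \<infinity>}"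

definition Omega_bar ::
    "real \<Rightarrow> nat \<Rightarrow> ennreal \<Rightarrow> (real \<Rightarrow> real \<Rightarrow> real \<Rightarrow> nat \<Rightarrow> real) \<Rightarrow> real \<Rightarrow> ennreal" where
  "Omega_bar T m p B \<tau> =
     (SUP \<theta>\<in>{0..1}. SUP h\<in>{0..\<tau>}.
        Lp_norm p (lebesgue_on {0..T - h}) (\<lambda>r. ennreal (vnorm m (B r (r + \<theta> * h) (r + h)))))"

definition BB_bar_norm ::
    "real \<Rightarrow> nat \<Rightarrow> real \<Rightarrow> ennreal \<Rightarrow> ennreal \<Rightarrow> (real \<Rightarrow> real \<Rightarrow> real \<Rightarrow> nat \<Rightarrow> real) \<Rightarrow> ennreal" where
  "BB_bar_norm T m \<gamma> p q B = Besov_scale T \<gamma> q (Omega_bar T m p B)"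


definition incr :: "(real \<Rightarrow> nat \<Rightarrow> real) \<Rightarrow> real \<Rightarrow> real \<Rightarrow> nat \<Rightarrow> real" where
  "incr f s t = f t - f s"

definition delta ::
    "(real \<Rightarrow> real \<Rightarrow> nat \<Rightarrow> real) \<Rightarrow> real \<Rightarrow> real \<Rightarrow> real \<Rightarrow> nat \<Rightarrow> real" where
  "delta A s u t = A s t - A s u - A u t"


text \<open>A partition of \<open>[0,1]\<close> is the list of its points \<open>0 = \<tau>\<^sub>0 < \<dots> < \<tau>\<^sub>N = 1\<close>.\<close>

definition unit_partition :: "real list \<Rightarrow> bool" where
  "unit_partition P \<longleftrightarrow> P \<noteq> [] \<and> hd P = 0 \<and> last P = 1 \<and> sorted_wrt (<) P"

definition mesh :: "real list \<Rightarrow> real" where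
  "mesh P = Max ((\<lambda>i. P ! i - P ! (i - 1)) ` {1..<length P})"

text \<open>The filter of the limit \<open>\<parallel>P\<parallel> \<rightarrow> 0\<close>.\<close>

definition mesh_to_0 :: "real list filter" where
  "mesh_to_0 = inf (filtercomap mesh (at_right 0)) (principal {P. unit_partition P})"

definition riemann_sum ::
    "real list \<Rightarrow> (real \<Rightarrow> real \<Rightarrow> nat \<Rightarrow> real) \<Rightarrow> real \<Rightarrow> real \<Rightarrow> nat \<Rightarrow> real" where
  "riemann_sum P A s t =
     (\<Sum>i = 1..<length P. A (s + P ! (i - 1) * (t - s)) (s + P ! i * (t - s)))"

definition riemann_rem ::
    "real list \<Rightarrow> (real \<Rightarrow> real \<Rightarrow> nat \<Rightarrow> real) \<Rightarrow> real \<Rightarrow> real \<Rightarrow> nat \<Rightarrow> real" where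
  "riemann_rem P A s t = riemann_sum P A s t - A s t"

lemma mesh_pos:
  assumes "unit_partition P"
  shows "0 < mesh P"
proof -
  have len: "2 \<le> length P"
  proof (rule ccontr)
    assume "\<not> 2 \<le> length P"
    then have "length P = 1"
      using assms by (cases P) (auto simp: unit_partition_def not_less_eq_eq)
    then have "hd P = last P"
      by (cases P) auto
    then show False using assms unfolding unit_partition_def by (metis zero_neq_one)
  qed
  then have "P ! 0 < P ! 1"
    using assms by (auto simp: unit_partition_def sorted_wrt_iff_nth_less)
  moreover have "P ! 1 - P ! 0 \<le> mesh P"
    unfolding mesh_def using len by (intro Max_ge) (auto intro!: image_eqI[of _ _ 1])
  ultimately show ?thesis by simp
qed

lemma eventually_mesh_to_0:
  "eventually Q mesh_to_0 \<longleftrightarrow> (\<exists>d>0. \<forall>P. unit_partition P \<and> mesh P < d \<longrightarrow> Q P)"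
proof -
  have "eventually Q mesh_to_0 \<longleftrightarrow>
      (\<exists>R. (\<exists>d>0. \<forall>y>0. y < d \<longrightarrow> R y) \<and> (\<forall>P. R (mesh P) \<longrightarrow> unit_partition P \<longrightarrow> Q P))"
    unfolding mesh_to_0_def eventually_inf_principal eventually_filtercomap
      eventually_at_right_field by simp
  also have "\<dots> \<longleftrightarrow> (\<exists>d>0. \<forall>P. unit_partition P \<and> mesh P < d \<longrightarrow> Q P)"
  proof
    assume "\<exists>d>0. \<forall>P. unit_partition P \<and> mesh P < d \<longrightarrow> Q P"
    then obtain d where "d > 0" "\<forall>P. unit_partition P \<and> mesh P < d \<longrightarrow> Q P" by blast
    then show "\<exists>R. (\<exists>d>0. \<forall>y>0. y < d \<longrightarrow> R y) \<and> (\<forall>P. R (mesh P) \<longrightarrow> unit_partition P \<longrightarrow> Q P)"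
      by (intro exI[of _ "\<lambda>y. y < d"]) auto
  qed (use mesh_pos in meson)
  finally show ?thesis .
qed

end

theory Submission
  imports Defs
begin

text \<open>
  Put \<open>\<rho> \<le> 1 \<and> p\<^sub>2\<close> with \<open>\<gamma> \<rho> > 1\<close>, so that \<open>\<parallel>\<cdot>\<parallel>\<^sub>p\<^sup>\<rho>\<close> satisfies the triangle inequality. Halving the
  interval repeatedly bounds the remainder of an arbitrary Riemann sum on an interval of length \<open>\<tau>\<close> by
  \<open>\<Phi>(\<tau>) = \<Sum>\<^sub>k 2\<^sup>k\<^sup>+\<^sup>1 \<Omega>(\<tau>/2\<^sup>k)\<^sup>\<rho>\<close>, where \<open>\<Omega>\<close> is the modulus of \<open>\<delta>A\<close>. Hence dyadic Riemann sums converge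
  almost everywhere along every line \<open>t - s = h\<close>, and comparing grids through their common refinement
  shows that the limit is additive. Fubini's theorem then yields a base point from which the limit is the
  increment of a Borel path \<open>f\<close>. With \<open>RA = \<delta>f - A\<close>, the geometric sum \<open>\<Phi>\<close> gives the bound of \<open>RA\<close>,
  and the error of a general Riemann sum is minus the sum of \<open>RA\<close> over the partition intervals, which
  scales like \<open>\<parallel>P\<parallel>\<^sup>\<gamma>\<^sup>\<rho>\<^sup>-\<^sup>1\<close>.
\<close>

section \<open>Quasi-norms on nonnegative functions\<close>

text \<open>Two obstacles shape the details. A finite Besov norm bounds a modulus pointwise only up
  to scale \<open>T / 2\<close>; closer to \<open>T\<close> the modulus may be infinite. Hence the
  error bounds start at level 1 of the dyadic grids, a change of the exponent q costs half of the
  interval, and the loss is recovered by splitting increments of the path in two, or by taking a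
  mesh of at most 1/2. Secondly, \<open>A\<close> is only Lebesgue measurable, while Fubini needs a
  Borel version, which agrees with \<open>A\<close> on almost every line only. The exceptional lines
  are recovered at the end by writing a length as a sum of two good ones. The power \<rho> is chosen
  twice: for the constants it depends on \<open>p2\<close> and \<gamma> alone, while for convergence
  with exponent r it must also lie below r. The choices are compatible because the path is fixed by
  then and only the finite norm of its remainder enters. The condition r > 1/\<gamma> is what makes
  \<rho> \<le> r and \<gamma>\<rho> > 1 possible together.\<close>

lemma epowr_ennreal [simp]: "0 \<le> x \<Longrightarrow> epowr (ennreal x) a = ennreal (x powr a)"
  by (simp add: epowr_def)

lemma epowr_top [simp]: "epowr top a = top"
  by (simp add: epowr_def)

lemma epowr_0 [simp]: "epowr 0 a = 0"
  by (simp add: epowr_def)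

lemma epowr_one [simp]: "epowr 1 a = 1"
  using epowr_ennreal[of 1 a] by simp

lemma epowr_1 [simp]: "epowr x 1 = x"
  by (cases x) auto

lemma epowr_mono:
  assumes "0 < a" "x \<le> y"
  shows "epowr x a \<le> epowr y a"
  using assms by (cases x; cases y) (auto intro: powr_mono2 simp: top_unique)

lemma epowr_epowr: "0 < a \<Longrightarrow> epowr (epowr x a) b = epowr x (a * b)"
  by (cases x) (auto simp: powr_powr)

lemma epowr_le_iff: "0 < a \<Longrightarrow> epowr x a \<le> epowr y a \<longleftrightarrow> x \<le> y"
  using epowr_mono[of a x y] epowr_mono[of "1 / a" "epowr x a" "epowr y a"]
  by (auto simp: epowr_epowr)

lemma epowr_le_cong: "0 < a \<Longrightarrow> epowr x a \<le> y \<longleftrightarrow> x \<le> epowr y (1 / a)"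
  using epowr_le_iff[of a x "epowr y (1 / a)"] by (simp add: epowr_epowr)

lemma epowr_less_iff: "0 < a \<Longrightarrow> epowr x a < epowr y a \<longleftrightarrow> x < y"
  using epowr_le_iff[of a y x] by (simp add: not_le[symmetric])

lemma epowr_less_cong: "0 < a \<Longrightarrow> epowr x a < y \<longleftrightarrow> x < epowr y (1 / a)"
  using epowr_less_iff[of a x "epowr y (1 / a)"] by (simp add: epowr_epowr)

lemma less_epowr_cong: "0 < a \<Longrightarrow> y < epowr x a \<longleftrightarrow> epowr y (1 / a) < x"
  using epowr_less_iff[of a "epowr y (1 / a)" x] by (simp add: epowr_epowr)

lemma epowr_mult:
  assumes "0 < a"
  shows "epowr (x * y) a = epowr x a * epowr y a"
proof (cases x; cases y)
  fix r s assume "x = ennreal r" "0 \<le> r" "y = ennreal s" "0 \<le> s"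
  then show ?thesis by (simp add: ennreal_mult[symmetric] powr_mult)
qed (auto simp: ennreal_mult_top ennreal_top_mult powr_eq_0_iff)

lemma epowr_eq_0_iff [simp]: "0 < a \<Longrightarrow> epowr x a = 0 \<longleftrightarrow> x = 0"
  using epowr_le_iff[of a x 0] by simp

lemma epowr_eq_top_iff [simp]: "epowr x a = top \<longleftrightarrow> x = top"
  by (cases x) auto

text \<open>Dividing by x + y reduces the claim to u \<le> u^a on [0,1], applied to two fractions
  that add up to 1.\<close>

lemma powr_add_le:
  fixes x y :: real
  assumes "0 < a" "a \<le> 1" "0 \<le> x" "0 \<le> y"
  shows "(x + y) powr a \<le> x powr a + y powr a"
proof (cases "x + y = 0")
  case False
  then have pos: "0 < x + y" using assms by auto
  have *: "u \<le> u powr a" if "0 \<le> u" "u \<le> 1" for u :: real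
    using powr_mono'[of a 1 u] that assms by simp
  have "1 = x / (x + y) + y / (x + y)"
    using pos by (simp add: add_divide_distrib[symmetric])
  also have "\<dots> \<le> (x / (x + y)) powr a + (y / (x + y)) powr a"
    using assms pos by (intro add_mono *) auto
  also have "\<dots> = (x powr a + y powr a) / (x + y) powr a"
    using assms by (simp add: powr_divide add_divide_distrib)
  finally show ?thesis using pos by (simp add: field_simps)
qed (use assms in auto)

lemma epowr_add_le:
  assumes "0 < a" "a \<le> 1"
  shows "epowr (x + y) a \<le> epowr x a + epowr y a"
  using assms by (cases x; cases y) (auto simp: ennreal_plus[symmetric] powr_add_le simp del: ennreal_plus)

lemma epowr_sum_le:
  assumes "0 < a" "a \<le> 1"
  shows "epowr (\<Sum>i\<in>I. f i) a \<le> (\<Sum>i\<in>I. epowr (f i) a)"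
proof (induction I rule: infinite_finite_induct)
  case (insert i I)
  then show ?case
    using epowr_add_le[OF assms, of "f i" "sum f I"] by (auto intro: order_trans add_left_mono)
qed auto

text \<open>For positive \<open>a\<close> the power is an order isomorphism of [0,\<infinity>] with
  inverse exponent 1/a, so open rays pull back to open rays, also near infinity.\<close>

lemma tendsto_epowr:
  assumes "(f \<longlongrightarrow> x) F" "0 < a"
  shows "((\<lambda>n. epowr (f n) a) \<longlongrightarrow> epowr x a) F"
proof (rule order_tendstoI)
  fix y assume "y < epowr x a"
  then have "\<forall>\<^sub>F n in F. epowr y (1 / a) < f n"
    using assms by (intro order_tendstoD(1)[OF assms(1)]) (simp only: less_epowr_cong)
  then show "\<forall>\<^sub>F n in F. y < epowr (f n) a"
    by eventually_elim (use assms(2) in \<open>simp only: less_epowr_cong\<close>)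
next
  fix y assume "epowr x a < y"
  then have "\<forall>\<^sub>F n in F. f n < epowr y (1 / a)"
    using assms(2) by (intro order_tendstoD(2)[OF assms(1)]) (simp only: epowr_less_cong)
  then show "\<forall>\<^sub>F n in F. epowr (f n) a < y"
    by eventually_elim (use assms(2) in \<open>simp only: epowr_less_cong\<close>)
qed

lemma borel_measurable_epowr [measurable (raw)]:
  assumes "f \<in> borel_measurable M" "0 < a"
  shows "(\<lambda>x. epowr (f x) a) \<in> borel_measurable M"
proof -
  have "continuous_on UNIV (\<lambda>x. epowr x a)"
    using assms(2) by (auto simp: continuous_on_def intro!: tendsto_epowr tendsto_ident_at)
  from measurable_compose[OF assms(1) borel_measurable_continuous_onI[OF this]]
  show ?thesis by simp
qed

text \<open>Convexity on the open half-line covers positive x and y; if one of them is 0, the claim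
  reduces to s^p \<le> s for a weight s in [0,1].\<close>

lemma convex_powr:
  fixes x y :: real
  assumes "1 \<le> p" "0 \<le> x" "0 \<le> y" "0 < t" "t < 1"
  shows "((1 - t) * x + t * y) powr p \<le> (1 - t) * x powr p + t * y powr p"
proof -
  have le: "s powr p \<le> s" if "0 \<le> s" "s \<le> 1" for s :: real
    using powr_mono'[of 1 p s] that assms by simp
  consider "x = 0" | "y = 0" | "0 < x" "0 < y" using assms by fastforce
  then show ?thesis
  proof cases
    case 1
    then show ?thesis using assms le[of t] by (simp add: powr_mult mult_right_mono)
  next
    case 2
    then show ?thesis using assms le[of "1 - t"] by (simp add: powr_mult mult_right_mono)
  next
    case 3
    then show ?thesis
      using convex_onD[OF powr_convex[OF assms(1)], of t x y] assms by simp
  qed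
qed

section \<open>Lebesgue quasi-norms with exponent in (0,\<infinity>]\<close>

abbreviation pow_integral :: "'a measure \<Rightarrow> real \<Rightarrow> ('a \<Rightarrow> ennreal) \<Rightarrow> ennreal" where
  "pow_integral M p f \<equiv> \<integral>\<^sup>+x. epowr (f x) p \<partial>M"

lemma enn2real_pos: "0 < p \<Longrightarrow> p \<noteq> top \<Longrightarrow> 0 < enn2real p"
  by (simp add: enn2real_positive_iff top.not_eq_extremum)

text \<open>Bounds on quasi-norms are mostly proved through this equivalence, so that finite and
  infinite p differ only in the kind of bound to be shown.\<close>

lemma Lp_norm_le_iff:
  assumes "0 < p" "g \<in> borel_measurable M"
  shows "Lp_norm p M g \<le> c \<longleftrightarrow>
    (if p = top then AE x in M. g x \<le> c
     else (pow_integral M (enn2real p) g) \<le> epowr c (enn2real p))"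
proof (cases "p = top")
  case True
  have "(AE x in M. g x \<le> c)" if "esssup M g \<le> c"
    using esssup_AE[of g M] by eventually_elim (use that in auto)
  then show ?thesis using True esssup_I[OF assms(2)] by (auto simp: Lp_norm_def)
next
  case False
  then have "0 < enn2real p" using assms by (simp add: enn2real_pos)
  then show ?thesis using False
    by (simp add: Lp_norm_def epowr_le_cong)
qed

lemma Lp_norm_finite_pow:
  assumes "0 < p" "p \<noteq> top"
  shows "epowr (Lp_norm p M g) (enn2real p) = (pow_integral M (enn2real p) g)"
proof -
  have "0 < enn2real p" using assms by (simp add: enn2real_pos)
  then show ?thesis using assms by (simp add: Lp_norm_def epowr_epowr)
qed

lemma Lp_norm_AE_le:
  assumes "0 < p" "g \<in> borel_measurable M" "f \<in> borel_measurable M" "AE x in M. f x \<le> g x"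
  shows "Lp_norm p M f \<le> Lp_norm p M g"
proof (cases "p = top")
  case True
  have "AE x in M. f x \<le> esssup M g"
    using assms(4) esssup_AE[of g M] by eventually_elim auto
  then show ?thesis using True assms by (auto simp: Lp_norm_def)
next
  case False
  then have p: "0 < enn2real p" using assms by (simp add: enn2real_pos)
  have "(pow_integral M (enn2real p) f) \<le> (pow_integral M (enn2real p) g)"
    using assms(4) p by (intro nn_integral_mono_AE) (auto elim!: eventually_mono intro: epowr_mono)
  then show ?thesis using False assms(1) p
    by (auto simp: Lp_norm_def intro!: epowr_mono)
qed

lemma Lp_norm_cong_AE:
  assumes "0 < p" "g \<in> borel_measurable M" "f \<in> borel_measurable M" "AE x in M. f x = g x"
  shows "Lp_norm p M f = Lp_norm p M g"
  using assms(4) by (intro antisym Lp_norm_AE_le assms) (auto elim: eventually_mono)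

lemma Lp_norm_cmult:
  assumes "0 < p" "g \<in> borel_measurable M"
  shows "Lp_norm p M (\<lambda>x. ennreal c * g x) \<le> ennreal c * Lp_norm p M g"
proof (cases "p = top")
  case True
  have "AE x in M. ennreal c * g x \<le> ennreal c * esssup M g"
    using esssup_AE[of g M] by eventually_elim (auto intro: mult_left_mono)
  then show ?thesis using True assms by (auto simp: Lp_norm_def)
next
  case False
  then have p: "0 < enn2real p" using assms by (simp add: enn2real_pos)
  have "(\<integral>\<^sup>+x. epowr (ennreal c * g x) (enn2real p) \<partial>M) = epowr (ennreal c) (enn2real p) * (pow_integral M (enn2real p) g)"
    using p assms by (simp add: epowr_mult nn_integral_cmult)
  then show ?thesis using False p
    by (auto simp: Lp_norm_def epowr_mult epowr_epowr)
qed

lemma Lp_norm_finite_AE: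
  assumes "0 < p" "g \<in> borel_measurable M" "Lp_norm p M g < top"
  shows "AE x in M. g x < top"
proof (cases "p = top")
  case True
  show ?thesis using esssup_AE[of g M] 
    by eventually_elim (use assms True in \<open>auto simp: Lp_norm_def intro: le_less_trans\<close>)
next
  case False
  then have p: "0 < enn2real p" using assms by (simp add: enn2real_pos)
  have "(pow_integral M (enn2real p) g) \<noteq> \<infinity>"
    using assms False by (auto simp: Lp_norm_def)
  then have "AE x in M. epowr (g x) (enn2real p) \<noteq> \<infinity>"
    using p assms by (intro nn_integral_noteq_infinite) auto
  then show ?thesis by eventually_elim (auto simp: top.not_eq_extremum)
qed

lemma Lp_norm_0_AE:
  assumes "0 < p" "g \<in> borel_measurable M" "Lp_norm p M g = 0"
  shows "AE x in M. g x = 0"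
proof (cases "p = top")
  case True
  show ?thesis using esssup_AE[of g M] 
    by eventually_elim (use assms True in \<open>auto simp: Lp_norm_def\<close>)
next
  case False
  then have p: "0 < enn2real p" using assms by (simp add: enn2real_pos)
  have "(pow_integral M (enn2real p) g) = 0"
    using assms False p by (auto simp: Lp_norm_def)
  then have "AE x in M. epowr (g x) (enn2real p) = 0"
    using p assms by (subst (asm) nn_integral_0_iff_AE) auto
  then show ?thesis by eventually_elim (use p in auto)
qed

text \<open>Fatou's lemma for finite p; for infinite p the bound survives on the intersection of
  countably many sets of full measure. Limits of dyadic sums are estimated this way.\<close>

lemma Lp_norm_liminf_le:
  assumes "0 < p" and u[measurable]: "\<And>n. u n \<in> borel_measurable M" and g[measurable]: "g \<in> borel_measurable M"
    and lim: "AE x in M. (\<lambda>n. u n x) \<longlonglongrightarrow> g x"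
    and le: "\<And>n. Lp_norm p M (u n) \<le> c"
  shows "Lp_norm p M g \<le> c"
proof (cases "p = top")
  case True
  have "AE x in M. \<forall>n. u n x \<le> c"
    using le assms(1) True by (subst AE_all_countable) (auto simp: Lp_norm_le_iff)
  then have "AE x in M. g x \<le> c"
    using lim by eventually_elim (auto intro: LIMSEQ_le_const2)
  then show ?thesis using assms True by (simp add: Lp_norm_le_iff)
next
  case False
  then have p: "0 < enn2real p" using assms by (simp add: enn2real_pos)
  have "(pow_integral M (enn2real p) g) = (\<integral>\<^sup>+x. liminf (\<lambda>n. epowr (u n x) (enn2real p)) \<partial>M)"
  proof (rule nn_integral_cong_AE, use lim in eventually_elim)
    case (elim x)
    show ?case
      using lim_imp_Liminf[OF _ tendsto_epowr[OF elim p]] by simp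
  qed
  also have "\<dots> \<le> liminf (\<lambda>n. \<integral>\<^sup>+x. epowr (u n x) (enn2real p) \<partial>M)"
    using p by (intro nn_integral_liminf) auto
  also have "\<dots> \<le> epowr c (enn2real p)"
    using le assms(1) False by (intro Liminf_le) (auto simp: Lp_norm_le_iff)
  finally show ?thesis using assms False by (simp add: Lp_norm_le_iff)
qed

text \<open>Minkowski's inequality: after normalisation it is the convexity of \<open>x\<^sup>p\<close>.\<close>

lemma Minkowski_nn_integral:
  assumes p: "1 \<le> p" and [measurable]: "f \<in> borel_measurable M" "g \<in> borel_measurable M"
  shows "epowr (\<integral>\<^sup>+x. epowr (f x + g x) p \<partial>M) (1 / p) \<le>
    epowr (pow_integral M p f) (1 / p) + epowr (pow_integral M p g) (1 / p)"
proof -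
  define F where "F = epowr (pow_integral M p f) (1 / p)"
  define G where "G = epowr (pow_integral M p g) (1 / p)"
  have p0: "0 < p" using p by simp
  \<comment> \<open>Positive upper bounds a, b in place of F and G permit division even when a norm
    vanishes; at the end they decrease to F and G.\<close>
  have main: "epowr (\<integral>\<^sup>+x. epowr (f x + g x) p \<partial>M) (1 / p) \<le> ennreal a + ennreal b"
    if ab: "0 < a" "0 < b" "F \<le> ennreal a" "G \<le> ennreal b" for a b :: real
  proof -
    have fa: "(pow_integral M p f) \<le> ennreal (a powr p)"
      using ab p0 by (simp add: F_def epowr_le_cong)
    have gb: "(pow_integral M p g) \<le> ennreal (b powr p)"
      using ab p0 by (simp add: G_def epowr_le_cong)
    \<comment> \<open>With t = b / (a + b), convexity at x / a and y / b yields exactly these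
      weights; they satisfy c a^p + d b^p = (a + b)^p.\<close>
    define c where "c = (a + b) powr p * (a / (a + b)) / a powr p"
    define d where "d = (a + b) powr p * (b / (a + b)) / b powr p"
    have cd: "0 < c" "0 < d" using ab by (auto simp: c_def d_def)
    have real: "(x + y) powr p \<le> c * x powr p + d * y powr p" if "0 \<le> x" "0 \<le> y" for x y :: real
    proof -
      define t where "t = b / (a + b)"
      have t: "0 < t" "t < 1" "1 - t = a / (a + b)" using ab by (auto simp: t_def field_simps)
      have "x + y = (a + b) * ((1 - t) * (x / a) + t * (y / b))"
      proof -
        have "(a + b) * (1 - t) = a" "(a + b) * t = b" using ab t by (auto simp: t_def)
        then show ?thesis using ab by (simp only: distrib_left mult.assoc[symmetric]) simp
      qed
      then have "(x + y) powr p = (a + b) powr p * ((1 - t) * (x / a) + t * (y / b)) powr p"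
        using ab t that by (simp only: powr_mult)
      also have "\<dots> \<le> (a + b) powr p * ((1 - t) * (x / a) powr p + t * (y / b) powr p)"
        using ab that p t by (intro mult_left_mono convex_powr) auto
      also have "\<dots> = c * x powr p + d * y powr p"
        unfolding t(3) using ab that by (simp add: c_def d_def t_def powr_divide distrib_left)
      finally show ?thesis .
    qed
    have "(\<integral>\<^sup>+x. epowr (f x + g x) p \<partial>M) \<le> (\<integral>\<^sup>+x. ennreal c * epowr (f x) p + ennreal d * epowr (g x) p \<partial>M)"
    proof (rule nn_integral_mono)
      fix x
      show "epowr (f x + g x) p \<le> ennreal c * epowr (f x) p + ennreal d * epowr (g x) p"
        using real cd
        by (cases "f x"; cases "g x")
          (auto simp: ennreal_plus[symmetric] ennreal_mult[symmetric] ennreal_mult_top simp del: ennreal_plus)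
    qed
    also have "\<dots> = ennreal c * (pow_integral M p f) + ennreal d * (pow_integral M p g)"
      using p0 by (simp add: nn_integral_add nn_integral_cmult)
    also have "\<dots> \<le> ennreal c * ennreal (a powr p) + ennreal d * ennreal (b powr p)"
      by (intro add_mono mult_left_mono fa gb) auto
    also have "\<dots> = ennreal (c * a powr p + d * b powr p)"
      using cd by (simp add: ennreal_mult)
    also have "c * a powr p + d * b powr p = (a + b) powr p"
      using ab by (simp add: c_def d_def add_divide_distrib[symmetric] distrib_left[symmetric])
    finally have "(\<integral>\<^sup>+x. epowr (f x + g x) p \<partial>M) \<le> epowr (ennreal (a + b)) p"
      using ab by (simp del: ennreal_plus)
    then show ?thesis
      using ab p0 by (simp add: epowr_le_cong)
  qed
  have "epowr (\<integral>\<^sup>+x. epowr (f x + g x) p \<partial>M) (1 / p) \<le> F + G"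
  proof (cases "F < top \<and> G < top")
    case True
    then obtain F' G' where FG: "F = ennreal F'" "0 \<le> F'" "G = ennreal G'" "0 \<le> G'"
      by (cases F; cases G) auto
    show ?thesis
    proof (rule ennreal_le_epsilon)
      fix e :: real assume e: "0 < e"
      have "epowr (\<integral>\<^sup>+x. epowr (f x + g x) p \<partial>M) (1 / p) \<le> ennreal (F' + e / 2) + ennreal (G' + e / 2)"
        using e FG by (intro main) (simp_all add: ennreal_leI add_nonneg_pos del: ennreal_plus)
      also have "\<dots> = F + G + ennreal e"
        using e FG by (simp add: ennreal_plus[symmetric] del: ennreal_plus)
      finally show "epowr (\<integral>\<^sup>+x. epowr (f x + g x) p \<partial>M) (1 / p) \<le> F + G + ennreal e" .
    qed
  qed (auto simp: not_less top_unique)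
  then show ?thesis unfolding F_def G_def .
qed

lemma Minkowski_nn_integral_sum:
  assumes "1 \<le> p" "\<And>i. i \<in> I \<Longrightarrow> u i \<in> borel_measurable M"
  shows "epowr (\<integral>\<^sup>+x. epowr (\<Sum>i\<in>I. u i x) p \<partial>M) (1 / p) \<le>
    (\<Sum>i\<in>I. epowr (pow_integral M p (u i)) (1 / p))"
  using assms(2)
proof (induction I rule: infinite_finite_induct)
  case (insert i I)
  have "epowr (\<integral>\<^sup>+x. epowr (\<Sum>i\<in>insert i I. u i x) p \<partial>M) (1 / p)
      = epowr (\<integral>\<^sup>+x. epowr (u i x + (\<Sum>i\<in>I. u i x)) p \<partial>M) (1 / p)"
    using insert by simp
  also have "\<dots> \<le> epowr (pow_integral M p (u i)) (1 / p) + epowr (\<integral>\<^sup>+x. epowr (\<Sum>i\<in>I. u i x) p \<partial>M) (1 / p)"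
    using insert by (intro Minkowski_nn_integral assms(1)) auto
  also have "\<dots> \<le> epowr (pow_integral M p (u i)) (1 / p) + (\<Sum>i\<in>I. epowr (pow_integral M p (u i)) (1 / p))"
    using insert by (intro add_left_mono insert.IH) auto
  finally show ?case using insert by simp
qed auto

text \<open>Minkowski's inequality with exponent \<open>p / \<rho> \<ge> 1\<close>, applied to the powers \<open>u\<^sub>i\<^sup>\<rho>\<close>. It covers the
  quasi-norms \<open>p < 1\<close> as well.\<close>

lemma Lp_norm_rho_sum:
  assumes \<rho>: "0 < \<rho>" "ennreal \<rho> \<le> p" and I: "finite I"
    and [measurable]: "\<And>i. i \<in> I \<Longrightarrow> u i \<in> borel_measurable M" "g \<in> borel_measurable M"
    and le: "AE x in M. epowr (g x) \<rho> \<le> (\<Sum>i\<in>I. epowr (u i x) \<rho>)"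
  shows "epowr (Lp_norm p M g) \<rho> \<le> (\<Sum>i\<in>I. epowr (Lp_norm p M (u i)) \<rho>)"
proof -
  have p0: "0 < p" using \<rho> by (auto intro: less_le_trans[of _ "ennreal \<rho>"])
  show ?thesis
  proof (cases "p = top")
    case True
    have "AE x in M. \<forall>i\<in>I. u i x \<le> Lp_norm p M (u i)"
      using I esssup_AE True by (subst AE_ball_countable) (auto simp: Lp_norm_def countable_finite)
    then have "AE x in M. g x \<le> epowr (\<Sum>i\<in>I. epowr (Lp_norm p M (u i)) \<rho>) (1 / \<rho>)"
      using le
    proof eventually_elim
      case (elim x)
      then have "epowr (g x) \<rho> \<le> (\<Sum>i\<in>I. epowr (Lp_norm p M (u i)) \<rho>)"
        using \<rho> by (intro order_trans[OF elim(2)] sum_mono epowr_mono) auto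
      then show ?case using \<rho> by (simp add: epowr_le_cong)
    qed
    then show ?thesis using \<rho> True p0 by (simp add: epowr_le_cong Lp_norm_le_iff)
  next
    case False
    define r where "r = enn2real p"
    have r: "0 < r" "\<rho> \<le> r" "1 \<le> r / \<rho>"
      using \<rho> False p0 ennreal_le_iff[of r \<rho>]
      by (auto simp: r_def enn2real_positive_iff top.not_eq_extremum)
    have e: "epowr y r = epowr (epowr y \<rho>) (r / \<rho>)" for y
      using \<rho> by (simp add: epowr_epowr)
    have "epowr (Lp_norm p M g) \<rho> = epowr (pow_integral M r g) (1 / (r / \<rho>))"
      using False r by (simp add: Lp_norm_def r_def epowr_epowr)
    also have "\<dots> \<le> epowr (\<integral>\<^sup>+x. epowr (\<Sum>i\<in>I. epowr (u i x) \<rho>) (r / \<rho>) \<partial>M) (1 / (r / \<rho>))"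
      unfolding e using le r \<rho>
      by (intro epowr_mono nn_integral_mono_AE) (auto elim!: eventually_mono intro: epowr_mono)
    also have "\<dots> \<le> (\<Sum>i\<in>I. epowr (\<integral>\<^sup>+x. epowr (epowr (u i x) \<rho>) (r / \<rho>) \<partial>M) (1 / (r / \<rho>)))"
      using r \<rho> by (intro Minkowski_nn_integral_sum) auto
    also have "\<dots> = (\<Sum>i\<in>I. epowr (Lp_norm p M (u i)) \<rho>)"
      using False r \<rho> by (simp add: Lp_norm_def r_def epowr_epowr)
    finally show ?thesis .
  qed
qed

text \<open>Partial sums obey the finite inequality because x^\<rho> is subadditive for \<rho> \<le>
  1; Fatou carries the bound to the series.\<close>

lemma Lp_norm_rho_suminf:
  assumes \<rho>: "0 < \<rho>" "\<rho> \<le> 1" "ennreal \<rho> \<le> p" 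
    and [measurable]: "\<And>i. u i \<in> borel_measurable M"
  shows "epowr (Lp_norm p M (\<lambda>x. \<Sum>i. u i x)) \<rho> \<le> (\<Sum>i. epowr (Lp_norm p M (u i)) \<rho>)"
proof -
  have p0: "0 < p" using \<rho> by (auto intro: less_le_trans[of _ "ennreal \<rho>"])
  have "Lp_norm p M (\<lambda>x. \<Sum>i. u i x) \<le> epowr (\<Sum>i. epowr (Lp_norm p M (u i)) \<rho>) (1 / \<rho>)"
  proof (rule Lp_norm_liminf_le[where u = "\<lambda>n x. \<Sum>i<n. u i x"])
    show "AE x in M. (\<lambda>n. \<Sum>i<n. u i x) \<longlonglongrightarrow> (\<Sum>i. u i x)"
      by (auto intro: summable_LIMSEQ)
    fix n
    have "epowr (Lp_norm p M (\<lambda>x. \<Sum>i<n. u i x)) \<rho> \<le> (\<Sum>i<n. epowr (Lp_norm p M (u i)) \<rho>)"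
      using \<rho> by (intro Lp_norm_rho_sum) (auto intro: epowr_sum_le)
    also have "\<dots> \<le> (\<Sum>i. epowr (Lp_norm p M (u i)) \<rho>)"
      by (auto intro: sum_le_suminf)
    finally show "Lp_norm p M (\<lambda>x. \<Sum>i<n. u i x) \<le> epowr (\<Sum>i. epowr (Lp_norm p M (u i)) \<rho>) (1 / \<rho>)"
      using \<rho> by (simp add: epowr_le_cong)
  qed (auto simp: p0)
  then show ?thesis using \<rho> by (simp add: epowr_le_cong)
qed

text \<open>The elementary inequality t^r \<le> 1 + t^s for r \<le> s replaces Hoelder's. One
  constant serves all measures of total mass at most \<open>L\<close>, so it can be used for all
  segments at once.\<close>

lemma Lp_norm_inclusion:
  assumes "0 < p" "p \<le> p1"
  shows "\<exists>C\<ge>0. \<forall>(M :: 'a measure) g. emeasure M (space M) \<le> ennreal L \<longrightarrow> g \<in> borel_measurable M \<longrightarrow>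
    Lp_norm p M g \<le> ennreal C * Lp_norm p1 M g"
proof (cases "p = top")
  case True
  then show ?thesis using assms by (intro exI[of _ 1]) (auto simp: top_unique)
next
  case False
  define r where "r = enn2real p"
  have r: "0 < r" "p = ennreal r" using False assms(1)
    by (auto simp: r_def enn2real_positive_iff top.not_eq_extremum)
  \<comment> \<open>The mass bound comes from integrating the 1 in 1 + t^s, the added 1 from the
    integral of t^s after normalisation by b; the absolute value keeps the base positive.\<close>
  define C where "C = (\<bar>L\<bar> + 1) powr (1 / r)"
  have C: "0 < C" "epowr (ennreal C) r = ennreal (\<bar>L\<bar> + 1)"
    using r by (auto simp: C_def powr_powr)
  show ?thesis
  proof (intro exI[of _ C] conjI allI impI)
    fix M :: "'a measure" and g :: "'a \<Rightarrow> ennreal"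
    assume L: "emeasure M (space M) \<le> ennreal L" and [measurable]: "g \<in> borel_measurable M"
    have L': "emeasure M (space M) \<le> ennreal \<bar>L\<bar>" by (rule order_trans[OF L]) (simp add: ennreal_leI)
    have p1: "0 < p1" using assms by auto
    have main: "Lp_norm p M g \<le> ennreal C * ennreal b" if b: "0 < b" "Lp_norm p1 M g \<le> ennreal b" for b
    proof -
      have "(pow_integral M r g) \<le> ennreal (b powr r) * ennreal (\<bar>L\<bar> + 1)"
      proof (cases "p1 = top")
        case True
        then have "AE x in M. g x \<le> ennreal b" using b p1 by (simp add: Lp_norm_le_iff)
        then have "(pow_integral M r g) \<le> (\<integral>\<^sup>+x. ennreal (b powr r) \<partial>M)"
          using b r epowr_mono[of r _ "ennreal b"]
          by (intro nn_integral_mono_AE) (auto elim!: eventually_mono)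
        also have "\<dots> \<le> ennreal (b powr r) * ennreal (\<bar>L\<bar> + 1)"
          unfolding nn_integral_const
          by (intro mult_left_mono order_trans[OF L'] ennreal_leI) auto
        finally show ?thesis .
      next
        case False
        define s where "s = enn2real p1"
        have s: "0 < s" "p1 = ennreal s" using False p1
          by (auto simp: s_def enn2real_positive_iff top.not_eq_extremum)
        then have rs: "r \<le> s" using assms r by (simp add: ennreal_le_iff)
        have int: "(pow_integral M s g) \<le> ennreal (b powr s)"
          using b p1 False by (simp add: Lp_norm_le_iff s_def)
        have real: "x powr r \<le> b powr r * (1 + inverse (b powr s) * x powr s)" if "0 \<le> x" for x :: real
        proof -
          have "(x / b) powr r \<le> 1 + (x / b) powr s"
          proof (cases "x / b \<le> 1")
            case True
            then have "(x / b) powr r \<le> 1" using that b r by (intro powr_le1) auto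
            then show ?thesis by (simp add: add_increasing2)
          next
            case False
            then have "(x / b) powr r \<le> (x / b) powr s" using rs by (intro powr_mono) auto
            then show ?thesis by simp
          qed
          then show ?thesis using b that by (simp add: powr_divide field_simps)
        qed
        have "(pow_integral M r g) \<le> (\<integral>\<^sup>+x. ennreal (b powr r) * (1 + ennreal (inverse (b powr s)) * epowr (g x) s) \<partial>M)"
        proof (rule nn_integral_mono)
          fix x
          show "epowr (g x) r \<le> ennreal (b powr r) * (1 + ennreal (inverse (b powr s)) * epowr (g x) s)"
            using real b by (cases "g x")
              (auto simp: ennreal_1[symmetric] ennreal_plus[symmetric] ennreal_mult[symmetric] ennreal_mult_top simp del: ennreal_plus ennreal_1)
        qed
        also have "\<dots> = ennreal (b powr r) * (emeasure M (space M) + ennreal (inverse (b powr s)) * (pow_integral M s g))"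
          using s by (simp add: nn_integral_add nn_integral_cmult)
        also have "\<dots> \<le> ennreal (b powr r) * (ennreal \<bar>L\<bar> + ennreal (inverse (b powr s)) * ennreal (b powr s))"
          using L' int by (intro mult_left_mono add_mono) auto
        also have "\<dots> = ennreal (b powr r) * ennreal (\<bar>L\<bar> + 1)"
          using b by (simp add: ennreal_mult[symmetric])
        finally show ?thesis .
      qed
      also have "\<dots> = epowr (ennreal C * ennreal b) r"
        using b r C by (simp only: epowr_mult) (simp add: mult.commute)
      finally show ?thesis using False assms(1) by (simp add: Lp_norm_le_iff r_def)
    qed
    show "Lp_norm p M g \<le> ennreal C * Lp_norm p1 M g"
    proof (cases "Lp_norm p1 M g")
      case (real n)
      show ?thesis
      proof (rule ennreal_le_epsilon)
        fix e :: real assume e: "0 < e"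
        have "Lp_norm p M g \<le> ennreal C * ennreal (n + e / C)"
          using e C real by (intro main) (simp_all add: ennreal_leI add_nonneg_pos del: ennreal_plus)
        also have "\<dots> = ennreal C * Lp_norm p1 M g + ennreal e"
          using e C real by (simp add: ennreal_mult[symmetric] ennreal_plus[symmetric] distrib_left del: ennreal_plus)
        finally show "Lp_norm p M g \<le> ennreal C * Lp_norm p1 M g + ennreal e" .
      qed
    qed (use C in \<open>auto simp: ennreal_mult_top\<close>)
  qed (use C in auto)
qed

section \<open>Besov scales\<close>

text \<open>Superlevel sets are closed upwards, hence empty, the whole line or a half-line. The
  moduli are monotone in \<tau> and therefore Borel.\<close>

lemma borel_measurable_mono_ennreal:
  fixes w :: "real \<Rightarrow> ennreal"
  assumes "mono w"
  shows "w \<in> borel_measurable borel"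
proof (rule borel_measurableI_greater)
  fix y
  define U where "U = {x. y < w x}"
  have up: "x' \<in> U" if "x \<in> U" "x \<le> x'" for x x'
    using that monoD[OF assms, of x x'] by (auto simp: U_def)
  consider "U = {}" | "\<not> bdd_below U" | "U \<noteq> {}" "bdd_below U" by auto
  then have "U \<in> sets borel"
  proof cases
    case 2
    then have "U = UNIV"
      using up by (auto simp: bdd_below_def) (metis linorder_linear)
    then show ?thesis by simp
  next
    case 3
    have "x \<in> U" if "Inf U < x" for x
      using that up 3 by (metis cInf_less_iff less_imp_le)
    moreover have "Inf U \<le> x" if "x \<in> U" for x
      using that 3 by (auto intro: cInf_lower)
    ultimately have "U = (if Inf U \<in> U then {Inf U..} else {Inf U<..})"
      by (auto simp: less_le)
    then show ?thesis by (metis borel_closed borel_open closed_atLeast open_greaterThan)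
  qed auto
  then show "{x \<in> space borel. y < w x} \<in> sets borel" by (simp add: U_def)
qed

lemma measurable_lebesgue_affine:
  "c \<noteq> 0 \<Longrightarrow> (\<lambda>x::real. t + c * x) \<in> lebesgue \<rightarrow>\<^sub>M lebesgue"
  using lebesgue_affine_measurable[where c="\<lambda>x::real. c"] by simp

lemma AE_lebesgue_affine:
  fixes c t :: real
  assumes "c \<noteq> 0" "AE x in lebesgue. P x"
  shows "AE x in lebesgue. P (t + c * x)"
proof -
  have "AE x in density (distr lebesgue lebesgue (\<lambda>x. t + c * x)) (\<lambda>_. ennreal \<bar>c\<bar>). P x"
    using assms(2) by (simp only: lebesgue_real_affine[OF assms(1), of t, symmetric])
  then have "AE x in distr lebesgue lebesgue (\<lambda>x. t + c * x). P x"
    using assms(1) by (subst (asm) AE_density) auto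
  then show ?thesis by (rule AE_distrD[OF measurable_lebesgue_affine[OF assms(1)]])
qed

abbreviation segment :: "real \<Rightarrow> real \<Rightarrow> real measure" where
  "segment T h \<equiv> lebesgue_on {0..T - h}"

context
  fixes a h H T :: real
  assumes ah: "0 \<le> a" "a + h \<le> H"
begin

text \<open>A piece [r + a, r + a + h] of [r, r + H] starts at r + a, and a + h \<le> H makes this
  shift map the base points for \<open>H\<close> into those for \<open>h\<close>. Properties along
  the line of lag \<open>h\<close> thus pass to pieces of longer intervals.\<close>

lemma measurable_shift:
  assumes "g \<in> segment T h \<rightarrow>\<^sub>M N"
  shows "(\<lambda>r. g (r + a)) \<in> segment T H \<rightarrow>\<^sub>M N"
proof -
  have "(\<lambda>r. a + 1 * r) \<in> segment T H \<rightarrow>\<^sub>M segment T h"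
    using ah by (intro measurable_restrict_space2 measurable_restrict_space1 measurable_lebesgue_affine) auto
  from measurable_compose[OF this assms] show ?thesis by (simp add: add.commute)
qed

lemma AE_shift:
  assumes "AE r in segment T h. P r"
  shows "AE r in segment T H. P (r + a)"
proof -
  have "AE r in lebesgue. r \<in> {0..T - h} \<longrightarrow> P r"
    using assms by (simp add: AE_restrict_space_iff)
  then have "AE r in lebesgue. a + 1 * r \<in> {0..T - h} \<longrightarrow> P (a + 1 * r)"
    by (intro AE_lebesgue_affine[where P = "\<lambda>r. r \<in> {0..T - h} \<longrightarrow> P r"]) simp
  then have "AE r in lebesgue. r \<in> {0..T - H} \<longrightarrow> P (r + a)"
    by eventually_elim (use ah in \<open>auto simp: add.commute\<close>)
  then show ?thesis by (simp add: AE_restrict_space_iff)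
qed

lemma Lp_norm_shift:
  assumes p: "0 < p" and g: "g \<in> borel_measurable (segment T h)"
  shows "Lp_norm p (segment T H) (\<lambda>r. g (r + a)) \<le> Lp_norm p (segment T h) g"
proof (cases "p = top")
  case True
  have "AE r in segment T h. g r \<le> Lp_norm p (segment T h) g"
    using True esssup_AE by (simp add: Lp_norm_def)
  from AE_shift[OF this] show ?thesis
    using True p g by (simp add: Lp_norm_le_iff measurable_shift)
next
  case False
  then have p': "0 < enn2real p" using p by (simp add: enn2real_pos)
  let ?G = "\<lambda>x. epowr (g x) (enn2real p) * indicator {0..T - h} x"
  have G: "?G \<in> borel_measurable lebesgue"
    using g p' borel_measurable_epowr[OF g p'] by (subst (asm) borel_measurable_restrict_space_iff_ennreal) auto
  have "(\<integral>\<^sup>+r. epowr (g (r + a)) (enn2real p) \<partial>segment T H) =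
      (\<integral>\<^sup>+r. epowr (g (r + a)) (enn2real p) * indicator {0..T - H} r \<partial>lebesgue)"
    by (simp add: nn_integral_restrict_space)
  also have "\<dots> \<le> (\<integral>\<^sup>+r. ?G (a + 1 * r) \<partial>lebesgue)"
    using ah by (intro nn_integral_mono) (auto simp: indicator_def add.commute)
  also have "\<dots> = (\<integral>\<^sup>+r. ?G r \<partial>lebesgue)"
    using nn_integral_real_affine_lebesgue[OF G, of 1 a] by simp
  also have "\<dots> = epowr (Lp_norm p (segment T h) g) (enn2real p)"
    using p False by (simp add: Lp_norm_finite_pow nn_integral_restrict_space)
  finally show ?thesis
    using p False g by (simp add: Lp_norm_le_iff measurable_shift)
qed

end

lemma Lp_norm_add_le:
  assumes "0 < \<rho>" "\<rho> \<le> 1" "ennreal \<rho> \<le> p"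
    and [measurable]: "f \<in> borel_measurable M" "g \<in> borel_measurable M" "k \<in> borel_measurable M"
    and le: "AE x in M. k x \<le> f x + g x"
  shows "epowr (Lp_norm p M k) \<rho> \<le> epowr (Lp_norm p M f) \<rho> + epowr (Lp_norm p M g) \<rho>"
proof -
  have "epowr (Lp_norm p M k) \<rho> \<le> (\<Sum>i\<in>{True, False}. epowr (Lp_norm p M (if i then f else g)) \<rho>)"
  proof (rule Lp_norm_rho_sum)
    show "AE x in M. epowr (k x) \<rho> \<le> (\<Sum>i\<in>{True, False}. epowr ((if i then f else g) x) \<rho>)"
      using le
    proof eventually_elim
      case (elim x)
      then have "epowr (k x) \<rho> \<le> epowr (f x + g x) \<rho>" using assms by (intro epowr_mono) auto
      also have "\<dots> \<le> epowr (f x) \<rho> + epowr (g x) \<rho>" using assms by (intro epowr_add_le) auto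
      finally show ?case by simp
    qed
  qed (use assms in auto)
  then show ?thesis by simp
qed

text \<open>Leaves the \<rho>-th powers: a^\<rho> + b^\<rho> \<le> 2 (a + b)^\<rho> is the source of
  the quasi-norm constant 2^(1/\<rho>).\<close>

lemma epowr_add_leD:
  assumes "0 < \<rho>" "epowr x \<rho> \<le> epowr a \<rho> + epowr b \<rho>"
  shows "x \<le> ennreal (2 powr (1 / \<rho>)) * (a + b)"
proof -
  have "epowr a \<rho> + epowr b \<rho> \<le> epowr (a + b) \<rho> + epowr (a + b) \<rho>"
    using assms(1) by (intro add_mono epowr_mono) auto
  also have "\<dots> = epowr (ennreal (2 powr (1 / \<rho>)) * (a + b)) \<rho>"
    using assms(1) by (simp add: epowr_mult powr_powr mult_2[symmetric])
  finally show ?thesis using assms by (metis epowr_le_iff order_trans)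
qed

lemma exists_rho:
  assumes "0 \<le> a" "a < 1" "ennreal a < p"
  obtains \<rho> where "a < \<rho>" "\<rho> < 1" "ennreal \<rho> < p"
proof -
  have "ennreal a < min 1 p" using assms by (simp add: ennreal_less_one_iff)
  then obtain z where z: "ennreal a < z" "z < min 1 p" by (meson dense)
  then obtain r where "z = ennreal r" "0 \<le> r" by (cases z) auto
  then show ?thesis using that[of r] z assms by (auto simp: ennreal_less_iff ennreal_less_one_iff)
qed

lemma divide_ennreal_pos: "0 < y \<Longrightarrow> x / ennreal y = x * ennreal (inverse y)"
  by (simp add: divide_ennreal_def inverse_ennreal)

lemma divide_powr_scale:
  assumes "0 < c" "0 < \<tau>"
  shows "ennreal (c powr \<gamma>) * (x / ennreal ((c * \<tau>) powr \<gamma>)) = x / ennreal (\<tau> powr \<gamma>)"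
proof -
  have "ennreal (inverse (\<tau> powr \<gamma>)) = ennreal (c powr \<gamma>) * ennreal (inverse ((c * \<tau>) powr \<gamma>))"
    using assms by (simp add: ennreal_mult[symmetric] powr_mult)
  then show ?thesis using assms by (simp add: divide_ennreal_pos mult.left_commute)
qed

section \<open>The dilation-invariant measure of the Besov scale\<close>

abbreviation log_measure :: "real \<Rightarrow> real measure" where
  "log_measure T \<equiv> density (lebesgue_on {0<..T}) (\<lambda>\<tau>. ennreal (1 / \<tau>))"

lemma log_measure_measurable [measurable (raw)]:
  "f \<in> borel_measurable borel \<Longrightarrow> f \<in> borel_measurable (log_measure T)"
  by (simp add: measurable_completion measurable_restrict_space1)

lemma nn_integral_log_measure:
  assumes [measurable]: "f \<in> borel_measurable borel"
  shows "(\<integral>\<^sup>+\<tau>. f \<tau> \<partial>log_measure T) = (\<integral>\<^sup>+\<tau>. f \<tau> * ennreal (1 / \<tau>) * indicator {0<..T} \<tau> \<partial>lborel)"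
proof -
  have "(\<integral>\<^sup>+\<tau>. f \<tau> \<partial>log_measure T) = (\<integral>\<^sup>+\<tau>. ennreal (1 / \<tau>) * f \<tau> \<partial>lebesgue_on {0<..T})"
    by (intro nn_integral_density) (auto intro!: measurable_restrict_space1 measurable_completion)
  also have "\<dots> = (\<integral>\<^sup>+\<tau>. f \<tau> * ennreal (1 / \<tau>) * indicator {0<..T} \<tau> \<partial>lborel)"
    by (simp add: nn_integral_restrict_space nn_integral_completion mult.commute mult.left_commute)
  finally show ?thesis .
qed

lemma AE_log_measure:
  "(AE \<tau> in log_measure T. P \<tau>) \<longleftrightarrow> (AE \<tau> in lborel. 0 < \<tau> \<and> \<tau> \<le> T \<longrightarrow> P \<tau>)"
proof -
  have "(AE \<tau> in log_measure T. P \<tau>) \<longleftrightarrow> (AE \<tau> in lebesgue_on {0<..T}. 0 < ennreal (1 / \<tau>) \<longrightarrow> P \<tau>)"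
    by (intro AE_density) (auto intro!: measurable_restrict_space1 measurable_completion)
  also have "\<dots> \<longleftrightarrow> (AE \<tau> in lborel. \<tau> \<in> {0<..T} \<longrightarrow> 0 < ennreal (1 / \<tau>) \<longrightarrow> P \<tau>)"
    by (simp add: AE_restrict_space_iff AE_completion_iff)
  also have "\<dots> \<longleftrightarrow> (AE \<tau> in lborel. 0 < \<tau> \<and> \<tau> \<le> T \<longrightarrow> P \<tau>)"
    by (intro AE_cong) auto
  finally show ?thesis .
qed

lemma nn_integral_log_measure_mono:
  assumes "f \<in> borel_measurable borel" "T \<le> T'"
  shows "(\<integral>\<^sup>+\<tau>. f \<tau> \<partial>log_measure T) \<le> (\<integral>\<^sup>+\<tau>. f \<tau> \<partial>log_measure T')"
  using assms by (auto simp: nn_integral_log_measure intro!: nn_integral_mono split: split_indicator)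

lemma Besov_scale_mono:
  assumes q: "0 < q" and [measurable]: "w \<in> borel_measurable borel" "w' \<in> borel_measurable borel"
    and le: "\<And>\<tau>. 0 < \<tau> \<Longrightarrow> \<tau> \<le> T \<Longrightarrow> w \<tau> / ennreal (\<tau> powr \<gamma>) \<le> w' \<tau> / ennreal (\<tau> powr \<gamma>')"
  shows "Besov_scale T \<gamma> q w \<le> Besov_scale T \<gamma>' q w'"
  unfolding Besov_scale_def
  by (rule Lp_norm_AE_le[OF q log_measure_measurable log_measure_measurable])
    (use le in \<open>auto simp: AE_log_measure\<close>)

lemma Besov_scale_mono':
  assumes "0 < q" "w \<in> borel_measurable borel" "w' \<in> borel_measurable borel"
    and "\<And>\<tau>. 0 < \<tau> \<Longrightarrow> \<tau> \<le> T \<Longrightarrow> w \<tau> \<le> w' \<tau>"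
  shows "Besov_scale T \<gamma> q w \<le> Besov_scale T \<gamma> q w'"
  using assms by (intro Besov_scale_mono divide_right_mono_ennreal) auto

lemma Besov_scale_cmult:
  assumes "0 < q" and [measurable]: "w \<in> borel_measurable borel"
  shows "Besov_scale T \<gamma> q (\<lambda>\<tau>. ennreal c * w \<tau>) \<le> ennreal c * Besov_scale T \<gamma> q w"
  unfolding Besov_scale_def ennreal_times_divide[symmetric]
  by (intro Lp_norm_cmult log_measure_measurable assms) measurable

text \<open>Invariance of d\<tau>/\<tau> under dilation leaves only the weight, which contributes
  c^\<gamma>; the domain (0,T] becomes (0,cT], contained in (0,T'].\<close>

lemma Besov_scale_rescale:
  assumes q: "0 < q" and c: "0 < c" "c * T \<le> T'" and [measurable]: "w \<in> borel_measurable borel"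
  shows "Besov_scale T \<gamma> q (\<lambda>\<tau>. w (c * \<tau>)) \<le> ennreal (c powr \<gamma>) * Besov_scale T' \<gamma> q w"
proof -
  have eq: "w (c * \<tau>) / ennreal (\<tau> powr \<gamma>) = ennreal (c powr \<gamma>) * (w (c * \<tau>) / ennreal ((c * \<tau>) powr \<gamma>))"
    if "0 < \<tau>" for \<tau>
    using divide_powr_scale[OF c(1) that] by simp
  define g where "g \<tau> = w \<tau> / ennreal (\<tau> powr \<gamma>)" for \<tau>
  have [measurable]: "g \<in> borel_measurable borel" unfolding g_def by measurable
  have "Besov_scale T \<gamma> q (\<lambda>\<tau>. w (c * \<tau>)) = Lp_norm q (log_measure T) (\<lambda>\<tau>. ennreal (c powr \<gamma>) * g (c * \<tau>))"
    unfolding Besov_scale_def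
  proof (rule Lp_norm_cong_AE[OF q log_measure_measurable log_measure_measurable])
    show "AE \<tau> in log_measure T. w (c * \<tau>) / ennreal (\<tau> powr \<gamma>) = ennreal (c powr \<gamma>) * g (c * \<tau>)"
      unfolding AE_log_measure g_def using eq by (intro AE_I2) blast
  qed measurable
  also have "\<dots> \<le> ennreal (c powr \<gamma>) * Lp_norm q (log_measure T) (\<lambda>\<tau>. g (c * \<tau>))"
    by (intro Lp_norm_cmult q log_measure_measurable) measurable
  also have "Lp_norm q (log_measure T) (\<lambda>\<tau>. g (c * \<tau>)) \<le> Lp_norm q (log_measure T') g"
  proof (cases "q = top")
    case True
    define N where "N = Lp_norm q (log_measure T') g"
    have "AE \<tau> in log_measure T'. g \<tau> \<le> N" using True esssup_AE by (simp add: Lp_norm_def N_def)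
    then have "AE \<tau> in lborel. 0 < \<tau> \<and> \<tau> \<le> T' \<longrightarrow> g \<tau> \<le> N" by (simp add: AE_log_measure)
    from AE_borel_affine[OF _ _ this, of c 0]
    have "AE \<tau> in lborel. 0 < c * \<tau> \<and> c * \<tau> \<le> T' \<longrightarrow> g (c * \<tau>) \<le> N" using c by simp
    then have "AE \<tau> in lborel. 0 < \<tau> \<and> \<tau> \<le> T \<longrightarrow> g (c * \<tau>) \<le> N"
    proof eventually_elim
      case (elim \<tau>)
      have "c * \<tau> \<le> T'" if "\<tau> \<le> T" using that c mult_left_mono[of \<tau> T c] by linarith
      then show ?case using elim c by auto
    qed
    then have "Lp_norm q (log_measure T) (\<lambda>\<tau>. g (c * \<tau>)) \<le> N"
      by (subst Lp_norm_le_iff[OF q log_measure_measurable]) (simp_all add: AE_log_measure True)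
    then show ?thesis by (simp add: N_def)
  next
    case False
    then have q': "0 < enn2real q" using q by (simp add: enn2real_pos)
    let ?F = "\<lambda>\<tau>. epowr (g \<tau>) (enn2real q) * ennreal (1 / \<tau>) * indicator {0<..T'} \<tau>"
    have [measurable]: "(\<lambda>\<tau>. epowr (g \<tau>) (enn2real q)) \<in> borel_measurable borel" using q' by simp
    have "(\<integral>\<^sup>+\<tau>. epowr (g (c * \<tau>)) (enn2real q) \<partial>log_measure T) =
      (\<integral>\<^sup>+\<tau>. epowr (g (c * \<tau>)) (enn2real q) * ennreal (1 / \<tau>) * indicator {0<..T} \<tau> \<partial>lborel)"
      using q' by (subst nn_integral_log_measure) auto
    also have "\<dots> \<le> (\<integral>\<^sup>+\<tau>. ennreal c * ?F (0 + c * \<tau>) \<partial>lborel)"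
    proof (rule nn_integral_mono)
      fix \<tau> :: real
      have "c * \<tau> \<le> T'" if "\<tau> \<le> T" using that c mult_left_mono[of \<tau> T c] by linarith
      moreover have "ennreal (1 / \<tau>) = ennreal c * ennreal (1 / (c * \<tau>))" if "0 < \<tau>"
        using c that by (simp add: ennreal_mult[symmetric])
      ultimately show "epowr (g (c * \<tau>)) (enn2real q) * ennreal (1 / \<tau>) * indicator {0<..T} \<tau> \<le> ennreal c * ?F (0 + c * \<tau>)"
        using c by (auto simp: mult_ac split: split_indicator)
    qed
    also have "\<dots> = ennreal \<bar>c\<bar> * (\<integral>\<^sup>+\<tau>. ?F (0 + c * \<tau>) \<partial>lborel)"
      using c by (subst nn_integral_cmult) auto
    also have "\<dots> = (\<integral>\<^sup>+\<tau>. ?F \<tau> \<partial>lborel)"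
      using c by (intro nn_integral_real_affine[symmetric]) auto
    also have "\<dots> = (pow_integral (log_measure T') (enn2real q) g)"
      by (intro nn_integral_log_measure[symmetric]) auto
    also have "\<dots> = epowr (Lp_norm q (log_measure T') g) (enn2real q)"
      using q False by (simp add: Lp_norm_finite_pow)
    finally show ?thesis
      by (subst Lp_norm_le_iff[OF q log_measure_measurable]) (simp_all add: False)
  qed
  then have "ennreal (c powr \<gamma>) * Lp_norm q (log_measure T) (\<lambda>\<tau>. g (c * \<tau>)) \<le> ennreal (c powr \<gamma>) * Besov_scale T' \<gamma> q w"
    unfolding Besov_scale_def g_def by (rule mult_left_mono) auto
  finally show ?thesis .
qed

lemma Besov_scale_add_le:
  assumes "0 < \<rho>" "\<rho> \<le> 1" "ennreal \<rho> \<le> q"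
    and [measurable]: "w \<in> borel_measurable borel" "w' \<in> borel_measurable borel"
  shows "Besov_scale T \<gamma> q (\<lambda>\<tau>. w \<tau> + w' \<tau>) \<le>
    ennreal (2 powr (1 / \<rho>)) * (Besov_scale T \<gamma> q w + Besov_scale T \<gamma> q w')"
  unfolding Besov_scale_def
  by (rule epowr_add_leD[OF assms(1)], rule Lp_norm_add_le[OF assms(1-3)
      log_measure_measurable log_measure_measurable log_measure_measurable])
    (auto simp: add_divide_distrib_ennreal)

lemma Besov_scale_mono_T:
  assumes q: "0 < q" and T: "T \<le> T'" and [measurable]: "w \<in> borel_measurable borel"
  shows "Besov_scale T \<gamma> q w \<le> Besov_scale T' \<gamma> q w"
  using Besov_scale_rescale[OF q, of 1 T T' w \<gamma>] T by simp

text \<open>Since \<open>w\<close> is monotone, its value at \<tau> is dominated by those on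
  [\<tau>, 2\<tau>], a set of mass at least 1/2 under d\<tau>/\<tau>; this gives 2^(1/q). Replacing
  the weight (2\<tau>)^\<gamma> by \<tau>^\<gamma> gives 2^\<gamma>. The bound \<tau> \<le> T / 2
  keeps the interval inside (0,T].\<close>

lemma Besov_scale_pointwise:
  assumes q: "0 < q" "q \<noteq> top" and \<gamma>: "0 \<le> \<gamma>" and w: "mono w" and \<tau>: "0 < \<tau>" "\<tau> \<le> T / 2"
  shows "w \<tau> / ennreal (\<tau> powr \<gamma>) \<le> ennreal (2 powr \<gamma> * 2 powr (1 / enn2real q)) * Besov_scale T \<gamma> q w"
proof -
  define N where "N = Besov_scale T \<gamma> q w"
  define r where "r = enn2real q"
  have r: "0 < r" using q by (simp add: r_def enn2real_positive_iff top.not_eq_extremum)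
  have [measurable]: "w \<in> borel_measurable borel" by (rule borel_measurable_mono_ennreal[OF w])
  have [measurable]: "(\<lambda>\<sigma>. epowr (w \<sigma> / ennreal (\<sigma> powr \<gamma>)) r) \<in> borel_measurable borel"
    using r by measurable
  let ?x = "w \<tau> / ennreal ((2 * \<tau>) powr \<gamma>)"
  have "epowr ?x r * ennreal (1 / 2) = epowr ?x r * ennreal (1 / (2 * \<tau>)) * ennreal \<tau>"
    using \<tau> by (simp add: ennreal_mult[symmetric] mult.assoc)
  also have "\<dots> = (\<integral>\<^sup>+\<sigma>. epowr ?x r * ennreal (1 / (2 * \<tau>)) * indicator {\<tau>..2 * \<tau>} \<sigma> \<partial>lborel)"
    using \<tau> by (subst nn_integral_cmult_indicator) auto
  also have "\<dots> \<le> (\<integral>\<^sup>+\<sigma>. epowr (w \<sigma> / ennreal (\<sigma> powr \<gamma>)) r * ennreal (1 / \<sigma>) * indicator {0<..T} \<sigma> \<partial>lborel)"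
  proof (rule nn_integral_mono)
    fix \<sigma>
    show "epowr ?x r * ennreal (1 / (2 * \<tau>)) * indicator {\<tau>..2 * \<tau>} \<sigma> \<le>
      epowr (w \<sigma> / ennreal (\<sigma> powr \<gamma>)) r * ennreal (1 / \<sigma>) * indicator {0<..T} \<sigma>"
    proof (cases "\<sigma> \<in> {\<tau>..2 * \<tau>}")
      case True
      then have \<sigma>: "0 < \<sigma>" "\<sigma> \<le> T" "\<tau> \<le> \<sigma>" "\<sigma> \<le> 2 * \<tau>" using \<tau> by auto
      then have "?x \<le> w \<sigma> / ennreal (\<sigma> powr \<gamma>)"
        using \<tau> monoD[OF w, of \<tau> \<sigma>] \<gamma>
        by (auto simp: divide_ennreal_pos intro!: mult_mono ennreal_leI le_imp_inverse_le powr_mono2)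
      then show ?thesis using \<sigma> \<tau> r
        by (auto intro!: mult_mono epowr_mono ennreal_leI divide_left_mono)
    qed auto
  qed
  also have "\<dots> = (\<integral>\<^sup>+\<sigma>. epowr (w \<sigma> / ennreal (\<sigma> powr \<gamma>)) r \<partial>log_measure T)"
    by (intro nn_integral_log_measure[symmetric]) auto
  also have "\<dots> = epowr N r"
    using q by (simp add: N_def Besov_scale_def Lp_norm_finite_pow r_def)
  finally have "ennreal 2 * (epowr ?x r * ennreal (1 / 2)) \<le> ennreal 2 * epowr N r"
    by (rule mult_left_mono) auto
  also have "ennreal 2 * (epowr ?x r * ennreal (1 / 2)) = epowr ?x r"
    using ennreal_mult[of 2 "1 / 2"] by (simp only: mult.left_commute[of "ennreal 2"]) simp
  also have "ennreal 2 * epowr N r = epowr (ennreal (2 powr (1 / r)) * N) r"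
    using r by (simp add: epowr_mult powr_powr)
  finally have "?x \<le> ennreal (2 powr (1 / r)) * N"
    using r by (simp only: epowr_le_iff)
  then have "ennreal (2 powr \<gamma>) * ?x \<le> ennreal (2 powr \<gamma>) * (ennreal (2 powr (1 / r)) * N)"
    by (rule mult_left_mono) auto
  also have "ennreal (2 powr \<gamma>) * ?x = w \<tau> / ennreal (\<tau> powr \<gamma>)"
    using \<tau> by (intro divide_powr_scale) auto
  finally show ?thesis by (simp add: N_def r_def ennreal_mult mult.assoc)
qed

text \<open>Halving the interval is essential: \<open>w\<close> may blow up at \<open>T\<close> although its \<open>q\<close>-norm is finite.\<close>

lemma Besov_scale_embedding:
  assumes q: "0 < q" "q \<le> r" and \<gamma>: "0 \<le> \<gamma>" "\<gamma> \<le> G" and T: "0 < T" and w: "mono w"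
  shows "Besov_scale (T / 2) \<gamma> r w \<le> ennreal (2 powr G * 2 powr (1 / enn2real q)) * Besov_scale T \<gamma> q w"
proof -
  define N where "N = Besov_scale T \<gamma> q w"
  \<comment> \<open>The exponent \<open>G\<close> in place of \<gamma> makes the constant uniform in
    \<gamma> \<le> G; with G = 1 it later serves all \<alpha> < 1.\<close>
  define K where "K = 2 powr G * 2 powr (1 / enn2real q)"
  have [measurable]: "w \<in> borel_measurable borel" by (rule borel_measurable_mono_ennreal[OF w])
  have "1 * 1 \<le> K" unfolding K_def using \<gamma> by (intro mult_mono ge_one_powr_ge_zero) auto
  then have K: "1 \<le> K" by simp
  have r0: "0 < r" using q by auto
  consider "q = top" | "N = top" | n where "q \<noteq> top" "N = ennreal n" "0 \<le> n" by (cases N) auto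
  then have "Besov_scale (T / 2) \<gamma> r w \<le> ennreal K * N"
  proof cases
    case 1
    then have "r = q" using q by (simp add: top_unique)
    then have "Besov_scale (T / 2) \<gamma> r w \<le> 1 * N"
      using Besov_scale_mono_T[of q "T / 2" T w \<gamma>] q T by (simp add: N_def)
    also have "\<dots> \<le> ennreal K * N" using K by (intro mult_right_mono) auto
    finally show ?thesis .
  next
    case 2
    then show ?thesis using K by (simp add: ennreal_mult_top)
  next
    case (3 n)
    define s where "s = enn2real q"
    have s: "0 < s" "q = ennreal s" using q(1) 3 by (auto simp: s_def enn2real_positive_iff top.not_eq_extremum)
    define g where "g \<tau> = w \<tau> / ennreal (\<tau> powr \<gamma>)" for \<tau>
    have [measurable]: "g \<in> borel_measurable borel" unfolding g_def by measurable
    have g: "g \<tau> \<le> ennreal (K * n)" if "0 < \<tau>" "\<tau> \<le> T / 2" for \<tau>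
    proof -
      have "g \<tau> \<le> ennreal (2 powr \<gamma> * 2 powr (1 / enn2real q)) * N"
        unfolding g_def N_def by (rule Besov_scale_pointwise) (use that q 3 \<gamma> w in auto)
      also have "\<dots> \<le> ennreal K * N"
        unfolding K_def using \<gamma> by (intro mult_right_mono ennreal_leI) auto
      finally show ?thesis using 3 K by (simp add: ennreal_mult)
    qed
    have Kn: "n \<le> K * n" using K 3 mult_right_mono[of 1 K n] by simp
    show ?thesis
    proof (cases "r = top")
      case True
      then have "Lp_norm r (log_measure (T / 2)) g \<le> ennreal (K * n)"
        using g r0 log_measure_measurable[of g "T / 2"] by (simp add: Lp_norm_le_iff AE_log_measure)
      then show ?thesis using 3 K by (simp add: Besov_scale_def g_def[abs_def] ennreal_mult)
    next
      case False
      define t where "t = enn2real r"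
      have t: "0 < t" "r = ennreal t" using r0 False by (auto simp: t_def enn2real_positive_iff top.not_eq_extremum)
      then have st: "s \<le> t" using q s by (simp add: ennreal_le_iff)
      have [measurable]: "(\<lambda>\<sigma>. epowr (g \<sigma>) s) \<in> borel_measurable borel" using s by measurable
      \<comment> \<open>Interpolation: the pointwise bound absorbs the power t - s, and only the
        power s is integrated.\<close>
      have le: "epowr (g \<tau>) t \<le> ennreal ((K * n) powr (t - s)) * epowr (g \<tau>) s" if \<tau>: "0 < \<tau>" "\<tau> \<le> T / 2" for \<tau>
      proof -
        obtain x where x: "g \<tau> = ennreal x" "0 \<le> x" "x \<le> K * n"
          using g[OF \<tau>] K 3 by (cases "g \<tau>") (auto simp: top_unique ennreal_le_iff)
        have "x powr t = x powr (t - s) * x powr s" by (simp add: powr_add[symmetric])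
        also have "\<dots> \<le> (K * n) powr (t - s) * x powr s"
          using x st by (intro mult_right_mono powr_mono2) auto
        finally show ?thesis using x by (simp add: ennreal_mult[symmetric] ennreal_leI)
      qed
      have "(pow_integral (log_measure (T / 2)) t g) \<le>
          (\<integral>\<^sup>+\<tau>. ennreal ((K * n) powr (t - s)) * epowr (g \<tau>) s \<partial>log_measure (T / 2))"
        using le by (intro nn_integral_mono_AE) (simp add: AE_log_measure)
      also have "\<dots> = ennreal ((K * n) powr (t - s)) * (pow_integral (log_measure (T / 2)) s g)"
        by (intro nn_integral_cmult) measurable
      also have "\<dots> \<le> ennreal ((K * n) powr (t - s)) * (pow_integral (log_measure T) s g)"
        using T by (intro mult_left_mono nn_integral_log_measure_mono) auto
      also have "(pow_integral (log_measure T) s g) = epowr N s"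
        using Lp_norm_finite_pow[of q "log_measure T" g] 3(1) q(1)
        by (simp add: s_def g_def[abs_def] N_def Besov_scale_def)
      also have "ennreal ((K * n) powr (t - s)) * epowr N s = ennreal ((K * n) powr (t - s) * n powr s)"
        using 3 by (simp add: ennreal_mult)
      also have "\<dots> \<le> ennreal ((K * n) powr (t - s) * (K * n) powr s)"
        using 3 s Kn by (intro ennreal_leI mult_left_mono powr_mono2) auto
      also have "\<dots> = epowr (ennreal (K * n)) t"
        using 3 K by (simp add: powr_add[symmetric])
      finally have "Lp_norm r (log_measure (T / 2)) g \<le> ennreal (K * n)"
        using False r0 log_measure_measurable[of g "T / 2"] by (simp add: Lp_norm_le_iff t_def)
      then show ?thesis using 3 K by (simp add: Besov_scale_def g_def[abs_def] ennreal_mult)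
    qed
  qed
  then show ?thesis by (simp add: K_def N_def)
qed

text \<open>Level k of repeated halving has at most 2^k subintervals, and each of them costs two
  values of \<open>delta A\<close>; this is the weight 2^(k+1).\<close>

definition dyadic_sum :: "real \<Rightarrow> (real \<Rightarrow> ennreal) \<Rightarrow> real \<Rightarrow> ennreal" where
  "dyadic_sum \<rho> w \<tau> = (\<Sum>k. ennreal (2 * 2 ^ k) * epowr (w ((1 / 2) ^ k * \<tau>)) \<rho>)"

lemma suminf_geometric_ennreal:
  fixes x :: real
  assumes "0 \<le> x" "x < 1" "0 \<le> a"
  shows "(\<Sum>k. ennreal (a * x ^ k)) = ennreal (a / (1 - x))"
proof (rule suminf_ennreal_eq)
  show "(\<lambda>k. a * x ^ k) sums (a / (1 - x))"
    using sums_mult[OF geometric_sums[of x], of a] assms by simp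
qed (use assms in auto)

text \<open>The \<rho>-th powers sit inside a q-quasi-norm, with no order between \<rho> and q. An
  intermediate smoothness \<beta> between 1/\<rho> and \<gamma> decouples them: \<beta>\<rho> > 1
  turns the \<rho>-sum into an ordinary sum, and the remaining \<gamma> - \<beta> makes that sum
  converge in the scale. \<open>C\<close> depends on \<rho>, \<gamma> and q only.\<close>

lemma Besov_scale_dyadic_sum:
  assumes \<rho>: "0 < \<rho>" "1 < \<gamma> * \<rho>" and q: "0 < q"
  shows "\<exists>C\<ge>0. \<forall>T w u. mono w \<longrightarrow> 0 < T \<longrightarrow> u \<in> borel_measurable borel \<longrightarrow>
    (\<forall>\<tau>. 0 < \<tau> \<longrightarrow> \<tau> \<le> T \<longrightarrow> epowr (u \<tau>) \<rho> \<le> dyadic_sum \<rho> w \<tau>) \<longrightarrow>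
    Besov_scale T \<gamma> q u \<le> ennreal C * Besov_scale T \<gamma> q w"
proof -
  define \<beta> where "\<beta> = (\<gamma> + 1 / \<rho>) / 2"
  have "1 / \<rho> < \<gamma>" using \<rho> by (simp add: field_simps)
  then have \<beta>: "1 < \<beta> * \<rho>" "\<beta> < \<gamma>" using \<rho> by (auto simp: \<beta>_def field_simps)
  \<comment> \<open>With \<sigma> below 1 and q, the \<sigma>-th power of the q-quasi-norm is
    subadditive.\<close>
  obtain \<sigma> where \<sigma>: "0 < \<sigma>" "\<sigma> < 1" "ennreal \<sigma> < q" using exists_rho[of 0 q] q by auto
  define x where "x = 2 powr (1 - \<beta> * \<rho>)"
  define y where "y = 2 powr ((\<beta> - \<gamma>) * \<sigma>)"
  have "x < 2 powr 0" unfolding x_def using \<beta> by (intro powr_less_mono) auto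
  then have x: "0 \<le> x" "x < 1" by (auto simp: x_def)
  have "y < 2 powr 0" unfolding y_def using \<beta> \<sigma> by (intro powr_less_mono) (auto simp: mult_neg_pos)
  then have y: "0 \<le> y" "y < 1" by (auto simp: y_def)
  define C where "C = (2 / (1 - x)) powr (1 / \<rho>) * (1 / (1 - y)) powr (1 / \<sigma>)"
  have p2: "((1 / 2) ^ k) powr a = 2 powr (- (real k * a))" for k a
    by (simp add: powr_realpow[symmetric] powr_powr powr_minus powr_divide powr_one_gt_zero_iff field_simps)
  show ?thesis
  proof (intro exI[of _ C] conjI allI impI)
    fix T and w u :: "real \<Rightarrow> ennreal"
    assume w: "mono w" and T: "0 < T" and u[measurable]: "u \<in> borel_measurable borel"
      and le: "\<forall>\<tau>. 0 < \<tau> \<longrightarrow> \<tau> \<le> T \<longrightarrow> epowr (u \<tau>) \<rho> \<le> dyadic_sum \<rho> w \<tau>"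
    have [measurable]: "w \<in> borel_measurable borel" by (rule borel_measurable_mono_ennreal[OF w])
    define N where "N = Besov_scale T \<gamma> q w"
    define v where "v k \<tau> = ennreal (2 powr (k * \<beta>)) * w ((1 / 2) ^ k * \<tau>)" for k :: nat and \<tau> :: real
    have [measurable]: "v k \<in> borel_measurable borel" for k unfolding v_def by measurable
    define S where "S \<tau> = (\<Sum>k. v k \<tau>)" for \<tau>
    have [measurable]: "S \<in> borel_measurable borel" unfolding S_def by measurable
    \<comment> \<open>By definition of \<open>S\<close>, w(2^(-k) \<tau>) \<le> 2^(-k\<beta>)
      S(\<tau>); inserting this into the dyadic sum leaves a geometric series of ratio x <
      1.\<close>
    have uS: "u \<tau> \<le> ennreal ((2 / (1 - x)) powr (1 / \<rho>)) * S \<tau>" if \<tau>: "0 < \<tau>" "\<tau> \<le> T" for \<tau>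
    proof -
      have "ennreal (2 * 2 ^ k) * epowr (w ((1 / 2) ^ k * \<tau>)) \<rho> \<le> ennreal (2 * x ^ k) * epowr (S \<tau>) \<rho>" for k
      proof -
        have "w ((1 / 2) ^ k * \<tau>) = ennreal (2 powr (- (k * \<beta>))) * v k \<tau>"
          by (simp add: v_def mult.assoc[symmetric] ennreal_mult[symmetric] powr_add[symmetric])
        also have "\<dots> \<le> ennreal (2 powr (- (k * \<beta>))) * S \<tau>"
          using sum_le_suminf[of "\<lambda>k. v k \<tau>" "{k}"] by (intro mult_left_mono) (auto simp: S_def)
        finally have "epowr (w ((1 / 2) ^ k * \<tau>)) \<rho> \<le> epowr (ennreal (2 powr (- (k * \<beta>))) * S \<tau>) \<rho>"
          using \<rho> by (intro epowr_mono) auto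
        also have "\<dots> = ennreal (2 powr (- (k * \<beta>) * \<rho>)) * epowr (S \<tau>) \<rho>"
          using \<rho> by (simp add: epowr_mult powr_powr)
        finally have "ennreal (2 * 2 ^ k) * epowr (w ((1 / 2) ^ k * \<tau>)) \<rho> \<le>
            ennreal (2 * 2 ^ k) * (ennreal (2 powr (- (k * \<beta>) * \<rho>)) * epowr (S \<tau>) \<rho>)"
          by (rule mult_left_mono) auto
        also have "\<dots> = ennreal (2 * 2 ^ k * 2 powr (- (k * \<beta>) * \<rho>)) * epowr (S \<tau>) \<rho>"
          by (simp add: ennreal_mult mult.assoc)
        also have "2 * 2 ^ k * 2 powr (- (k * \<beta>) * \<rho>) = 2 * x ^ k"
          by (simp add: x_def powr_realpow[symmetric] powr_powr powr_add[symmetric] algebra_simps)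
        finally show ?thesis .
      qed
      then have "dyadic_sum \<rho> w \<tau> \<le> (\<Sum>k. ennreal (2 * x ^ k) * epowr (S \<tau>) \<rho>)"
        unfolding dyadic_sum_def by (intro suminf_le) auto
      also have "\<dots> = ennreal (2 / (1 - x)) * epowr (S \<tau>) \<rho>"
        using x by (simp only: ennreal_suminf_multc suminf_geometric_ennreal)
      also have "\<dots> = epowr (ennreal ((2 / (1 - x)) powr (1 / \<rho>)) * S \<tau>) \<rho>"
        using \<rho> x by (simp add: epowr_mult powr_powr)
      finally have "epowr (u \<tau>) \<rho> \<le> epowr (ennreal ((2 / (1 - x)) powr (1 / \<rho>)) * S \<tau>) \<rho>"
        by (rule order_trans[OF le[rule_format, OF \<tau>]])
      then show ?thesis by (simp only: epowr_le_iff[OF \<rho>(1)])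
    qed
    have "Besov_scale T \<gamma> q u \<le> Besov_scale T \<gamma> q (\<lambda>\<tau>. ennreal ((2 / (1 - x)) powr (1 / \<rho>)) * S \<tau>)"
      using uS q by (intro Besov_scale_mono') auto
    also have "\<dots> \<le> ennreal ((2 / (1 - x)) powr (1 / \<rho>)) * Besov_scale T \<gamma> q S"
      using q by (intro Besov_scale_cmult) auto
    also have "Besov_scale T \<gamma> q S \<le> ennreal ((1 / (1 - y)) powr (1 / \<sigma>)) * N"
    proof -
      \<comment> \<open>Dilation by 2^(-k) yields 2^(-k\<gamma>), which beats the factor
        2^(k\<beta>) in \<open>v k\<close>.\<close>
      have v: "Besov_scale T \<gamma> q (v k) \<le> ennreal (2 powr (k * (\<beta> - \<gamma>))) * N" for k
      proof -
        have "Besov_scale T \<gamma> q (v k) \<le> ennreal (2 powr (k * \<beta>)) * Besov_scale T \<gamma> q (\<lambda>\<tau>. w ((1 / 2) ^ k * \<tau>))"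
          unfolding v_def using q by (intro Besov_scale_cmult) auto
        also have "\<dots> \<le> ennreal (2 powr (k * \<beta>)) * (ennreal (((1 / 2) ^ k) powr \<gamma>) * N)"
          unfolding N_def using q T
          by (intro mult_left_mono Besov_scale_rescale) (auto simp: power_le_one mult_le_cancel_right1)
        also have "\<dots> = ennreal (2 powr (k * \<beta>) * ((1 / 2) ^ k) powr \<gamma>) * N"
          by (simp add: ennreal_mult mult.assoc)
        also have "2 powr (k * \<beta>) * ((1 / 2) ^ k) powr \<gamma> = 2 powr (k * (\<beta> - \<gamma>))"
          unfolding p2 by (simp add: powr_add[symmetric] algebra_simps)
        finally show ?thesis .
      qed
      have "epowr (Besov_scale T \<gamma> q S) \<sigma> = epowr (Lp_norm q (log_measure T) (\<lambda>\<tau>. \<Sum>k. v k \<tau> / ennreal (\<tau> powr \<gamma>))) \<sigma>"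
        by (simp add: Besov_scale_def S_def ennreal_suminf_divide)
      also have "\<dots> \<le> (\<Sum>k. epowr (Besov_scale T \<gamma> q (v k)) \<sigma>)"
        unfolding Besov_scale_def using \<sigma>
        by (intro Lp_norm_rho_suminf log_measure_measurable) auto
      also have "\<dots> \<le> (\<Sum>k. ennreal (1 * y ^ k) * epowr N \<sigma>)"
      proof (intro suminf_le)
        fix k
        have "epowr (Besov_scale T \<gamma> q (v k)) \<sigma> \<le> epowr (ennreal (2 powr (k * (\<beta> - \<gamma>))) * N) \<sigma>"
          using v \<sigma> by (intro epowr_mono) auto
        also have "\<dots> = ennreal (1 * y ^ k) * epowr N \<sigma>"
          using \<sigma> by (simp add: epowr_mult y_def powr_powr powr_realpow[symmetric] algebra_simps)
        finally show "epowr (Besov_scale T \<gamma> q (v k)) \<sigma> \<le> ennreal (1 * y ^ k) * epowr N \<sigma>" .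
      qed auto
      also have "\<dots> = ennreal (1 / (1 - y)) * epowr N \<sigma>"
        using y by (simp only: ennreal_suminf_multc suminf_geometric_ennreal)
      also have "\<dots> = epowr (ennreal ((1 / (1 - y)) powr (1 / \<sigma>)) * N) \<sigma>"
        using \<sigma> y by (simp add: epowr_mult powr_powr)
      finally show ?thesis using \<sigma> by (simp only: epowr_le_iff)
    qed
    finally show "Besov_scale T \<gamma> q u \<le> ennreal C * Besov_scale T \<gamma> q w"
      by (simp add: C_def N_def ennreal_mult mult.assoc mult_left_mono del: powr_one_eq_one)
  qed (auto simp: C_def)
qed

section \<open>Riemann sums along finite grids\<close>

lemma dyadic_sum_mono:
  assumes "0 < \<rho>" "mono w" "s \<le> t"
  shows "dyadic_sum \<rho> w s \<le> dyadic_sum \<rho> w t"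
  unfolding dyadic_sum_def using assms
  by (intro suminf_le mult_left_mono epowr_mono monoD[OF assms(2)]) auto

lemma dyadic_sum_rec: "dyadic_sum \<rho> w t = 2 * epowr (w t) \<rho> + 2 * dyadic_sum \<rho> w (t / 2)"
proof -
  have "dyadic_sum \<rho> w t = (\<Sum>k. ennreal (2 * 2 ^ Suc k) * epowr (w ((1 / 2) ^ Suc k * t)) \<rho>) + ennreal (2 * 2 ^ 0) * epowr (w ((1 / 2) ^ 0 * t)) \<rho>"
    unfolding dyadic_sum_def
    by (subst suminf_offset[where i = 1]) auto
  also have "(\<Sum>k. ennreal (2 * 2 ^ Suc k) * epowr (w ((1 / 2) ^ Suc k * t)) \<rho>) =
     (\<Sum>k. 2 * (ennreal (2 * 2 ^ k) * epowr (w ((1 / 2) ^ k * (t / 2))) \<rho>))"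
    by (intro suminf_cong) (simp add: ennreal_mult mult.assoc)
  finally show ?thesis by (simp add: ennreal_suminf_cmult dyadic_sum_def add.commute)
qed

text \<open>\<open>Min\<close> of the empty set is unspecified, so the successor is meaningful only
  if \<open>X\<close> has a point beyond \<open>x\<close>; the lemmas secure this by a grid point b
  > x.\<close>

definition nxt :: "real set \<Rightarrow> real \<Rightarrow> real" where
  "nxt X x = Min (X \<inter> {x<..})"

text \<open>Grids are finite sets rather than lists, so that a common refinement is a union. The
  half-open range counts each grid interval by its left end, which makes splitting exact; the last
  interval ends at b when b is a grid point.\<close>

definition grid_sum :: "real set \<Rightarrow> (real \<Rightarrow> real \<Rightarrow> 'v::ab_group_add) \<Rightarrow> real \<Rightarrow> real \<Rightarrow> 'v" where
  "grid_sum X A a b = (\<Sum>x\<in>X \<inter> {a..<b}. A x (nxt X x))"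

lemma nxt_props:
  assumes "finite X" "b \<in> X" "x < b"
  shows "nxt X x \<in> X" "x < nxt X x" "nxt X x \<le> b"
proof -
  have "nxt X x \<in> X \<inter> {x<..}" unfolding nxt_def using assms by (intro Min_in) auto
  then show "nxt X x \<in> X" "x < nxt X x" by auto
  show "nxt X x \<le> b" unfolding nxt_def using assms by (intro Min_le) auto
qed

lemma grid_sum_self [simp]: "grid_sum X A a a = 0"
  by (simp add: grid_sum_def)

lemma grid_sum_split:
  assumes "finite X" "a \<le> u" "u \<le> b"
  shows "grid_sum X A a b = grid_sum X A a u + grid_sum X A u b"
proof -
  have "X \<inter> {a..<b} = (X \<inter> {a..<u}) \<union> (X \<inter> {u..<b})" using assms by auto
  then show ?thesis unfolding grid_sum_def using assms by (subst sum.union_disjoint[symmetric]) auto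
qed

lemma grid_sum_single:
  assumes "finite X" "a \<in> X" "b \<in> X" "a < b" "X \<inter> {a<..<b} = {}"
  shows "grid_sum X A a b = A a b"
proof -
  have *: "X \<inter> {a..<b} = {a}" using assms by force
  have "nxt X a = b" using nxt_props[OF assms(1,3,4)] assms(5) by force
  then show ?thesis by (simp add: grid_sum_def *)
qed

text \<open>The functional \<open>\<nu>\<close> will be the \<open>\<rho>\<close>-th power of an \<open>L\<^sup>p\<close> quasi-norm, \<open>V\<close> the measurable functions.\<close>

locale sewing =
  fixes V :: "'v::ab_group_add set" and \<nu> :: "'v \<Rightarrow> ennreal" and H \<rho> :: real and w :: "real \<Rightarrow> ennreal"
    and A :: "real \<Rightarrow> real \<Rightarrow> 'v"
  assumes V_zero: "0 \<in> V" and V_diff: "x \<in> V \<Longrightarrow> y \<in> V \<Longrightarrow> x - y \<in> V"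
    and \<nu>_zero: "\<nu> 0 = 0" and \<nu>_minus: "\<nu> (- x) = \<nu> x"
    and \<nu>_add: "x \<in> V \<Longrightarrow> y \<in> V \<Longrightarrow> \<nu> (x + y) \<le> \<nu> x + \<nu> y"
    and A_V: "0 \<le> a \<Longrightarrow> a \<le> b \<Longrightarrow> b \<le> H \<Longrightarrow> A a b \<in> V"
    and w_mono: "mono w" and \<rho>_pos: "0 < \<rho>"
    and delta_le: "0 \<le> a \<Longrightarrow> a \<le> u \<Longrightarrow> u \<le> b \<Longrightarrow> b \<le> H \<Longrightarrow> \<nu> (A a b - A a u - A u b) \<le> epowr (w (b - a)) \<rho>"
begin

lemma V_add: "x \<in> V \<Longrightarrow> y \<in> V \<Longrightarrow> x + y \<in> V"
  using V_diff[of x "0 - y"] V_diff[of 0 y] V_zero by simp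

lemma V_sum: "(\<And>i. i \<in> I \<Longrightarrow> f i \<in> V) \<Longrightarrow> sum f I \<in> V"
  by (induction I rule: infinite_finite_induct) (auto intro: V_add V_zero)

lemma grid_sum_V:
  assumes "finite X" "b \<in> X" "0 \<le> a" "b \<le> H"
  shows "grid_sum X A a b \<in> V"
  unfolding grid_sum_def
proof (rule V_sum)
  fix x assume "x \<in> X \<inter> {a..<b}"
  then show "A x (nxt X x) \<in> V"
    using nxt_props[OF assms(1,2), of x] assms by (intro A_V) auto
qed

text \<open>Removing the two points around the midpoint leaves two grids on intervals of at most half the length,
  whence the recursion \<open>dyadic_sum_rec\<close>.\<close>

lemma grid_sum_remainder:
  assumes "finite X" "a \<in> X" "b \<in> X" "0 \<le> a" "a \<le> b" "b \<le> H" "b - a \<le> d"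
  shows "\<nu> (A a b - grid_sum X A a b) \<le> dyadic_sum \<rho> w d"
  using assms(2-)
proof (induction "card (X \<inter> {a<..<b})" arbitrary: a b d rule: less_induct)
  case (less a b d)
  have w_le: "epowr (w t) \<rho> \<le> epowr (w d) \<rho>" if "t \<le> d" for t
    using that \<rho>_pos by (intro epowr_mono monoD[OF w_mono]) auto
  consider "a = b" | "a < b" "X \<inter> {a<..<b} = {}" | "a < b" "X \<inter> {a<..<b} \<noteq> {}"
    using less.prems by fastforce
  then show ?case
  proof cases
    case 1
    \<comment> \<open>The grid sum is empty, but \<open>A a a\<close> need not vanish; up to sign it
      is the defect at a = u = b.\<close>
    have "\<nu> (A a b - grid_sum X A a b) = \<nu> (A a a - A a a - A a a)"
      using \<nu>_minus[of "A a a"] 1 by simp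
    also have "\<dots> \<le> epowr (w (a - a)) \<rho>"
      using less.prems 1 by (intro delta_le) auto
    also have "\<dots> \<le> epowr (w d) \<rho>" using less.prems 1 by (intro w_le) auto
    also have "\<dots> \<le> dyadic_sum \<rho> w d"
      unfolding dyadic_sum_rec[of \<rho> w d] mult_2 by (simp add: add_increasing2 add.assoc)
    finally show ?thesis .
  next
    case 2
    then show ?thesis using less.prems assms(1) by (simp add: grid_sum_single \<nu>_zero)
  next
    case 3
    define m where "m = (a + b) / 2"
    define u where "u = Max (X \<inter> {a..m})"
    have m: "a < m" "m < b" using 3 by (auto simp: m_def)
    have "u \<in> X \<inter> {a..m}" unfolding u_def using assms(1) less.prems m by (intro Max_in) auto
    then have u: "u \<in> X" "a \<le> u" "u \<le> m" by auto
    have u_max: "x \<le> u" if "x \<in> X" "x \<le> m" for x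
    proof (cases "a \<le> x")
      case True
      then show ?thesis unfolding u_def using assms(1) that by (intro Max_ge) auto
    qed (use u in auto)
    define v where "v = nxt X u"
    have v: "v \<in> X" "u < v" "v \<le> b"
      using nxt_props[OF assms(1), of b u] less.prems u m by (auto simp: v_def)
    have mv: "m < v" using u_max[of v] v by force
    have "v \<le> x" if "x \<in> X" "u < x" for x
      using nxt_props(3)[OF assms(1) that] by (simp add: v_def)
    then have gap: "X \<inter> {u<..<v} = {}" by fastforce
    have bnd: "0 \<le> a" "b \<le> H" "b - a \<le> d" using less.prems by auto
    have sum: "grid_sum X A a b = grid_sum X A a u + (A u v + grid_sum X A v b)"
      using grid_sum_split[OF assms(1), of a u b A] grid_sum_split[OF assms(1), of u v b A]
        grid_sum_single[OF assms(1) u(1) v(1,2) gap, of A] u v m by simp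
    have fin: "finite (X \<inter> {a<..<b})" using assms(1) by auto
    \<comment> \<open>If u = a, the left part has no interior point while [a,b] has one; otherwise u
      itself is lost. The induction measure decreases in both cases.\<close>
    have "X \<inter> {a<..<u} \<subset> X \<inter> {a<..<b}"
      using u m 3 by (cases "u = a") (auto simp: psubset_eq)
    then have IH1: "\<nu> (A a u - grid_sum X A a u) \<le> dyadic_sum \<rho> w (d / 2)"
      using less.prems u m psubset_card_mono[OF fin] by (intro less.hyps) (auto simp: m_def field_simps)
    have "X \<inter> {v<..<b} \<subset> X \<inter> {a<..<b}"
      using v u m mv 3 by (cases "v = b") (auto simp: psubset_eq)
    then have IH2: "\<nu> (A v b - grid_sum X A v b) \<le> dyadic_sum \<rho> w (d / 2)"
      using less.prems u v m mv psubset_card_mono[OF fin] by (intro less.hyps) (auto simp: m_def field_simps)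
    have mem: "A a b \<in> V" "A a u \<in> V" "A u b \<in> V" "A u v \<in> V" "A v b \<in> V"
      using u v m bnd by (auto intro!: A_V)
    have mem': "grid_sum X A a u \<in> V" "grid_sum X A v b \<in> V"
      using u v m bnd assms(1) less.prems by (auto intro!: grid_sum_V)
    \<comment> \<open>Inserting u and then v costs two defects; the interval [u,v] is common to the
      germ and the grid sum and cancels.\<close>
    have "A a b - grid_sum X A a b = ((A a b - A a u - A u b) + (A u b - A u v - A v b)) +
        ((A a u - grid_sum X A a u) + (A v b - grid_sum X A v b))"
      by (simp add: sum)
    then have "\<nu> (A a b - grid_sum X A a b) \<le> \<nu> ((A a b - A a u - A u b) + (A u b - A u v - A v b)) +
        \<nu> ((A a u - grid_sum X A a u) + (A v b - grid_sum X A v b))"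
      using \<nu>_add mem mem' V_add V_diff by metis
    also have "\<dots> \<le> (\<nu> (A a b - A a u - A u b) + \<nu> (A u b - A u v - A v b)) +
        (\<nu> (A a u - grid_sum X A a u) + \<nu> (A v b - grid_sum X A v b))"
      using mem mem' by (intro add_mono \<nu>_add V_diff)
    also have "\<dots> \<le> (epowr (w d) \<rho> + epowr (w d) \<rho>) + (dyadic_sum \<rho> w (d / 2) + dyadic_sum \<rho> w (d / 2))"
    proof (intro add_mono IH1 IH2)
      show "\<nu> (A a b - A a u - A u b) \<le> epowr (w d) \<rho>"
        by (rule order_trans[OF delta_le w_le]) (use bnd u m in auto)
      show "\<nu> (A u b - A u v - A v b) \<le> epowr (w d) \<rho>"
        by (rule order_trans[OF delta_le w_le]) (use bnd u v m in auto)
    qed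
    also have "\<dots> = dyadic_sum \<rho> w d"
      by (simp add: dyadic_sum_rec[of \<rho> w d] mult_2)
    finally show ?thesis .
  qed
qed

text \<open>Over one interval of the coarse grid the difference is the remainder of the fine grid,
  at most \<open>dyadic_sum \<rho> w d\<close>. Peeling off the intervals from the left adds one
  such term for each of them.\<close>

lemma grid_sum_refine:
  assumes "finite Z" "X \<subseteq> Z" "a \<in> X" "b \<in> X" "0 \<le> a" "a \<le> b" "b \<le> H"
    and gap: "\<And>x. x \<in> X \<Longrightarrow> a \<le> x \<Longrightarrow> x < b \<Longrightarrow> nxt X x - x \<le> d"
  shows "\<nu> (grid_sum X A a b - grid_sum Z A a b) \<le> of_nat (card (X \<inter> {a..<b})) * dyadic_sum \<rho> w d"
  using assms(3-)
proof (induction "card (X \<inter> {a..<b})" arbitrary: a rule: less_induct)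
  case (less a)
  have X: "finite X" using assms finite_subset by auto
  show ?case
  proof (cases "a = b")
    case True
    then show ?thesis by (simp add: \<nu>_zero)
  next
    case False
    then have ab: "a < b" using less.prems by simp
    define v where "v = nxt X a"
    have v: "v \<in> X" "a < v" "v \<le> b"
      using nxt_props[OF X _ ab] less.prems by (auto simp: v_def)
    have v_le: "v \<le> x" if "x \<in> X" "a < x" for x
      using nxt_props(3)[OF X that] by (simp add: v_def)
    then have gapv: "X \<inter> {a<..<v} = {}" by fastforce
    have eq: "X \<inter> {a..<b} = insert a (X \<inter> {v..<b})"
      using v v_le ab less.prems by (auto simp: less_le)
    have card: "card (X \<inter> {a..<b}) = Suc (card (X \<inter> {v..<b}))"
      unfolding eq using X v by (subst card_insert_disjoint) auto
    have IH: "\<nu> (grid_sum X A v b - grid_sum Z A v b) \<le> of_nat (card (X \<inter> {v..<b})) * dyadic_sum \<rho> w d"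
      using less.prems v by (intro less.hyps) (auto simp: card)
    have e: "\<nu> (A a v - grid_sum Z A a v) \<le> dyadic_sum \<rho> w d"
      using less.prems v assms(1,2) by (intro grid_sum_remainder) (auto simp: v_def)
    have mem: "A a v - grid_sum Z A a v \<in> V" "grid_sum X A v b - grid_sum Z A v b \<in> V"
      using assms(1,2) X less.prems v by (auto intro!: V_diff A_V grid_sum_V)
    have "grid_sum X A a b - grid_sum Z A a b = (A a v - grid_sum Z A a v) + (grid_sum X A v b - grid_sum Z A v b)"
      using grid_sum_split[OF X, of a v b A] grid_sum_split[OF assms(1), of a v b A]
        grid_sum_single[OF X less.prems(1) v(1,2) gapv, of A] v by simp
    then have "\<nu> (grid_sum X A a b - grid_sum Z A a b) \<le> \<nu> (A a v - grid_sum Z A a v) + \<nu> (grid_sum X A v b - grid_sum Z A v b)"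
      using \<nu>_add[OF mem] by simp
    also have "\<dots> \<le> dyadic_sum \<rho> w d + of_nat (card (X \<inter> {v..<b})) * dyadic_sum \<rho> w d"
      by (intro add_mono e IH)
    also have "\<dots> = of_nat (card (X \<inter> {a..<b})) * dyadic_sum \<rho> w d"
      by (simp add: card distrib_right)
    finally show ?thesis .
  qed
qed

end

section \<open>Dyadic grids\<close>

definition dyadic_grid :: "nat \<Rightarrow> real \<Rightarrow> real \<Rightarrow> real set" where
  "dyadic_grid n a b = (\<lambda>j. a + real j * ((b - a) / 2 ^ n)) ` {..2 ^ n}"

text \<open>The sum over \<open>dyadic_grid\<close> in closed form: pointwise limits and joint
  measurability in (a,b) use this form, the estimates use the grid.\<close>

definition dyadic_riemann :: "nat \<Rightarrow> (real \<Rightarrow> real \<Rightarrow> 'v::comm_monoid_add) \<Rightarrow> real \<Rightarrow> real \<Rightarrow> 'v" where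
  "dyadic_riemann n A a b = (\<Sum>j<2 ^ n. A (a + real j * ((b - a) / 2 ^ n)) (a + real (Suc j) * ((b - a) / 2 ^ n)))"

lemma finite_dyadic_grid [simp]: "finite (dyadic_grid n a b)"
  by (simp add: dyadic_grid_def)

lemma dyadic_grid_ends [simp]: "a \<in> dyadic_grid n a b" "b \<in> dyadic_grid n a b"
proof -
  show "a \<in> dyadic_grid n a b" unfolding dyadic_grid_def by (rule image_eqI[of _ _ 0]) auto
  show "b \<in> dyadic_grid n a b" unfolding dyadic_grid_def by (rule image_eqI[of _ _ "2 ^ n"]) auto
qed

context
  fixes a b :: real and n :: nat
  assumes ab: "a < b"
begin

lemma dyadic_grid_less: "dyadic_grid n a b \<inter> {a..<b} = (\<lambda>j. a + real j * ((b - a) / 2 ^ n)) ` {..<2 ^ n}"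
proof -
  define e where "e = (b - a) / 2 ^ n"
  have e: "0 < e" "b = a + real (2 ^ n) * e" using ab by (auto simp: e_def)
  have "a + real j * e < b \<longleftrightarrow> j < 2 ^ n" for j
    unfolding e(2) using e(1) by (simp del: of_nat_power)
  moreover have "a \<le> a + real j * e" for j using e by simp
  ultimately show ?thesis unfolding dyadic_grid_def e_def[symmetric] by force
qed

lemma inj_dyadic_point: "inj_on (\<lambda>j::nat. a + real j * ((b - a) / 2 ^ n)) J"
  using ab by (auto simp: inj_on_def)

lemma card_dyadic_grid: "card (dyadic_grid n a b \<inter> {a..<b}) = 2 ^ n"
  unfolding dyadic_grid_less by (subst card_image[OF inj_dyadic_point]) simp

lemma nxt_dyadic_grid:
  assumes "j < 2 ^ n"
  shows "nxt (dyadic_grid n a b) (a + real j * ((b - a) / 2 ^ n)) = a + real (Suc j) * ((b - a) / 2 ^ n)"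
proof -
  define e where "e = (b - a) / 2 ^ n"
  have e: "0 < e" using ab by (auto simp: e_def)
  have mem: "a + real (Suc j) * e \<in> dyadic_grid n a b"
    unfolding dyadic_grid_def e_def using assms by (intro imageI) auto
  note nx = nxt_props[OF finite_dyadic_grid mem, of "a + real j * e"]
  have grid: "dyadic_grid n a b = (\<lambda>j. a + real j * e) ` {..2 ^ n}"
    by (simp add: dyadic_grid_def e_def)
  have lt: "a + real j * e < a + real (Suc j) * e" using e by simp
  obtain i where i: "nxt (dyadic_grid n a b) (a + real j * e) = a + real i * e"
    using nx(1)[OF lt] unfolding grid by blast
  have "real j < real i" "real i \<le> real (Suc j)" using nx(2,3)[OF lt] e unfolding i by auto
  then have "i = Suc j" by linarith
  then show ?thesis using i by (simp add: e_def)
qed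

lemma dyadic_grid_gap:
  assumes "x \<in> dyadic_grid n a b" "a \<le> x" "x < b"
  shows "nxt (dyadic_grid n a b) x - x = (b - a) / 2 ^ n"
proof -
  have "x \<in> dyadic_grid n a b \<inter> {a..<b}" using assms by auto
  then obtain j where j: "j < 2 ^ n" "x = a + real j * ((b - a) / 2 ^ n)"
    unfolding dyadic_grid_less by auto
  have "a + real (Suc j) * e - (a + real j * e) = e" for e by (simp add: algebra_simps)
  then show ?thesis unfolding j(2) nxt_dyadic_grid[OF j(1)] .
qed

lemma grid_sum_dyadic: "grid_sum (dyadic_grid n a b) A a b = dyadic_riemann n A a b"
  unfolding grid_sum_def dyadic_grid_less sum.reindex[OF inj_dyadic_point] dyadic_riemann_def
  by (rule sum.cong[OF refl]) (simp only: o_def lessThan_iff nxt_dyadic_grid)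

end

lemma dyadic_grid_mono:
  assumes "n \<le> m"
  shows "dyadic_grid n a b \<subseteq> dyadic_grid m a b"
proof
  fix x assume "x \<in> dyadic_grid n a b"
  then obtain j where j: "j \<le> 2 ^ n" "x = a + real j * ((b - a) / 2 ^ n)" by (auto simp: dyadic_grid_def)
  have p: "(2::real) ^ m = 2 ^ (m - n) * 2 ^ n" "(2::nat) ^ m = 2 ^ (m - n) * 2 ^ n"
    using assms by (simp_all add: power_add[symmetric])
  have "x = a + real (j * 2 ^ (m - n)) * ((b - a) / 2 ^ m)"
    unfolding p j by (simp add: field_simps)
  moreover have "j * 2 ^ (m - n) \<le> 2 ^ m" using j unfolding p by simp
  ultimately show "x \<in> dyadic_grid m a b" unfolding dyadic_grid_def by blast
qed

context sewing
begin

text \<open>Refining the n-th dyadic grid changes each of its 2^n terms by one remainder.\<close>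

definition error :: "nat \<Rightarrow> real \<Rightarrow> ennreal" where
  "error n t = 2 ^ n * dyadic_sum \<rho> w (t / 2 ^ n)"

lemma \<nu>_diff_commute: "\<nu> (x - y) = \<nu> (y - x)"
  using \<nu>_minus[of "x - y"] by simp

lemma dyadic_riemann_V:
  assumes "0 \<le> a" "a < b" "b \<le> H"
  shows "dyadic_riemann n A a b \<in> V"
  unfolding grid_sum_dyadic[OF assms(2), symmetric]
  using assms by (intro grid_sum_V) auto

lemma dyadic_riemann_remainder:
  assumes "0 \<le> a" "a < b" "b \<le> H"
  shows "\<nu> (A a b - dyadic_riemann n A a b) \<le> dyadic_sum \<rho> w (b - a)"
  unfolding grid_sum_dyadic[OF assms(2), symmetric]
  using assms by (intro grid_sum_remainder) auto

lemma dyadic_riemann_Cauchy: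
  assumes "0 \<le> a" "a < b" "b \<le> H" "n \<le> m"
  shows "\<nu> (dyadic_riemann n A a b - dyadic_riemann m A a b) \<le> error n (b - a)"
proof -
  have "\<nu> (grid_sum (dyadic_grid n a b) A a b - grid_sum (dyadic_grid m a b) A a b) \<le>
      of_nat (card (dyadic_grid n a b \<inter> {a..<b})) * dyadic_sum \<rho> w ((b - a) / 2 ^ n)"
    using assms by (intro grid_sum_refine dyadic_grid_mono) (auto simp: dyadic_grid_gap)
  then show ?thesis
    unfolding grid_sum_dyadic[OF assms(2)] card_dyadic_grid[OF assms(2)] error_def by simp
qed

text \<open>In general u is not a point of the dyadic grid of [a,b], so additivity is only
  approximate. Over the union of the three grids it is exact, and the passage from each grid to the
  union costs one \<open>error\<close>.\<close>

lemma dyadic_riemann_additive: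
  assumes "0 \<le> a" "a < u" "u < b" "b \<le> H"
  shows "\<nu> (dyadic_riemann n A a b - dyadic_riemann n A a u - dyadic_riemann n A u b) \<le> 3 * error n (b - a)"
proof -
  let ?X = "dyadic_grid n a u" and ?Y = "dyadic_grid n u b" and ?W = "dyadic_grid n a b"
  define Z where "Z = ?X \<union> ?Y \<union> ?W"
  have Z: "finite Z" "?X \<subseteq> Z" "?Y \<subseteq> Z" "?W \<subseteq> Z" by (auto simp: Z_def)
  have ab: "a < b" using assms by simp
  have le: "of_nat (2 ^ n) * dyadic_sum \<rho> w (t / 2 ^ n) \<le> error n (b - a)" if "t \<le> b - a" for t
    unfolding error_def of_nat_power of_nat_numeral using that \<rho>_pos w_mono
    by (intro mult_left_mono dyadic_sum_mono divide_right_mono) auto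
  let ?S = "\<lambda>X a b. grid_sum X A a b"
  have 1: "\<nu> (?S ?W a b - ?S Z a b) \<le> error n (b - a)"
    using grid_sum_refine[OF Z(1,4), of a b "(b - a) / 2 ^ n"] assms ab le[of "b - a"]
    by (auto simp: dyadic_grid_gap card_dyadic_grid)
  have 2: "\<nu> (?S ?X a u - ?S Z a u) \<le> error n (b - a)"
    by (rule order_trans[OF grid_sum_refine[OF Z(1,2), of a u "(u - a) / 2 ^ n"]])
      (use assms le[of "u - a"] in \<open>auto simp: dyadic_grid_gap card_dyadic_grid\<close>)
  have 3: "\<nu> (?S ?Y u b - ?S Z u b) \<le> error n (b - a)"
    by (rule order_trans[OF grid_sum_refine[OF Z(1,3), of u b "(b - u) / 2 ^ n"]])
      (use assms le[of "b - u"] in \<open>auto simp: dyadic_grid_gap card_dyadic_grid\<close>)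
  have mem: "?S ?W a b - ?S Z a b \<in> V" "?S Z a u - ?S ?X a u \<in> V" "?S Z u b - ?S ?Y u b \<in> V"
    using assms Z by (auto intro!: V_diff grid_sum_V simp: Z_def)
  have "?S ?W a b - ?S ?X a u - ?S ?Y u b =
      (?S ?W a b - ?S Z a b) + ((?S Z a u - ?S ?X a u) + (?S Z u b - ?S ?Y u b))"
    using grid_sum_split[OF Z(1), of a u b A] assms by simp
  also have "\<nu> \<dots> \<le> \<nu> (?S ?W a b - ?S Z a b) + \<nu> ((?S Z a u - ?S ?X a u) + (?S Z u b - ?S ?Y u b))"
    by (intro \<nu>_add mem V_add)
  also have "\<dots> \<le> error n (b - a) + (\<nu> (?S Z a u - ?S ?X a u) + \<nu> (?S Z u b - ?S ?Y u b))"
    by (intro add_mono 1 \<nu>_add mem)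
  also have "\<dots> \<le> error n (b - a) + (error n (b - a) + error n (b - a))"
    using 2 3 by (intro add_mono) (auto simp: \<nu>_diff_commute)
  also have "\<dots> = 3 * error n (b - a)"
  proof -
    have "(3::ennreal) = 1 + (1 + 1)" by simp
    then show ?thesis by (simp only: distrib_right mult_1)
  qed
  finally show ?thesis
    unfolding grid_sum_dyadic[OF ab] grid_sum_dyadic[OF assms(2)] grid_sum_dyadic[OF assms(3)] .
qed

text \<open>If w(s) is of order s^\<gamma>, the k-th term of \<open>error n\<close> is of order
  x^(n+k) with x = 2^(1-\<gamma>\<rho>). The restriction to \<open>1 \<le> n\<close> ensures that
  only scales up to t / 2 occur, where the bound on \<open>w\<close> is available.\<close>

lemma error_geometric:
  assumes \<gamma>: "1 < \<gamma> * \<rho>" and K: "0 \<le> K" and t: "0 < t"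
    and w: "\<And>s. 0 < s \<Longrightarrow> s \<le> t / 2 \<Longrightarrow> w s \<le> ennreal (K * s powr \<gamma>)"
  obtains C x where "0 \<le> C" "0 < x" "x < 1" "\<And>n. 1 \<le> n \<Longrightarrow> error n t \<le> ennreal (C * x ^ n)"
proof -
  define x where "x = 2 powr (1 - \<gamma> * \<rho>)"
  have "x < 2 powr 0" unfolding x_def using \<gamma> by (intro powr_less_mono) auto
  then have x: "0 < x" "x < 1" by (auto simp: x_def)
  define C where "C = 2 * K powr \<rho> * t powr (\<gamma> * \<rho>) / (1 - x)"
  have "error n t \<le> ennreal (C * x ^ n)" if n: "1 \<le> n" for n
  proof -
    have "error n t = (\<Sum>k. 2 ^ n * (ennreal (2 * 2 ^ k) * epowr (w ((1 / 2) ^ k * (t / 2 ^ n))) \<rho>))"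
      by (simp add: error_def dyadic_sum_def ennreal_suminf_cmult)
    also have "\<dots> \<le> (\<Sum>k. ennreal (2 * K powr \<rho> * t powr (\<gamma> * \<rho>) * x ^ n * x ^ k))"
    proof (intro suminf_le)
      fix k
      define s where "s = (1 / 2) ^ k * (t / 2 ^ n)"
      have s_eq: "s = t * 2 powr (- real (n + k))"
      proof -
        have "2 powr (- real (n + k)) = inverse (2 ^ (n + k))"
          by (simp only: powr_minus powr_realpow zero_less_numeral)
        then show ?thesis by (simp add: s_def power_add field_simps)
      qed
      have "(2::real) ^ 1 \<le> 2 ^ (n + k)" using n by (intro power_increasing) auto
      then have s: "0 < s" "s \<le> t / 2"
        using t by (auto simp: s_def power_add field_simps)
      have "epowr (w s) \<rho> \<le> epowr (ennreal (K * s powr \<gamma>)) \<rho>"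
        using s \<rho>_pos by (intro epowr_mono w) auto
      also have "\<dots> = ennreal (K powr \<rho> * (t powr (\<gamma> * \<rho>) * 2 powr (- real (n + k) * (\<gamma> * \<rho>))))"
        using K t by (simp add: powr_mult powr_powr s_eq mult.assoc)
      finally have "2 ^ n * (ennreal (2 * 2 ^ k) * epowr (w s) \<rho>) \<le>
          ennreal (2 ^ n) * (ennreal (2 * 2 ^ k) * ennreal (K powr \<rho> * (t powr (\<gamma> * \<rho>) * 2 powr (- real (n + k) * (\<gamma> * \<rho>)))))"
        by (intro mult_mono) (auto simp: ennreal_power[symmetric])
      also have "\<dots> = ennreal (2 * K powr \<rho> * t powr (\<gamma> * \<rho>) * (2 ^ (n + k) * 2 powr (- real (n + k) * (\<gamma> * \<rho>))))"
        by (simp add: ennreal_mult[symmetric] power_add mult_ac)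
      also have "2 ^ (n + k) * 2 powr (- real (n + k) * (\<gamma> * \<rho>)) = x ^ (n + k)"
        by (simp add: x_def powr_realpow[symmetric] powr_powr powr_add[symmetric] algebra_simps del: power_add of_nat_add)
      finally show "2 ^ n * (ennreal (2 * 2 ^ k) * epowr (w ((1 / 2) ^ k * (t / 2 ^ n))) \<rho>) \<le> ennreal (2 * K powr \<rho> * t powr (\<gamma> * \<rho>) * x ^ n * x ^ k)"
        by (simp add: s_def power_add mult.assoc)
    qed auto
    also have "\<dots> = ennreal (C * x ^ n)"
      using x by (subst suminf_geometric_ennreal) (auto simp: C_def)
    finally show ?thesis .
  qed
  then show ?thesis using that[of C x] x by (auto simp: C_def)
qed

end

section \<open>The sewing limit\<close>

lemma sum_fun_apply: "(\<Sum>i\<in>I. f i) x = (\<Sum>i\<in>I. f i x)"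
  by (induction I rule: infinite_finite_induct) auto

lemma vnorm_nonneg [simp]: "0 \<le> vnorm m v"
  by (simp add: vnorm_def)

lemma vnorm_zero [simp]: "vnorm m 0 = 0"
  by (simp add: vnorm_def L2_set_def)

lemma vnorm_minus [simp]: "vnorm m (- v) = vnorm m v"
  by (simp add: vnorm_def L2_set_def)

lemma vnorm_minus_commute: "vnorm m (u - v) = vnorm m (v - u)"
  using vnorm_minus[of m "u - v"] by simp

lemma vnorm_triangle: "vnorm m (u + v) \<le> vnorm m u + vnorm m v"
  using L2_set_triangle_ineq[of u v "{..<m}"] by (simp add: vnorm_def plus_fun_def)

lemma vnorm_sum_le: "vnorm m (\<Sum>i\<in>I. f i) \<le> (\<Sum>i\<in>I. vnorm m (f i))"
proof (induction I rule: infinite_finite_induct)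
  case (insert x F)
  have "vnorm m (sum f (insert x F)) = vnorm m (f x + sum f F)"
    by (simp only: sum.insert[OF insert.hyps])
  also have "\<dots> \<le> vnorm m (f x) + vnorm m (sum f F)" by (rule vnorm_triangle)
  also have "\<dots> \<le> vnorm m (f x) + (\<Sum>i\<in>F. vnorm m (f i))" by (intro add_left_mono insert.IH)
  finally show ?case by (simp only: sum.insert[OF insert.hyps])
qed (simp_all only: sum.infinite sum.empty vnorm_zero order_refl not_False_eq_True)

lemma component_le_vnorm:
  assumes "i < m"
  shows "\<bar>v i\<bar> \<le> vnorm m v"
proof -
  have "(v i)\<^sup>2 \<le> (\<Sum>i<m. (v i)\<^sup>2)" using assms by (intro member_le_sum) auto
  then have "sqrt ((v i)\<^sup>2) \<le> vnorm m v" unfolding vnorm_def L2_set_def by (rule real_sqrt_le_mono)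
  then show ?thesis by simp
qed

lemma vnorm_cong: "(\<And>i. i < m \<Longrightarrow> u i = v i) \<Longrightarrow> vnorm m u = vnorm m v"
  unfolding vnorm_def by (intro L2_set_cong) auto

lemma vnorm_eq_0D: "vnorm m v = 0 \<Longrightarrow> i < m \<Longrightarrow> v i = 0"
  using component_le_vnorm[of i m v] by simp

lemma tendsto_vnorm:
  assumes "\<And>i. i < m \<Longrightarrow> ((\<lambda>n. u n i) \<longlongrightarrow> v i) F"
  shows "((\<lambda>n. vnorm m (u n)) \<longlongrightarrow> vnorm m v) F"
  unfolding vnorm_def L2_set_def using assms by (intro tendsto_intros) auto

lemma borel_measurable_vnorm [measurable (raw)]:
  assumes "\<And>i. i < m \<Longrightarrow> (\<lambda>r. g r i) \<in> borel_measurable M"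
  shows "(\<lambda>r. vnorm m (g r)) \<in> borel_measurable M"
  unfolding vnorm_def L2_set_def using assms by measurable

section \<open>The germ along lines of constant lag\<close>

abbreviation line_norm :: "real \<Rightarrow> nat \<Rightarrow> ennreal \<Rightarrow> real \<Rightarrow> (real \<Rightarrow> nat \<Rightarrow> real) \<Rightarrow> ennreal" where
  "line_norm T m p h g \<equiv> Lp_norm p (segment T h) (\<lambda>r. ennreal (vnorm m (g r)))"

lemma Omega_bar_mono: "mono (Omega_bar T m p B)"
  unfolding Omega_bar_def by (intro monoI SUP_mono' SUP_subset_mono) auto

lemma Omega_mono: "mono (Omega T m p B)"
  unfolding Omega_def by (intro monoI SUP_subset_mono) auto

lemma Omega_le:
  assumes "0 \<le> h" "h \<le> \<tau>"
  shows "line_norm T m p h (\<lambda>r. B r (r + h)) \<le> Omega T m p B \<tau>"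
  unfolding Omega_def using assms by (intro SUP_upper) auto

lemma Omega_bar_le:
  assumes "0 \<le> u" "u \<le> h"
  shows "line_norm T m p h (\<lambda>r. B r (r + u) (r + h)) \<le> Omega_bar T m p B h"
proof -
  define \<theta> where "\<theta> = (if h = 0 then 0 else u / h)"
  have "\<theta> \<in> {0..1}" "\<theta> * h = u" using assms by (auto simp: \<theta>_def)
  then show ?thesis
    unfolding Omega_bar_def using assms by (intro SUP_upper2[of \<theta>] SUP_upper2[of h]) auto
qed

locale besov_germ =
  fixes T :: real and m :: nat and p :: ennreal and \<rho> :: real and A :: "real \<Rightarrow> real \<Rightarrow> nat \<Rightarrow> real"
  assumes T_pos: "0 < T" and \<rho>: "0 < \<rho>" "\<rho> \<le> 1" "ennreal \<rho> \<le> p" and A_meas: "measurable2 T m A"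
begin

definition w :: "real \<Rightarrow> ennreal" where
  "w = Omega_bar T m p (delta A)"

definition V :: "real \<Rightarrow> (real \<Rightarrow> nat \<Rightarrow> real) set" where
  "V h = {g. \<forall>i<m. (\<lambda>r. g r i) \<in> borel_measurable (segment T h)}"

definition \<nu> :: "real \<Rightarrow> (real \<Rightarrow> nat \<Rightarrow> real) \<Rightarrow> ennreal" where
  "\<nu> h g = epowr (line_norm T m p h g) \<rho>"

text \<open>The abstract argument sews functions of the base point r: an interval [a,b] inside [0,H]
  stands for [r + a, r + b], for all r at once. Translation then bounds every defect by the modulus
  \<open>w\<close>.\<close>

definition shifted :: "real \<Rightarrow> real \<Rightarrow> real \<Rightarrow> nat \<Rightarrow> real" where
  "shifted a b = (\<lambda>r. A (r + a) (r + b))"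

lemma p_pos: "0 < p"
  using \<rho> by (auto intro: less_le_trans[of _ "ennreal \<rho>"])

lemma V_measurable: "g \<in> V h \<Longrightarrow> i < m \<Longrightarrow> (\<lambda>r. g r i) \<in> borel_measurable (segment T h)"
  by (simp add: V_def)

lemma V_vnorm: "g \<in> V h \<Longrightarrow> (\<lambda>r. ennreal (vnorm m (g r))) \<in> borel_measurable (segment T h)"
  by (intro measurable_compose[OF _ measurable_ennreal] borel_measurable_vnorm V_measurable)

lemma shifted_V:
  assumes "0 \<le> a" "a \<le> b" "b \<le> H" "H \<le> T"
  shows "shifted a b \<in> V H"
  unfolding V_def shifted_def
proof safe
  fix i assume i: "i < m"
  have "(\<lambda>r. A r (r + (b - a)) i) \<in> borel_measurable (lebesgue_on {0..T - (b - a)})"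
    using A_meas i assms by (auto simp: measurable2_def)
  from measurable_shift[OF _ _ this, of a H] assms
  show "(\<lambda>r. A (r + a) (r + b) i) \<in> borel_measurable (segment T H)"
    by (simp add: add.assoc)
qed

lemma V_shift:
  assumes "0 \<le> a" "a + h \<le> H" "g \<in> V h"
  shows "(\<lambda>r. g (r + a)) \<in> V H"
  unfolding V_def using measurable_shift[OF assms(1,2) V_measurable[OF assms(3)]] by simp

lemma V_diff: "f \<in> V h \<Longrightarrow> g \<in> V h \<Longrightarrow> f - g \<in> V h"
  by (auto simp: V_def intro!: borel_measurable_diff)

lemma sewing_shifted:
  assumes "H \<le> T"
  shows "sewing (V H) (\<nu> H) H \<rho> w shifted"
proof
  show "0 \<in> V H" by (simp add: V_def)
  show "x - y \<in> V H" if "x \<in> V H" "y \<in> V H" for x y using that by (rule V_diff)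
  show "\<nu> H 0 = 0"
  proof -
    have "Lp_norm p (segment T H) (\<lambda>r. 0) \<le> 0"
      using p_pos by (subst Lp_norm_le_iff) auto
    then show ?thesis using \<rho> by (simp add: \<nu>_def)
  qed
  show "\<nu> H (- x) = \<nu> H x" for x by (simp add: \<nu>_def)
  show "\<nu> H (x + y) \<le> \<nu> H x + \<nu> H y" if xy: "x \<in> V H" "y \<in> V H" for x y
    unfolding \<nu>_def
  proof (rule Lp_norm_add_le[OF \<rho> V_vnorm V_vnorm V_vnorm])
    show "x + y \<in> V H" using xy by (auto simp: V_def intro!: borel_measurable_add)
    show "AE r in segment T H. ennreal (vnorm m ((x + y) r)) \<le> ennreal (vnorm m (x r)) + ennreal (vnorm m (y r))"
      by (intro AE_I2) (simp add: ennreal_plus[symmetric] vnorm_triangle ennreal_leI del: ennreal_plus)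
  qed (use xy in auto)
  show "shifted a b \<in> V H" if "0 \<le> a" "a \<le> b" "b \<le> H" for a b
    using that assms by (rule shifted_V)
  show "mono w" unfolding w_def by (rule Omega_bar_mono)
  show "0 < \<rho>" by (rule \<rho>)
  show "\<nu> H (shifted a b - shifted a u - shifted u b) \<le> epowr (w (b - a)) \<rho>"
    if ab: "0 \<le> a" "a \<le> u" "u \<le> b" "b \<le> H" for a u b
  proof -
    define g where "g r = ennreal (vnorm m (delta A r (r + (u - a)) (r + (b - a))))" for r
    have g: "g \<in> borel_measurable (lebesgue_on {0..T - (b - a)})"
    proof -
      have "shifted 0 (b - a) - shifted 0 (u - a) - shifted (u - a) (b - a) \<in> V (b - a)"
        using ab assms by (intro V_diff shifted_V) auto
      from V_vnorm[OF this] show ?thesis by (simp add: g_def[abs_def] shifted_def delta_def)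
    qed
    have "Lp_norm p (segment T H) (\<lambda>r. g (r + a)) \<le> Lp_norm p (lebesgue_on {0..T - (b - a)}) g"
      using ab p_pos g by (intro Lp_norm_shift) auto
    also have "\<dots> \<le> w (b - a)"
      unfolding g_def w_def using ab by (intro Omega_bar_le) auto
    finally have "epowr (Lp_norm p (segment T H) (\<lambda>r. g (r + a))) \<rho> \<le> epowr (w (b - a)) \<rho>"
      using \<rho> by (intro epowr_mono)
    then show ?thesis by (simp add: \<nu>_def g_def shifted_def delta_def)
  qed
qed

lemma dyadic_riemann_shifted: "dyadic_riemann n shifted a b r = dyadic_riemann n A (r + a) (r + b)"
  by (simp add: dyadic_riemann_def shifted_def sum_fun_apply add.assoc)

text \<open>\<open>lim\<close> is arbitrary where the dyadic sums diverge; in the locale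
  \<open>besov_sewing\<close> this concerns only a null set on each line of lag in (0,T].\<close>

definition I :: "real \<Rightarrow> real \<Rightarrow> nat \<Rightarrow> real" where
  "I s t i = lim (\<lambda>n. dyadic_riemann n A s t i)"

end

text \<open>The power bound on \<open>w\<close> stops at \<open>T / 2\<close>, because a finite
  Besov norm may leave \<open>w\<close> infinite closer to \<open>T\<close>.\<close>

locale besov_sewing = besov_germ +
  fixes \<gamma> K :: real
  assumes \<gamma>: "1 < \<gamma> * \<rho>" and K: "0 \<le> K" and w_le: "\<And>s. 0 < s \<Longrightarrow> s \<le> T / 2 \<Longrightarrow> w s \<le> ennreal (K * s powr \<gamma>)"
begin

lemma error_bound:
  assumes "0 < h" "h \<le> T"
  obtains C x where "0 \<le> C" "0 < x" "x < 1" "\<And>n. 1 \<le> n \<Longrightarrow> sewing.error \<rho> w n h \<le> ennreal (C * x ^ n)"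
  using sewing.error_geometric[OF sewing_shifted[OF assms(2)] \<gamma> K assms(1)] w_le assms by auto

text \<open>Consecutive dyadic sums differ by geometrically small amounts in the \<rho>-th power of
  the norm, so the sum of all differences has finite quasi-norm and is finite almost
  everywhere.\<close>

lemma dyadic_riemann_AE_tendsto:
  assumes h: "0 < h" "h \<le> T"
  shows "AE r in segment T h. \<forall>i<m. (\<lambda>n. dyadic_riemann n A r (r + h) i) \<longlonglongrightarrow> I r (r + h) i"
proof -
  interpret S: sewing "V h" "\<nu> h" h \<rho> w shifted by (rule sewing_shifted) fact
  obtain C x where C: "0 \<le> C" "0 < x" "x < 1" "\<And>n. 1 \<le> n \<Longrightarrow> S.error n h \<le> ennreal (C * x ^ n)"
    using error_bound[OF h] by blast
  \<comment> \<open>The differences start at level 1, since the geometric bound on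
    \<open>error\<close> excludes level 0.\<close>
  define g where "g n = dyadic_riemann (n + 1) shifted 0 h - dyadic_riemann (n + 2) shifted 0 h" for n
  have gV: "g n \<in> V h" for n
    unfolding g_def using h by (intro V_diff S.dyadic_riemann_V) auto
  have g: "\<nu> h (g n) \<le> ennreal (C * x * x ^ n)" for n
  proof -
    have "\<nu> h (g n) \<le> S.error (n + 1) (h - 0)"
      unfolding g_def using h by (intro S.dyadic_riemann_Cauchy) auto
    also have "\<dots> \<le> ennreal (C * x ^ (n + 1))" using C(4)[of "n + 1"] by simp
    finally show ?thesis by (simp add: mult.assoc)
  qed
  have "epowr (Lp_norm p (segment T h) (\<lambda>r. \<Sum>n. ennreal (vnorm m (g n r)))) \<rho> \<le> (\<Sum>n. \<nu> h (g n))"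
    unfolding \<nu>_def by (intro Lp_norm_rho_suminf \<rho> V_vnorm gV)
  also have "\<dots> \<le> (\<Sum>n. ennreal (C * x * x ^ n))" by (intro suminf_le g) auto
  also have "\<dots> < top" using C by (subst suminf_geometric_ennreal) auto
  finally have "Lp_norm p (segment T h) (\<lambda>r. \<Sum>n. ennreal (vnorm m (g n r))) < top"
    by (auto simp: less_top[symmetric])
  then have "AE r in segment T h. (\<Sum>n. ennreal (vnorm m (g n r))) < top"
    by (intro Lp_norm_finite_AE[OF p_pos] borel_measurable_suminf_order V_vnorm gV)
  then show ?thesis
  proof eventually_elim
    case (elim r)
    have sum: "summable (\<lambda>n. vnorm m (g n r))"
      by (rule summable_suminf_not_top) (use elim in auto)
    show ?case
    proof safe
      fix i assume i: "i < m"
      let ?d = "\<lambda>n. dyadic_riemann n A r (r + h) i"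
      have "summable (\<lambda>n. g n r i)"
        by (rule summable_comparison_test[OF _ sum]) (use component_le_vnorm[OF i] in auto)
      then have "summable (\<lambda>n. ?d (Suc n) - ?d (Suc (Suc n)))"
        by (simp add: g_def dyadic_riemann_shifted)
      from summable_LIMSEQ[OF this]
      obtain l where "(\<lambda>n. \<Sum>k<n. ?d (Suc k) - ?d (Suc (Suc k))) \<longlonglongrightarrow> l" by blast
      moreover have "(\<Sum>k<n. ?d (Suc k) - ?d (Suc (Suc k))) = ?d (Suc 0) - ?d (Suc n)" for n
        by (induction n) auto
      ultimately have "(\<lambda>n. ?d (Suc 0) - ?d (Suc n)) \<longlonglongrightarrow> l" by simp
      from tendsto_diff[OF tendsto_const[of "?d (Suc 0)"] this]
      have "(\<lambda>n. ?d (Suc n)) \<longlonglongrightarrow> ?d (Suc 0) - l" by simp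
      then have "convergent ?d" unfolding convergent_def by (blast intro: LIMSEQ_imp_Suc)
      then show "?d \<longlonglongrightarrow> I r (r + h) i" by (simp add: convergent_LIMSEQ_iff I_def)
    qed
  qed
qed

lemma I_V:
  assumes h: "0 < h" "h \<le> T"
  shows "(\<lambda>r. I r (r + h)) \<in> V h"
proof -
  have "dyadic_riemann n shifted 0 h \<in> V h" for n
    using sewing.dyadic_riemann_V[OF sewing_shifted[OF h(2)]] h by auto
  then show ?thesis unfolding V_def I_def
    by (auto simp: dyadic_riemann_shifted intro!: borel_measurable_lim_metric)
qed

text \<open>The remainder bound for dyadic sums is uniform in n, so Fatou carries it to the
  limit.\<close>

lemma remainder_le:
  assumes h: "0 < h" "h \<le> T"
  shows "\<nu> h (\<lambda>r. I r (r + h) - A r (r + h)) \<le> dyadic_sum \<rho> w h"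
proof -
  interpret S: sewing "V h" "\<nu> h" h \<rho> w shifted by (rule sewing_shifted) fact
  define g where "g n = shifted 0 h - dyadic_riemann n shifted 0 h" for n
  have gV: "g n \<in> V h" for n
    unfolding g_def using h by (intro V_diff S.dyadic_riemann_V shifted_V) auto
  have RV: "(\<lambda>r. I r (r + h) - A r (r + h)) \<in> V h"
    using V_diff[OF I_V[OF h] shifted_V[of 0 h h]] h by (simp add: shifted_def fun_diff_def)
  have "line_norm T m p h (\<lambda>r. I r (r + h) - A r (r + h)) \<le> epowr (dyadic_sum \<rho> w h) (1 / \<rho>)"
  proof (rule Lp_norm_liminf_le[OF p_pos V_vnorm[OF gV] V_vnorm[OF RV]])
    show "AE r in segment T h. (\<lambda>n. ennreal (vnorm m (g n r))) \<longlonglongrightarrow> ennreal (vnorm m (I r (r + h) - A r (r + h)))"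
      using dyadic_riemann_AE_tendsto[OF h]
    proof eventually_elim
      case (elim r)
      then have "(\<lambda>n. vnorm m (g n r)) \<longlonglongrightarrow> vnorm m (A r (r + h) - I r (r + h))"
        by (intro tendsto_vnorm) (auto simp: g_def shifted_def dyadic_riemann_shifted intro!: tendsto_intros)
      then show ?case by (subst vnorm_minus_commute) (rule tendsto_ennrealI)
    qed
    show "line_norm T m p h (\<lambda>r. g n r) \<le> epowr (dyadic_sum \<rho> w h) (1 / \<rho>)" for n
      using S.dyadic_riemann_remainder[of 0 h n] h \<rho>
      by (simp add: g_def \<nu>_def epowr_le_cong)
  qed
  then show ?thesis using \<rho> by (simp add: \<nu>_def epowr_le_cong)
qed

text \<open>The approximate additivity of the dyadic sums becomes exact in the limit. The
  exceptional null set depends on h and k, so a path cannot simply be read off from a prescribed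
  base point; that choice is left to Fubini.\<close>

lemma I_additive:
  assumes hk: "0 < h" "0 < k" "h + k \<le> T"
  shows "AE r in lebesgue_on {0..T - (h + k)}. \<forall>i<m. I r (r + h + k) i = I r (r + h) i + I (r + h) (r + h + k) i"
proof -
  define H where "H = h + k"
  have H: "0 < H" "H \<le> T" "h < H" using hk by (auto simp: H_def)
  interpret S: sewing "V H" "\<nu> H" H \<rho> w shifted by (rule sewing_shifted) fact
  obtain C x where C: "0 \<le> C" "0 < x" "x < 1" "\<And>n. 1 \<le> n \<Longrightarrow> S.error n H \<le> ennreal (C * x ^ n)"
    using error_bound[OF H(1,2)] by blast
  define g where "g n = dyadic_riemann n shifted 0 H - dyadic_riemann n shifted 0 h - dyadic_riemann n shifted h H" for n
  define D where "D r = I r (r + H) - I r (r + h) - I (r + h) (r + H)" for r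
  have gV: "g n \<in> V H" for n
    unfolding g_def using hk H by (intro V_diff S.dyadic_riemann_V) auto
  have g: "\<nu> H (g n) \<le> ennreal (3 * C * x ^ n)" if "1 \<le> n" for n
  proof -
    have "\<nu> H (g n) \<le> 3 * S.error n (H - 0)"
      unfolding g_def using hk H by (intro S.dyadic_riemann_additive) auto
    also have "\<dots> \<le> 3 * ennreal (C * x ^ n)" using C(4)[OF that] by (intro mult_left_mono) auto
    also have "\<dots> = ennreal (3 * C * x ^ n)" using C by (simp add: ennreal_mult mult.assoc)
    finally show ?thesis .
  qed
  have tendsto: "AE r in segment T H. \<forall>i<m. (\<lambda>n. g n r i) \<longlonglongrightarrow> D r i"
  proof -
    have 1: "AE r in segment T H. \<forall>i<m. (\<lambda>n. dyadic_riemann n A r (r + H) i) \<longlonglongrightarrow> I r (r + H) i"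
      by (rule dyadic_riemann_AE_tendsto) (use H in auto)
    have 2: "AE r in segment T H. \<forall>i<m. (\<lambda>n. dyadic_riemann n A r (r + h) i) \<longlonglongrightarrow> I r (r + h) i"
      using AE_shift[OF _ _ dyadic_riemann_AE_tendsto[of h], of 0 H] H hk by simp
    have 3: "AE r in segment T H. \<forall>i<m. (\<lambda>n. dyadic_riemann n A (r + h) (r + H) i) \<longlonglongrightarrow> I (r + h) (r + H) i"
      using AE_shift[OF _ _ dyadic_riemann_AE_tendsto[of k], of h H] H hk by (simp add: H_def add.assoc)
    show ?thesis using 1 2 3
      by eventually_elim (auto simp: g_def D_def dyadic_riemann_shifted intro!: tendsto_intros)
  qed
  have DV: "D \<in> V H"
  proof -
    have 1: "(\<lambda>r. I r (r + H)) \<in> V H" by (rule I_V) (use H in auto)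
    have 2: "(\<lambda>r. I r (r + h)) \<in> V H"
      using V_shift[of 0 h H, OF _ _ I_V[of h]] H hk by simp
    have 3: "(\<lambda>r. I (r + h) (r + H)) \<in> V H"
      using V_shift[of h k H, OF _ _ I_V[of k]] H hk by (simp add: H_def add.assoc)
    show ?thesis using V_diff[OF V_diff[OF 1 2] 3] by (simp add: D_def[abs_def] fun_diff_def)
  qed
  define L where "L = line_norm T m p H D"
  \<comment> \<open>The sequence started at N still tends to \<open>D\<close>, and Fatou transfers
    its bound; letting N grow gives L = 0.\<close>
  have L: "epowr L \<rho> \<le> ennreal (3 * C * x ^ N)" if N: "1 \<le> N" for N
  proof -
    have "L \<le> epowr (ennreal (3 * C * x ^ N)) (1 / \<rho>)"
      unfolding L_def
    proof (rule Lp_norm_liminf_le[OF p_pos V_vnorm V_vnorm[OF DV]])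
      show "g (n + N) \<in> V H" for n by (rule gV)
      show "AE r in segment T H. (\<lambda>n. ennreal (vnorm m (g (n + N) r))) \<longlonglongrightarrow> ennreal (vnorm m (D r))"
        using tendsto
        by eventually_elim (intro tendsto_ennrealI LIMSEQ_ignore_initial_segment tendsto_vnorm, auto)
      fix n
      have "\<nu> H (g (n + N)) \<le> ennreal (3 * C * x ^ (n + N))" using N by (intro g) auto
      also have "\<dots> \<le> ennreal (3 * C * x ^ N)"
        using C by (intro ennreal_leI mult_left_mono power_decreasing) auto
      finally show "line_norm T m p H (\<lambda>r. g (n + N) r) \<le> epowr (ennreal (3 * C * x ^ N)) (1 / \<rho>)"
        using \<rho> by (simp add: \<nu>_def epowr_le_cong)
    qed
    then show ?thesis using \<rho> by (simp add: epowr_le_cong)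
  qed
  have "(\<lambda>N. ennreal (3 * C * x ^ N)) \<longlonglongrightarrow> ennreal (3 * C * 0)"
    using C by (intro tendsto_ennrealI tendsto_mult_left LIMSEQ_realpow_zero) auto
  then have "epowr L \<rho> \<le> ennreal (3 * C * 0)"
    by (rule LIMSEQ_le_const) (use L in auto)
  then have "L = 0" using \<rho> by simp
  then have "AE r in segment T H. ennreal (vnorm m (D r)) = 0"
    unfolding L_def by (intro Lp_norm_0_AE[OF p_pos] V_vnorm DV)
  then show ?thesis unfolding H_def[symmetric]
  proof eventually_elim
    case (elim r)
    then have "vnorm m (D r) = 0" by simp
    from vnorm_eq_0D[OF this] show ?case by (auto simp: D_def H_def algebra_simps)
  qed
qed

end

section \<open>The limit as an increment\<close>

lemma AE_lborel_affine:
  fixes c t :: real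
  assumes "c \<noteq> 0" "AE x in lborel. P x"
  shows "AE x in lborel. P (t + c * x)"
  using AE_lebesgue_affine[of c P t] assms by (simp add: AE_completion_iff)

lemma AE_lborel_commute:
  fixes R :: "real \<Rightarrow> real \<Rightarrow> bool"
  assumes [measurable]: "Measurable.pred (borel \<Otimes>\<^sub>M borel) (\<lambda>z. R (fst z) (snd z))"
  shows "(AE x in lborel. AE y in lborel. R x y) \<longleftrightarrow> (AE y in lborel. AE x in lborel. R x y)"
  by (intro lborel_pair.AE_commute) (use assms in \<open>simp add: pred_def space_pair_measure\<close>)

text \<open>The inner statement holds iff the integral of the indicator of its failure vanishes, and
  that integral is measurable in the parameters. This permits swapping quantifiers in front of a
  further one.\<close>

lemma pred_AE_lborel:
  fixes R :: "real \<Rightarrow> real \<Rightarrow> real \<Rightarrow> bool"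
  assumes [measurable]: "Measurable.pred (borel \<Otimes>\<^sub>M borel \<Otimes>\<^sub>M borel) (\<lambda>z. R (fst z) (fst (snd z)) (snd (snd z)))"
  shows "Measurable.pred (borel \<Otimes>\<^sub>M borel) (\<lambda>z. AE t in lborel. R (fst z) (snd z) t)"
proof -
  let ?i = "\<lambda>z t. indicator {z. \<not> R (fst z) (fst (snd z)) (snd (snd z))} (fst z, snd z, t) :: ennreal"
  have eq: "(AE t in lborel. R (fst z) (snd z) t) \<longleftrightarrow> (\<integral>\<^sup>+t. ?i z t \<partial>lborel) = 0" for z
  proof (subst nn_integral_0_iff_AE)
    show "(\<lambda>t. ?i z t) \<in> borel_measurable lborel" by measurable
  qed (auto simp: indicator_def)
  show ?thesis unfolding eq by measurable
qed

context
  fixes Q :: "real \<Rightarrow> real \<Rightarrow> real \<Rightarrow> bool"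
  assumes Q [measurable]: "Measurable.pred (borel \<Otimes>\<^sub>M borel \<Otimes>\<^sub>M borel) (\<lambda>z. Q (fst z) (fst (snd z)) (snd (snd z)))"
begin

lemma Q_measurable [measurable (raw)]:
  assumes "a \<in> borel_measurable M" "b \<in> borel_measurable M" "c \<in> borel_measurable M"
  shows "Measurable.pred M (\<lambda>z. Q (a z) (b z) (c z))"
  using measurable_compose[OF measurable_Pair[OF assms(1) measurable_Pair[OF assms(2,3)]] Q] by simp

text \<open>Passes from a base point with two lags to three free points: Fubini moves the base point
  outermost, then translations by x and by y remove the lags.\<close>

lemma AE_rotate:
  assumes "AE h in lborel. AE k in lborel. AE x in lborel. Q x (x + h) (x + h + k)"
  shows "AE x in lborel. AE y in lborel. AE z in lborel. Q x y z"
proof -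
  have "AE h in lborel. AE x in lborel. AE k in lborel. Q x (x + h) (x + h + k)"
    using assms by (subst (asm) AE_lborel_commute) measurable
  then have "AE x in lborel. AE h in lborel. AE k in lborel. Q x (x + h) (x + h + k)"
    by (subst (asm) AE_lborel_commute) (intro pred_AE_lborel, measurable)
  then show ?thesis
  proof eventually_elim
    case (elim x)
    from AE_lborel_affine[OF _ this, of 1 "- x"]
    have "AE y in lborel. AE k in lborel. Q x y (y + k)" by simp
    then show ?case
    proof eventually_elim
      case (elim y)
      from AE_lborel_affine[OF _ this, of 1 "- y"] show ?case by simp
    qed
  qed
qed

text \<open>The base point c will have points on both sides, so the relation is needed with c as
  left, middle and right member; Fubini permutes the quantifiers accordingly.\<close>

lemma AE_base_point:
  assumes "AE x in lborel. AE y in lborel. AE z in lborel. Q x y z"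
  shows "AE c in lborel. AE r in lborel. AE t in lborel. Q c r t \<and> Q r c t \<and> Q r t c"
proof -
  have 2: "AE c in lborel. AE r in lborel. AE t in lborel. Q r c t"
    using assms by (subst (asm) AE_lborel_commute) (intro pred_AE_lborel, measurable)
  have "AE r in lborel. AE c in lborel. AE t in lborel. Q r t c"
    using assms
  proof eventually_elim
    case (elim r)
    then show ?case by (subst (asm) AE_lborel_commute) measurable
  qed
  then have 3: "AE c in lborel. AE r in lborel. AE t in lborel. Q r t c"
    by (subst (asm) AE_lborel_commute) (intro pred_AE_lborel, measurable)
  from assms 2 3 show ?thesis
  proof eventually_elim
    case (elim c)
    then show ?case
    proof eventually_elim
      case (elim r)
      then show ?case by eventually_elim auto
    qed
  qed
qed

end

lemma AE_shear:
  fixes P :: "real \<Rightarrow> real \<Rightarrow> bool"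
  assumes P: "Measurable.pred (borel \<Otimes>\<^sub>M borel) (\<lambda>z. P (fst z) (snd z))"
    and "AE s in lborel. AE t in lborel. P s t"
  shows "AE h in lborel. AE r in lborel. P r (r + h)"
proof -
  have "(\<lambda>z::real \<times> real. (fst z, fst z + snd z)) \<in> borel \<Otimes>\<^sub>M borel \<rightarrow>\<^sub>M borel \<Otimes>\<^sub>M borel"
    by measurable
  from measurable_compose[OF this P]
  have P': "Measurable.pred (borel \<Otimes>\<^sub>M borel) (\<lambda>z. P (fst z) (fst z + snd z))"
    by (simp only: fst_conv snd_conv)
  have "AE s in lborel. AE h in lborel. P s (s + h)"
    using assms(2)
  proof eventually_elim
    case (elim s)
    from AE_lborel_affine[OF _ this, of 1 s] show ?case by simp
  qed
  then show ?thesis by (subst (asm) AE_lborel_commute[OF P'])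
qed

text \<open>A Borel null cover \<open>N\<close> makes Fubini applicable to arbitrary P; the shear
  (r,h) to (r,r+h) then turns sections into lines of constant lag.\<close>

lemma AE_diagonal:
  fixes P :: "real \<Rightarrow> real \<Rightarrow> bool"
  assumes "AE z in lborel. P (fst z) (snd z)"
  shows "AE h in lborel. AE r in lborel. P r (r + h)"
proof -
  obtain N :: "(real \<times> real) set" where N: "N \<in> sets lborel" "emeasure lborel N = 0" "{z. \<not> P (fst z) (snd z)} \<subseteq> N"
    using assms by (auto elim!: AE_E)
  have NP: "P a b" if "(a, b) \<notin> N" for a b
    using that subsetD[OF N(3), of "(a, b)"] by auto
  have "- N \<in> sets (borel \<Otimes>\<^sub>M borel)" unfolding borel_prod using N(1) by (simp add: borel_comp)
  then have pN: "Measurable.pred (borel \<Otimes>\<^sub>M borel) (\<lambda>z. (fst z, snd z) \<notin> N)"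
    by (simp add: pred_def space_pair_measure Compl_eq)
  have "AE z in lborel \<Otimes>\<^sub>M lborel. z \<notin> N"
    unfolding lborel_prod using N by (intro AE_not_in) (auto simp: null_sets_def)
  then have "AE s in lborel. AE t in lborel. (s, t) \<notin> N" by (rule lborel_pair.AE_pair)
  from AE_shear[OF pN this] show ?thesis
  proof eventually_elim
    case (elim h)
    then show ?case by eventually_elim (rule NP)
  qed
qed

lemma AE_lebesgue_on_interval:
  "(AE r in lebesgue_on {a..b::real}. P r) \<longleftrightarrow> (AE r in lborel. a \<le> r \<and> r \<le> b \<longrightarrow> P r)"
  by (simp add: AE_restrict_space_iff AE_completion_iff)

lemma AE_lborel_interval_point:
  fixes a b :: real
  assumes "AE x in lborel. P x" "a < b"
  obtains x where "a < x" "x < b" "P x"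
proof -
  have "\<exists>x. a < x \<and> x < b \<and> P x"
  proof (rule ccontr)
    assume "\<not> ?thesis"
    then have "AE x in lborel. x \<notin> {a<..<b}" using assms(1) by (auto elim: eventually_mono)
    then have "{a<..<b} \<in> null_sets lborel" by (subst AE_iff_null_sets) auto
    then show False using assms(2) by auto
  qed
  then show ?thesis using that by blast
qed

lemma Delta2_borel [measurable]: "Delta2 T \<in> sets borel"
proof -
  have "closed {z :: real \<times> real. 0 \<le> fst z \<and> fst z \<le> snd z \<and> snd z \<le> T}"
    by (intro closed_Collect_conj closed_Collect_le continuous_intros)
  moreover have "Delta2 T = {z. 0 \<le> fst z \<and> fst z \<le> snd z \<and> snd z \<le> T}"
    by (auto simp: Delta2_def)
  ultimately show ?thesis by (simp only: borel_closed)
qed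

lemma Delta2_borel_version:
  assumes "f \<in> borel_measurable (lebesgue_on (Delta2 T))"
  shows "\<exists>g\<in>borel_measurable borel. AE z in lborel. z \<in> Delta2 T \<longrightarrow> f z = (g z :: real)"
proof -
  have "(\<lambda>z. indicator (Delta2 T) z *\<^sub>R f z) \<in> borel_measurable lebesgue"
    using assms by (subst (asm) borel_measurable_restrict_space_iff) auto
  from completion_ex_borel_measurable_real[OF this]
  obtain g where g: "g \<in> borel_measurable lborel" "AE z in lborel. indicator (Delta2 T) z *\<^sub>R f z = g z" by blast
  from g(2) have "AE z in lborel. z \<in> Delta2 T \<longrightarrow> f z = g z" by eventually_elim auto
  then show ?thesis using g(1) by auto
qed

context besov_sewing
begin

text \<open>Fubini needs joint Borel measurability of the limit, hence a Borel germ \<open>B\<close>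
  in place of \<open>A\<close>. Equality almost everywhere in the plane passes to the dyadic sums
  for almost every lag only, which explains the quantifier over h.\<close>

lemma I_borel_version:
  obtains J :: "real \<Rightarrow> real \<Rightarrow> nat \<Rightarrow> real"
  where "\<And>i. (\<lambda>z. J (fst z) (snd z) i) \<in> borel_measurable (borel \<Otimes>\<^sub>M borel)"
    and "AE h in lborel. AE r in lborel. 0 < h \<and> 0 \<le> r \<and> r + h \<le> T \<longrightarrow> (\<forall>i<m. J r (r + h) i = I r (r + h) i)"
proof -
  have "\<forall>i. \<exists>g. g \<in> borel_measurable borel \<and> (i < m \<longrightarrow> (AE z in lborel. z \<in> Delta2 T \<longrightarrow> A (fst z) (snd z) i = g z))"
  proof
    fix i
    show "\<exists>g. g \<in> borel_measurable borel \<and> (i < m \<longrightarrow> (AE z in lborel. z \<in> Delta2 T \<longrightarrow> A (fst z) (snd z) i = g z))"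
    proof (cases "i < m")
      case True
      then have "(\<lambda>z. A (fst z) (snd z) i) \<in> borel_measurable (lebesgue_on (Delta2 T))"
        using A_meas by (simp add: measurable2_def split_beta')
      from Delta2_borel_version[OF this] show ?thesis by auto
    qed (auto intro!: exI[of _ "\<lambda>_. 0"])
  qed
  from choice[OF this] obtain g where g: "g i \<in> borel_measurable borel"
    "i < m \<Longrightarrow> (AE z in lborel. z \<in> Delta2 T \<longrightarrow> A (fst z) (snd z) i = g i z)" for i by blast
  define B where "B s t i = g i (s, t)" for s t i
  have B_meas [measurable]: "(\<lambda>z. B (fst z) (snd z) i) \<in> borel_measurable (borel \<Otimes>\<^sub>M borel)" for i
    unfolding borel_prod B_def prod.collapse by (rule g(1))
  define eqAB where "eqAB s t \<longleftrightarrow> ((s, t) \<in> Delta2 T \<longrightarrow> (\<forall>i<m. A s t i = B s t i))" for s t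
  have "AE z in lborel. \<forall>i\<in>{..<m}. z \<in> Delta2 T \<longrightarrow> A (fst z) (snd z) i = g i z"
    using g(2) by (subst AE_ball_countable) auto
  then have "AE z in lborel. eqAB (fst z) (snd z)"
    by eventually_elim (auto simp: eqAB_def B_def)
  then have diag: "AE h in lborel. AE r in lborel. eqAB r (r + h)" by (rule AE_diagonal)
  \<comment> \<open>The n-th dyadic sum lives on the line of lag h / 2^n, so a good h must be good
    at all these scales; dilation and countability provide this.\<close>
  have AEn: "AE h in lborel. \<forall>n::nat. AE r in lborel. eqAB r (r + h / 2 ^ n)"
  proof (subst AE_all_countable, rule allI)
    fix n :: nat
    from AE_lborel_affine[OF _ diag, of "1 / 2 ^ n" 0]
    show "AE h in lborel. AE r in lborel. eqAB r (r + h / 2 ^ n)" by simp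
  qed
  define J where "J s t i = lim (\<lambda>n. dyadic_riemann n B s t i)" for s t i
  show ?thesis
  proof
    show "(\<lambda>z. J (fst z) (snd z) i) \<in> borel_measurable (borel \<Otimes>\<^sub>M borel)" for i
      unfolding J_def
    proof (rule borel_measurable_lim_metric)
      fix n
      have "(\<lambda>z. B (fst z + real j * ((snd z - fst z) / 2 ^ n)) (fst z + real (Suc j) * ((snd z - fst z) / 2 ^ n)) i) \<in> borel_measurable (borel \<Otimes>\<^sub>M borel)" for j
      proof -
        have "(\<lambda>z::real \<times> real. (fst z + real j * ((snd z - fst z) / 2 ^ n), fst z + real (Suc j) * ((snd z - fst z) / 2 ^ n))) \<in> borel \<Otimes>\<^sub>M borel \<rightarrow>\<^sub>M borel \<Otimes>\<^sub>M borel"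
          by measurable
        from measurable_compose[OF this B_meas] show ?thesis by simp
      qed
      then show "(\<lambda>z. dyadic_riemann n B (fst z) (snd z) i) \<in> borel_measurable (borel \<Otimes>\<^sub>M borel)"
        unfolding dyadic_riemann_def sum_fun_apply by measurable
    qed
    show "AE h in lborel. AE r in lborel. 0 < h \<and> 0 \<le> r \<and> r + h \<le> T \<longrightarrow> (\<forall>i<m. J r (r + h) i = I r (r + h) i)"
      using AEn
    proof eventually_elim
      case (elim h)
      \<comment> \<open>Translation along these lines makes all dyadic nodes above r good at
        once.\<close>
      have "AE r in lborel. \<forall>n j::nat. eqAB (r + real j * (h / 2 ^ n)) (r + real j * (h / 2 ^ n) + h / 2 ^ n)"
      proof (subst AE_all_countable, rule allI, subst AE_all_countable, rule allI)
        fix n j :: nat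
        from AE_lborel_affine[OF _ elim[rule_format, of n], of 1 "real j * (h / 2 ^ n)"]
        show "AE r in lborel. eqAB (r + real j * (h / 2 ^ n)) (r + real j * (h / 2 ^ n) + h / 2 ^ n)"
          by (simp add: add.commute)
      qed
      then show ?case
      proof eventually_elim
        case (elim r)
        show ?case
        proof (intro impI)
          assume h: "0 < h \<and> 0 \<le> r \<and> r + h \<le> T"
          have "dyadic_riemann n A r (r + h) i = dyadic_riemann n B r (r + h) i" if i: "i < m" for n i
            unfolding dyadic_riemann_def sum_fun_apply
          proof (rule sum.cong[OF refl])
            fix j :: nat assume "j \<in> {..<2 ^ n}"
            then have "Suc j \<le> 2 ^ n" by auto
            then have "real (Suc j) \<le> real (2 ^ n)" by (rule of_nat_mono)
            then have "real (Suc j) * (h / 2 ^ n) \<le> real (2 ^ n) * (h / 2 ^ n)"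
              using h by (intro mult_right_mono) auto
            then have le: "real (Suc j) * (h / 2 ^ n) \<le> h" by simp
            have eq: "r + real j * (h / 2 ^ n) + h / 2 ^ n = r + real (Suc j) * (h / 2 ^ n)"
              by (simp add: distrib_right add.assoc add.commute del: times_divide_eq_right)
            have "eqAB (r + real j * (h / 2 ^ n)) (r + real (Suc j) * (h / 2 ^ n))"
              using elim[rule_format, of j n] unfolding eq .
            moreover have "0 \<le> real j * (h / 2 ^ n)" using h by simp
            moreover have "real j * (h / 2 ^ n) \<le> real (Suc j) * (h / 2 ^ n)" using h by (intro mult_right_mono) auto
            ultimately show "A (r + real j * ((r + h - r) / 2 ^ n)) (r + real (Suc j) * ((r + h - r) / 2 ^ n)) i =
                B (r + real j * ((r + h - r) / 2 ^ n)) (r + real (Suc j) * ((r + h - r) / 2 ^ n)) i"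
              using h le i by (simp add: eqAB_def Delta2_def)
          qed
          then show "\<forall>i<m. J r (r + h) i = I r (r + h) i" by (simp add: J_def I_def)
        qed
      qed
    qed
  qed
qed

text \<open>The path is the limit taken from a generic base point. Through \<open>J\<close> this
  gives the right increments for almost every lag; additivity of \<open>I\<close> extends it to
  every lag.\<close>

lemma exists_primitive:
  obtains f :: "real \<Rightarrow> nat \<Rightarrow> real"
  where "\<And>i. (\<lambda>t. f t i) \<in> borel_measurable borel"
    and "\<And>h. 0 < h \<Longrightarrow> h \<le> T \<Longrightarrow> AE r in segment T h. \<forall>i<m. f (r + h) i - f r i = I r (r + h) i"
proof -
  obtain J where J [measurable]: "\<And>i. (\<lambda>z. J (fst z) (snd z) i) \<in> borel_measurable (borel \<Otimes>\<^sub>M borel)"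
    and JI: "AE h in lborel. AE r in lborel. 0 < h \<and> 0 \<le> r \<and> r + h \<le> T \<longrightarrow> (\<forall>i<m. J r (r + h) i = I r (r + h) i)"
    using I_borel_version by blast
  define Q where "Q x y z \<longleftrightarrow> (0 \<le> x \<and> x < y \<and> y < z \<and> z \<le> T \<longrightarrow> (\<forall>i\<in>{..<m}. J x z i = J x y i + J y z i))" for x y z
  have Q: "Measurable.pred (borel \<Otimes>\<^sub>M borel \<Otimes>\<^sub>M borel) (\<lambda>z. Q (fst z) (fst (snd z)) (snd (snd z)))"
  proof -
    have Jm: "(\<lambda>z. J (a z) (b z) i) \<in> borel_measurable (borel \<Otimes>\<^sub>M borel \<Otimes>\<^sub>M borel)"
      if "a \<in> borel_measurable (borel \<Otimes>\<^sub>M borel \<Otimes>\<^sub>M borel)" "b \<in> borel_measurable (borel \<Otimes>\<^sub>M borel \<Otimes>\<^sub>M borel)" for a b :: "real \<times> real \<times> real \<Rightarrow> real" and i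
      using measurable_compose[OF measurable_Pair[OF that] J[of i]] by simp
    note [measurable] = Jm
    show ?thesis unfolding Q_def by measurable
  qed
  let ?good = "\<lambda>h. AE r in lborel. 0 < h \<and> 0 \<le> r \<and> r + h \<le> T \<longrightarrow> (\<forall>i<m. J r (r + h) i = I r (r + h) i)"
  have "AE h in lborel. AE k in lborel. AE x in lborel. Q x (x + h) (x + h + k)"
    using JI
  proof eventually_elim
    case (elim h)
    note h = this
    \<comment> \<open>\<open>J\<close> inherits additivity from \<open>I\<close> when h, k and h + k
      are all good lags; the last one is generic in k by translation.\<close>
    have "AE k in lborel. ?good (h + k)" using AE_lborel_affine[OF _ JI, of 1 h] by simp
    with JI show ?case
    proof eventually_elim
      case (elim k)
      show ?case
      proof (cases "0 < h \<and> 0 < k \<and> h + k \<le> T")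
        case True
        have 1: "AE x in lborel. 0 < k \<and> 0 \<le> x + h \<and> x + h + k \<le> T \<longrightarrow> (\<forall>i<m. J (x + h) (x + h + k) i = I (x + h) (x + h + k) i)"
          using AE_lborel_affine[OF _ elim(1), of 1 h] by (simp add: add.commute)
        have 2: "AE x in lborel. 0 \<le> x \<and> x \<le> T - (h + k) \<longrightarrow> (\<forall>i<m. I x (x + h + k) i = I x (x + h) i + I (x + h) (x + h + k) i)"
          using I_additive[of h k] True by (simp add: AE_lebesgue_on_interval)
        from 1 2 h elim(2) show ?thesis
          by eventually_elim (use True in \<open>auto simp: Q_def add.assoc\<close>)
      next
        case False
        have "Q x (x + h) (x + h + k)" for x using False by (auto simp: Q_def)
        then show ?thesis by simp
      qed
    qed
  qed
  from AE_lborel_interval_point[OF AE_base_point[OF Q AE_rotate[OF Q this]] T_pos]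
  obtain c where c: "0 < c" "c < T" "AE r in lborel. AE t in lborel. Q c r t \<and> Q r c t \<and> Q r t c" by blast
  \<comment> \<open>The sign changes to the left of c, since \<open>J\<close> describes increments
    from the left to the right point only.\<close>
  define f where "f t i = (if c < t then J c t i else - J t c i)" for t i
  have f_meas [measurable]: "(\<lambda>t. f t i) \<in> borel_measurable borel" for i
  proof -
    have "(\<lambda>t. J c t i) \<in> borel_measurable borel" "(\<lambda>t. J t c i) \<in> borel_measurable borel"
      using measurable_compose[OF _ J[of i], of "\<lambda>t. (c, t)" borel] measurable_compose[OF _ J[of i], of "\<lambda>t. (t, c)" borel] by simp_all
    then show ?thesis unfolding f_def by measurable
  qed
  define R where "R r t \<longleftrightarrow> (0 \<le> r \<and> r < t \<and> t \<le> T \<longrightarrow> (\<forall>i\<in>{..<m}. f t i - f r i = J r t i))" for r t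
  have "AE r in lborel. r \<noteq> c" by (rule AE_lborel_singleton)
  with c(3) have RR: "AE r in lborel. AE t in lborel. R r t"
  proof eventually_elim
    case (elim r)
    have "AE t in lborel. t \<noteq> c" by (rule AE_lborel_singleton)
    with elim(1) show ?case
    proof eventually_elim
      case (elim t)
      show ?case
        unfolding R_def
      proof (intro impI ballI)
        fix i assume rt: "0 \<le> r \<and> r < t \<and> t \<le> T" and i: "i \<in> {..<m}"
        consider "c < r" | "r < c" "c < t" | "t < c" using rt elim \<open>r \<noteq> c\<close> by linarith
        then show "f t i - f r i = J r t i"
        proof cases
          case 1
          then have "J c t i = J c r i + J r t i" using elim rt i c unfolding Q_def by auto
          then show ?thesis using 1 rt by (simp add: f_def)
        next
          case 2
          then have "J r t i = J r c i + J c t i" using elim rt i c unfolding Q_def by auto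
          then show ?thesis using 2 rt by (simp add: f_def)
        next
          case 3
          then have "J r c i = J r t i + J t c i" using elim rt i c unfolding Q_def by auto
          then show ?thesis using 3 rt by (simp add: f_def)
        qed
      qed
    qed
  qed
  have R_meas: "Measurable.pred (borel \<Otimes>\<^sub>M borel) (\<lambda>z. R (fst z) (snd z))"
  proof -
    note [measurable] = measurable_compose[OF measurable_fst f_meas] measurable_compose[OF measurable_snd f_meas]
    show ?thesis unfolding R_def by measurable
  qed
  from AE_shear[OF this RR] have RD: "AE h in lborel. AE r in lborel. R r (r + h)" .
  define ok where "ok h \<longleftrightarrow> (AE r in lborel. 0 < h \<and> 0 \<le> r \<and> r + h \<le> T \<longrightarrow> (\<forall>i<m. f (r + h) i - f r i = I r (r + h) i))" for h
  have ok: "AE h in lborel. ok h"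
    using RD JI
  proof eventually_elim
    case (elim h)
    then show ?case unfolding ok_def by eventually_elim (auto simp: R_def)
  qed
  show ?thesis
  proof
    show "(\<lambda>t. f t i) \<in> borel_measurable borel" for i by (rule f_meas)
    fix h assume h: "0 < h" "h \<le> T"
    \<comment> \<open>A possibly exceptional lag h is cut into two good ones, k and h - k;
      \<open>I_additive\<close>, valid for every lag, glues them.\<close>
    have "AE k in lborel. ok (h - k)" using AE_lborel_affine[OF _ ok, of "-1" h] by simp
    with ok have "AE k in lborel. ok k \<and> ok (h - k)" by eventually_elim auto
    from AE_lborel_interval_point[OF this h(1)]
    obtain k where k: "0 < k" "k < h" "ok k" "ok (h - k)" by blast
    have 1: "AE r in lborel. 0 < h - k \<and> 0 \<le> r + k \<and> r + h \<le> T \<longrightarrow> (\<forall>i<m. f (r + h) i - f (r + k) i = I (r + k) (r + h) i)"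
      using AE_lborel_affine[OF _ k(4)[unfolded ok_def], of 1 k] by (simp add: algebra_simps)
    have 2: "AE r in lborel. 0 \<le> r \<and> r \<le> T - h \<longrightarrow> (\<forall>i<m. I r (r + h) i = I r (r + k) i + I (r + k) (r + h) i)"
      using I_additive[of k "h - k"] k h by (simp add: AE_lebesgue_on_interval add.assoc)
    show "AE r in segment T h. \<forall>i<m. f (r + h) i - f r i = I r (r + h) i"
      unfolding AE_lebesgue_on_interval using 1 2 k(3)[unfolded ok_def]
    proof eventually_elim
      case (elim r)
      show ?case
      proof (intro impI allI)
        fix i assume r: "0 \<le> r \<and> r \<le> T - h" and i: "i < m"
        have "f (r + h) i - f (r + k) i = I (r + k) (r + h) i" using elim(1) r i k by simp
        moreover have "I r (r + h) i = I r (r + k) i + I (r + k) (r + h) i" using elim(2) r i by simp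
        moreover have "f (r + k) i - f r i = I r (r + k) i" using elim(3) r i k by simp
        ultimately show "f (r + h) i - f r i = I r (r + h) i" by simp
      qed
    qed
  qed
qed

end

section \<open>Sewing in Besov spaces\<close>

text \<open>The hypotheses say that 1/\<gamma> lies below 1, p and r, which leaves room for \<rho>.
  The slot r is infinite when the constants are fixed, so that \<rho> depends on p and \<gamma>
  only; it is the target exponent when convergence is proved.\<close>

lemma exists_sewing_exponent:
  assumes "max 1 (1 / p) < ennreal \<gamma>" "0 < p" "0 < r" "ennreal (1 / \<gamma>) < r"
  obtains \<rho> where "0 < \<rho>" "\<rho> < 1" "ennreal \<rho> < p" "ennreal \<rho> < r" "1 < \<gamma> * \<rho>"
proof -
  have "ennreal 1 < ennreal \<gamma>" using assms(1) by simp
  then have \<gamma>: "1 < \<gamma>" by (subst (asm) ennreal_less_iff) auto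
  have "ennreal (1 / \<gamma>) < p"
  proof (cases p)
    case (real x)
    then have x: "0 < x" using assms(2) by simp
    have "1 / p = ennreal (1 / x)" using real x divide_ennreal[of 1 x] by simp
    then have "ennreal (1 / x) < ennreal \<gamma>" using assms(1) by simp
    then have "1 / x < \<gamma>" using x by (subst (asm) ennreal_less_iff) auto
    then have "1 / \<gamma> < x" using x \<gamma> by (simp add: field_simps)
    then show ?thesis using real \<gamma> by (simp add: ennreal_less_iff)
  qed simp
  then have "ennreal (1 / \<gamma>) < min p r" using assms by simp
  from exists_rho[OF _ _ this] \<gamma> obtain \<rho> where \<rho>: "1 / \<gamma> < \<rho>" "\<rho> < 1" "ennreal \<rho> < min p r" by auto
  have "0 < 1 / \<gamma>" using \<gamma> by simp
  then have "0 < \<rho>" using \<rho>(1) by linarith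
  then show ?thesis using that[of \<rho>] \<gamma> \<rho> by (simp add: field_simps)
qed

lemma Besov_scale_finite_pointwise:
  assumes q: "0 < q" and \<gamma>: "0 \<le> \<gamma>" and w: "mono w" and fin: "Besov_scale T \<gamma> q w < top"
  shows "\<exists>K\<ge>0. \<forall>s. 0 < s \<longrightarrow> s \<le> T / 2 \<longrightarrow> w s \<le> ennreal (K * s powr \<gamma>)"
proof -
  obtain n where n: "Besov_scale T \<gamma> q w = ennreal n" "0 \<le> n"
    using fin by (cases "Besov_scale T \<gamma> q w") auto
  have le: "x \<le> ennreal (a * b)" if "x / ennreal b \<le> ennreal a" "0 < b" "0 \<le> a" for x a b
  proof -
    have "x = x / ennreal b * ennreal b"
      using that(2) by (simp add: divide_ennreal_pos mult.assoc ennreal_mult[symmetric])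
    also have "\<dots> \<le> ennreal a * ennreal b" using that(1) by (rule mult_right_mono) simp
    finally show ?thesis using that by (simp add: ennreal_mult)
  qed
  show ?thesis
  proof (cases "q = top")
    case False
    define K where "K = 2 powr \<gamma> * 2 powr (1 / enn2real q) * n"
    show ?thesis
    proof (intro exI[of _ K] conjI allI impI)
      fix s assume s: "0 < s" "s \<le> T / 2"
      show "w s \<le> ennreal (K * s powr \<gamma>)"
        using Besov_scale_pointwise[OF q False \<gamma> w s] s n
        by (intro le) (auto simp: K_def ennreal_mult)
    qed (use n in \<open>auto simp: K_def\<close>)
  next
    \<comment> \<open>For infinite q the bound holds only almost everywhere, so it is taken at some
      \<tau> in (s, 2s) and transferred to s by monotonicity; this costs 2^\<gamma>.\<close>
    case True
    show ?thesis
    proof (intro exI[of _ "n * 2 powr \<gamma>"] conjI allI impI)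
      fix s assume s: "0 < s" "s \<le> T / 2"
      have "AE \<tau> in log_measure T. w \<tau> / ennreal (\<tau> powr \<gamma>) \<le> ennreal n"
        using esssup_AE[of "\<lambda>\<tau>. w \<tau> / ennreal (\<tau> powr \<gamma>)" "log_measure T"] n(1) True
        by (simp add: Besov_scale_def Lp_norm_def)
      then have "AE \<tau> in lborel. 0 < \<tau> \<and> \<tau> \<le> T \<longrightarrow> w \<tau> / ennreal (\<tau> powr \<gamma>) \<le> ennreal n"
        by (simp add: AE_log_measure)
      from AE_lborel_interval_point[OF this, of s "2 * s"] s
      obtain \<tau> where \<tau>: "s < \<tau>" "\<tau> < 2 * s" "w \<tau> / ennreal (\<tau> powr \<gamma>) \<le> ennreal n" by auto
      have "w s \<le> w \<tau>" using \<tau> by (intro monoD[OF w]) auto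
      also have "\<dots> \<le> ennreal (n * \<tau> powr \<gamma>)" using \<tau> s n by (intro le) auto
      also have "\<dots> \<le> ennreal (n * (2 * s) powr \<gamma>)"
        using \<tau> s n \<gamma> by (intro ennreal_leI mult_left_mono powr_mono2) auto
      finally show "w s \<le> ennreal (n * 2 powr \<gamma> * s powr \<gamma>)" using s by (simp add: powr_mult mult.assoc)
    qed (use n in auto)
  qed
qed

lemma incr_measurable:
  assumes f: "\<And>i. (\<lambda>t. f t i) \<in> borel_measurable borel"
  shows "(\<lambda>r. incr f (r + a) (r + b) i) \<in> borel_measurable (lebesgue_on S)"
proof -
  note [measurable] = f
  have "(\<lambda>r. f (r + b) i - f (r + a) i) \<in> borel_measurable borel" by measurable
  then have "(\<lambda>r. f (r + b) i - f (r + a) i) \<in> borel_measurable (lebesgue_on S)"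
    by (intro measurable_restrict_space1 measurable_completion) simp
  then show ?thesis by (simp add: incr_def)
qed

lemma measurable2_incr_minus:
  assumes f: "\<And>i. (\<lambda>t. f t i) \<in> borel_measurable borel" and A: "measurable2 T m A"
  shows "measurable2 T m (incr f - A)"
  unfolding measurable2_def
proof (intro allI impI conjI ballI)
  fix i assume i: "i < m"
  have "(\<lambda>z. f (snd z) i - f (fst z) i) \<in> borel_measurable borel"
    using f[of i]
    by (intro borel_measurable_diff measurable_compose[OF borel_measurable_continuous_onI f] continuous_intros)
  then have 1: "(\<lambda>z. f (snd z) i - f (fst z) i) \<in> borel_measurable (lebesgue_on (Delta2 T))"
    by (intro measurable_restrict_space1 measurable_completion) simp
  have 2: "(\<lambda>z. A (fst z) (snd z) i) \<in> borel_measurable (lebesgue_on (Delta2 T))"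
    using A i by (simp add: measurable2_def split_beta')
  show "(\<lambda>(s, t). (incr f - A) s t i) \<in> borel_measurable (lebesgue_on (Delta2 T))"
    using borel_measurable_diff[OF 1 2] by (simp add: incr_def split_beta')
  fix h assume h: "h \<in> {0..T}"
  have "(\<lambda>r. A r (r + h) i) \<in> borel_measurable (segment T h)"
    using A i h by (simp add: measurable2_def)
  from borel_measurable_diff[OF incr_measurable[where a = 0 and b = h and i = i, OF f] this]
  show "(\<lambda>r. (incr f - A) r (r + h) i) \<in> borel_measurable (segment T h)"
    by simp
qed

lemma measurable2_vnorm:
  assumes "measurable2 T m B" "0 \<le> h" "h \<le> T"
  shows "(\<lambda>r. ennreal (vnorm m (B r (r + h)))) \<in> borel_measurable (segment T h)"
  using assms by (intro measurable_compose[OF _ measurable_ennreal] borel_measurable_vnorm) (auto simp: measurable2_def)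

lemma (in besov_sewing) exists_sewing:
  "\<exists>f. (\<forall>i. (\<lambda>t. f t i) \<in> borel_measurable borel) \<and>
    (\<forall>h. 0 \<le> h \<longrightarrow> h \<le> T \<longrightarrow> \<nu> h (\<lambda>r. (incr f - A) r (r + h)) \<le> dyadic_sum \<rho> w h)"
proof -
  obtain f where f: "\<And>i. (\<lambda>t. f t i) \<in> borel_measurable borel"
    and fI: "\<And>h. 0 < h \<Longrightarrow> h \<le> T \<Longrightarrow> AE r in segment T h. \<forall>i<m. f (r + h) i - f r i = I r (r + h) i"
    using exists_primitive by blast
  show ?thesis
  proof (intro exI[of _ f] conjI allI impI f)
    fix h assume h: "0 \<le> h" "h \<le> T"
    interpret S: sewing "V h" "\<nu> h" h \<rho> w shifted by (rule sewing_shifted) fact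
    show "\<nu> h (\<lambda>r. (incr f - A) r (r + h)) \<le> dyadic_sum \<rho> w h"
    \<comment> \<open>At lag 0 the limit along lines says nothing; the remainder is -A r r, which up
      to sign is the remainder of the one-point grid {0}.\<close>
    proof (cases "h = 0")
      case True
      have "\<nu> h (\<lambda>r. (incr f - A) r (r + h)) = \<nu> h (shifted 0 0 - grid_sum {0} shifted 0 0)"
        by (simp add: True \<nu>_def shifted_def incr_def grid_sum_def nxt_def vnorm_def L2_set_def)
      also have "\<dots> \<le> dyadic_sum \<rho> w h"
        by (rule S.grid_sum_remainder) (use h in auto)
      finally show ?thesis .
    next
      case False
      then have h0: "0 < h" using h by simp
      have R: "(\<lambda>r. I r (r + h) - A r (r + h)) \<in> V h"
        using V_diff[OF I_V[OF h0 h(2)] shifted_V[of 0 h h]] h by (simp add: shifted_def fun_diff_def)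
      have "\<nu> h (\<lambda>r. (incr f - A) r (r + h)) = \<nu> h (\<lambda>r. I r (r + h) - A r (r + h))"
        unfolding \<nu>_def
      proof (rule arg_cong[where f = "\<lambda>x. epowr x \<rho>"], rule Lp_norm_cong_AE[OF p_pos V_vnorm[OF R]])
        show "(\<lambda>r. ennreal (vnorm m ((incr f - A) r (r + h)))) \<in> borel_measurable (segment T h)"
          using measurable2_incr_minus[OF f A_meas] h by (rule measurable2_vnorm)
        show "AE r in segment T h. ennreal (vnorm m ((incr f - A) r (r + h))) = ennreal (vnorm m (I r (r + h) - A r (r + h)))"
          using fI[OF h0 h(2)]
          by eventually_elim (auto simp: incr_def intro!: vnorm_cong arg_cong[where f = ennreal])
      qed
      also have "\<dots> \<le> dyadic_sum \<rho> w h" by (rule remainder_le[OF h0 h(2)])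
      finally show ?thesis .
    qed
  qed
qed

text \<open>Quantifying the constant before \<open>T\<close>, \<open>m\<close> and \<open>A\<close>
  expresses that it depends on p, q and \<gamma> alone, and lets it be chosen as a function of
  these.\<close>

definition sewing_constant :: "ennreal \<Rightarrow> ennreal \<Rightarrow> real \<Rightarrow> real \<Rightarrow> bool" where
  "sewing_constant p q \<gamma> C \<longleftrightarrow> 0 \<le> C \<and>
    (\<forall>T m A. 0 < T \<longrightarrow> measurable2 T m A \<longrightarrow> BB_bar_norm T m \<gamma> p q (delta A) < top \<longrightarrow>
      (\<exists>f. (\<forall>i. (\<lambda>t. f t i) \<in> borel_measurable borel) \<and>
        BB_norm T m \<gamma> p q (incr f - A) \<le> ennreal C * BB_bar_norm T m \<gamma> p q (delta A)))"

lemma sewing_constant_exists: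
  assumes p: "0 < p" and q: "0 < q" and \<gamma>: "max 1 (1 / p) < ennreal \<gamma>"
  shows "\<exists>C. sewing_constant p q \<gamma> C"
proof -
  obtain \<rho> where exps: "0 < \<rho>" "\<rho> < 1" "ennreal \<rho> < p" "1 < \<gamma> * \<rho>"
    using exists_sewing_exponent[OF \<gamma> p, of top] by auto
  then have "0 < \<gamma> * \<rho>" by linarith
  then have \<gamma>0: "0 \<le> \<gamma>" using exps(1) by (simp add: zero_less_mult_iff)
  from Besov_scale_dyadic_sum[OF exps(1,4) q] obtain C where C: "0 \<le> C"
    and bound: "\<forall>T w u. mono w \<longrightarrow> 0 < T \<longrightarrow> u \<in> borel_measurable borel \<longrightarrow>
      (\<forall>\<tau>. 0 < \<tau> \<longrightarrow> \<tau> \<le> T \<longrightarrow> epowr (u \<tau>) \<rho> \<le> dyadic_sum \<rho> w \<tau>) \<longrightarrow>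
      Besov_scale T \<gamma> q u \<le> ennreal C * Besov_scale T \<gamma> q w"
    by (elim exE conjE)
  show ?thesis
    unfolding sewing_constant_def
  proof (intro exI[of _ C] conjI allI impI C)
    fix T :: real and m :: nat and A
    assume T: "0 < T" and A: "measurable2 T m A" and fin: "BB_bar_norm T m \<gamma> p q (delta A) < top"
    have "Besov_scale T \<gamma> q (Omega_bar T m p (delta A)) < top" using fin by (simp add: BB_bar_norm_def)
    from Besov_scale_finite_pointwise[OF q \<gamma>0 Omega_bar_mono this]
    obtain K where K: "0 \<le> K" "\<forall>s. 0 < s \<longrightarrow> s \<le> T / 2 \<longrightarrow> Omega_bar T m p (delta A) s \<le> ennreal (K * s powr \<gamma>)"
      by (elim exE conjE)
    interpret besov_germ T m p \<rho> A
      by unfold_locales (use T exps A in \<open>simp_all add: less_imp_le\<close>)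
    interpret besov_sewing T m p \<rho> A \<gamma> K
      by unfold_locales (use exps K in \<open>simp_all add: w_def\<close>)
    from exists_sewing obtain f where f: "\<forall>i. (\<lambda>t. f t i) \<in> borel_measurable borel"
      and R: "\<forall>h. 0 \<le> h \<longrightarrow> h \<le> T \<longrightarrow> \<nu> h (\<lambda>r. (incr f - A) r (r + h)) \<le> dyadic_sum \<rho> w h"
      by (elim exE conjE)
    have "epowr (Omega T m p (incr f - A) \<tau>) \<rho> \<le> dyadic_sum \<rho> w \<tau>" if \<tau>: "0 < \<tau>" "\<tau> \<le> T" for \<tau>
    proof -
      have "Omega T m p (incr f - A) \<tau> \<le> epowr (dyadic_sum \<rho> w \<tau>) (1 / \<rho>)"
        unfolding Omega_def
      proof (rule SUP_least)
        fix h assume h: "h \<in> {0..\<tau>}"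
        have "\<nu> h (\<lambda>r. (incr f - A) r (r + h)) \<le> dyadic_sum \<rho> w h" using h \<tau> by (intro R[rule_format]) auto
        also have "\<dots> \<le> dyadic_sum \<rho> w \<tau>"
          using h exps by (intro dyadic_sum_mono) (auto simp: w_def Omega_bar_mono)
        finally show "line_norm T m p h (\<lambda>r. (incr f - A) r (r + h)) \<le> epowr (dyadic_sum \<rho> w \<tau>) (1 / \<rho>)"
          using exps by (simp add: \<nu>_def epowr_le_cong)
      qed
      then show ?thesis using exps by (simp add: epowr_le_cong)
    qed
    then have "Besov_scale T \<gamma> q (Omega T m p (incr f - A)) \<le> ennreal C * Besov_scale T \<gamma> q w"
      by (intro bound[rule_format] T borel_measurable_mono_ennreal Omega_mono) (auto simp: w_def Omega_bar_mono)
    then show "\<exists>f. (\<forall>i. (\<lambda>t. f t i) \<in> borel_measurable borel) \<and>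
      BB_norm T m \<gamma> p q (incr f - A) \<le> ennreal C * BB_bar_norm T m \<gamma> p q (delta A)"
      using f by (auto simp: BB_norm_def BB_bar_norm_def w_def)
  qed
qed

section \<open>The Besov bound of the path\<close>

lemma vnorm_ennreal_triangle: "ennreal (vnorm m (u + v)) \<le> ennreal (vnorm m u) + ennreal (vnorm m v)"
  by (simp add: ennreal_plus[symmetric] vnorm_triangle ennreal_leI del: ennreal_plus)

lemma Lp_norm_segment_shift:
  assumes p: "0 < p" and B: "measurable2 T m B" and ah: "0 \<le> a" "0 \<le> h" "a + h \<le> H" "H \<le> T"
  shows "line_norm T m p H (\<lambda>r. B (r + a) (r + a + h)) \<le> Omega T m p B h"
proof -
  have "line_norm T m p H (\<lambda>r. B (r + a) (r + a + h)) \<le>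
      line_norm T m p h (\<lambda>r. B r (r + h))"
    using Lp_norm_shift[OF ah(1,3) p measurable2_vnorm[OF B]] ah by simp
  also have "\<dots> \<le> Omega T m p B h" using ah by (intro Omega_le) auto
  finally show ?thesis .
qed

lemma segment_measurable:
  assumes B: "measurable2 T m B" and ah: "0 \<le> a" "0 \<le> h" "a + h \<le> H" "H \<le> T"
  shows "(\<lambda>r. ennreal (vnorm m (B (r + a) (r + a + h)))) \<in> borel_measurable (segment T H)"
  using measurable_shift[OF ah(1,3) measurable2_vnorm[OF B]] ah by simp

lemma measurable2_zero: "measurable2 T m (\<lambda>s t i. 0)"
  by (simp add: measurable2_def)

lemma measurable2_incr:
  assumes f: "\<And>i. (\<lambda>t. f t i) \<in> borel_measurable borel"
  shows "measurable2 T m (incr f)"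
proof -
  have "incr f - (\<lambda>s t i. 0) = incr f" by (simp add: fun_eq_iff)
  then show ?thesis using measurable2_incr_minus[OF f measurable2_zero, of T m] by simp
qed

lemma omega_eq_Omega: "omega T m p f = Omega T m p (incr f)"
  by (simp add: omega_def Omega_def incr_def fun_eq_iff)

text \<open>Increments of a path are additive, so a step h splits at its midpoint into two steps h /
  2; a general germ does not allow this. It later undoes the halving of the interval in
  \<open>Besov_scale_embedding\<close>.\<close>

lemma Omega_doubling:
  assumes \<sigma>: "0 < \<sigma>" "\<sigma> \<le> 1" "ennreal \<sigma> \<le> p" and f: "\<And>i. (\<lambda>t. f t i) \<in> borel_measurable borel"
    and \<tau>: "\<tau> \<le> T"
  shows "Omega T m p (incr f) \<tau> \<le> ennreal (2 * 2 powr (1 / \<sigma>)) * Omega T m p (incr f) ((1 / 2) * \<tau>)"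
proof -
  have p: "0 < p" using \<sigma> by (auto intro: less_le_trans[of _ "ennreal \<sigma>"])
  have mf: "measurable2 T m (incr f)" by (rule measurable2_incr) (rule f)
  define X where "X = Omega T m p (incr f) ((1 / 2) * \<tau>)"
  have "Omega T m p (incr f) \<tau> \<le> ennreal (2 powr (1 / \<sigma>)) * (X + X)"
    unfolding Omega_def[of _ _ _ _ \<tau>]
  proof (rule SUP_least)
    fix h assume h: "h \<in> {0..\<tau>}"
    let ?L = "\<lambda>g. line_norm T m p h g"
    have 1: "?L (\<lambda>r. incr f (r + 0) (r + 0 + h / 2)) \<le> X"
      using Lp_norm_segment_shift[OF p mf, of 0 "h / 2" h] h \<tau> monoD[OF Omega_mono, of "h / 2" "(1 / 2) * \<tau>"]
      unfolding X_def by (auto intro: order_trans)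
    have 2: "?L (\<lambda>r. incr f (r + h / 2) (r + h / 2 + h / 2)) \<le> X"
      using Lp_norm_segment_shift[OF p mf, of "h / 2" "h / 2" h] h \<tau> monoD[OF Omega_mono, of "h / 2" "(1 / 2) * \<tau>"]
      unfolding X_def by (auto intro: order_trans)
    have "epowr (?L (\<lambda>r. incr f r (r + h))) \<sigma> \<le> epowr (?L (\<lambda>r. incr f (r + 0) (r + 0 + h / 2))) \<sigma> + epowr (?L (\<lambda>r. incr f (r + h / 2) (r + h / 2 + h / 2))) \<sigma>"
    proof (rule Lp_norm_add_le[OF \<sigma> segment_measurable[OF mf] segment_measurable[OF mf] measurable2_vnorm[OF mf]])
      show "AE r in segment T h. ennreal (vnorm m (incr f r (r + h))) \<le>
          ennreal (vnorm m (incr f (r + 0) (r + 0 + h / 2))) + ennreal (vnorm m (incr f (r + h / 2) (r + h / 2 + h / 2)))"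
      proof (rule AE_I2)
        fix r
        have "incr f r (r + h) = incr f (r + 0) (r + 0 + h / 2) + incr f (r + h / 2) (r + h / 2 + h / 2)"
          by (simp add: incr_def algebra_simps)
        then show "ennreal (vnorm m (incr f r (r + h))) \<le>
          ennreal (vnorm m (incr f (r + 0) (r + 0 + h / 2))) + ennreal (vnorm m (incr f (r + h / 2) (r + h / 2 + h / 2)))"
          by (simp only: vnorm_ennreal_triangle)
      qed
    qed (use h \<tau> in auto)
    also have "\<dots> \<le> epowr X \<sigma> + epowr X \<sigma>" using 1 2 \<sigma> by (intro add_mono epowr_mono) auto
    finally show "?L (\<lambda>r. incr f r (r + h)) \<le> ennreal (2 powr (1 / \<sigma>)) * (X + X)"
      by (rule epowr_add_leD[OF \<sigma>(1)])
  qed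
  also have "\<dots> = ennreal (2 * 2 powr (1 / \<sigma>)) * X"
    by (simp add: ennreal_mult mult_2[symmetric] mult_ac)
  finally show ?thesis by (simp add: X_def)
qed

lemma Omega_add_le:
  assumes \<sigma>: "0 < \<sigma>" "\<sigma> \<le> 1" "ennreal \<sigma> \<le> p" and B: "measurable2 T m B" "measurable2 T m B'"
    and BB: "measurable2 T m (B + B')" and \<tau>: "\<tau> \<le> T"
  shows "Omega T m p (B + B') \<tau> \<le> ennreal (2 powr (1 / \<sigma>)) * (Omega T m p B \<tau> + Omega T m p B' \<tau>)"
  unfolding Omega_def[of _ _ _ "B + B'"]
proof (rule SUP_least)
  fix h assume h: "h \<in> {0..\<tau>}"
  let ?L = "\<lambda>B. line_norm T m p h (\<lambda>r. B r (r + h))"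
  have "epowr (?L (B + B')) \<sigma> \<le> epowr (?L B) \<sigma> + epowr (?L B') \<sigma>"
  proof (rule Lp_norm_add_le[OF \<sigma> measurable2_vnorm[OF B(1)] measurable2_vnorm[OF B(2)] measurable2_vnorm[OF BB]])
    show "AE r in segment T h. ennreal (vnorm m ((B + B') r (r + h))) \<le> ennreal (vnorm m (B r (r + h))) + ennreal (vnorm m (B' r (r + h)))"
      by (intro AE_I2) (simp only: plus_fun_apply[of B B'] plus_fun_apply[of "B r" "B' r" for r] vnorm_ennreal_triangle)
  qed (use h \<tau> in auto)
  then have "?L (B + B') \<le> ennreal (2 powr (1 / \<sigma>)) * (?L B + ?L B')"
    by (rule epowr_add_leD[OF \<sigma>(1)])
  also have "\<dots> \<le> ennreal (2 powr (1 / \<sigma>)) * (Omega T m p B \<tau> + Omega T m p B' \<tau>)"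
    using h by (intro mult_left_mono add_mono Omega_le) auto
  finally show "?L (B + B') \<le> ennreal (2 powr (1 / \<sigma>)) * (Omega T m p B \<tau> + Omega T m p B' \<tau>)" .
qed

text \<open>One constant serves all lags, since every segment has length at most
  \<open>T\<close>.\<close>

lemma Omega_inclusion:
  assumes p: "0 < p" "p \<le> p1"
  shows "\<exists>C\<ge>0. \<forall>m B \<tau>. measurable2 T m B \<longrightarrow> \<tau> \<le> T \<longrightarrow> Omega T m p B \<tau> \<le> ennreal C * Omega T m p1 B \<tau>"
proof -
  obtain C where C: "0 \<le> C" "\<And>(M :: real measure) g. emeasure M (space M) \<le> ennreal T \<Longrightarrow> g \<in> borel_measurable M \<Longrightarrow>
      Lp_norm p M g \<le> ennreal C * Lp_norm p1 M g"
    using Lp_norm_inclusion[OF p, of T] by metis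
  show ?thesis
  proof (intro exI[of _ C] conjI C allI impI)
    fix m B \<tau> assume B: "measurable2 T m B" and \<tau>: "\<tau> \<le> T"
    show "Omega T m p B \<tau> \<le> ennreal C * Omega T m p1 B \<tau>"
      unfolding Omega_def[of _ _ p]
    proof (rule SUP_least)
      fix h assume h: "h \<in> {0..\<tau>}"
      have "line_norm T m p h (\<lambda>r. B r (r + h)) \<le>
          ennreal C * Lp_norm p1 (segment T h) (\<lambda>r. ennreal (vnorm m (B r (r + h))))"
      proof (rule C(2))
        show "emeasure (segment T h) (space (segment T h)) \<le> ennreal T"
          using h \<tau> by (auto simp: emeasure_restrict_space intro!: ennreal_leI)
        show "(\<lambda>r. ennreal (vnorm m (B r (r + h)))) \<in> borel_measurable (segment T h)"
          using h \<tau> by (intro measurable2_vnorm B) auto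
      qed
      also have "\<dots> \<le> ennreal C * Omega T m p1 B \<tau>"
        using h by (intro mult_left_mono Omega_le) auto
      finally show "line_norm T m p h (\<lambda>r. B r (r + h)) \<le> ennreal C * Omega T m p1 B \<tau>" .
    qed
  qed
qed

lemma Omega_borel [measurable]: "Omega T m p B \<in> borel_measurable borel"
  by (rule borel_measurable_mono_ennreal[OF Omega_mono])

text \<open>Splitting increments in two and dilating recovers the scales between T / 2 and
  \<open>T\<close>. The dilation factor (1/2)^\<alpha> is bounded by 1 to keep the constant free of
  \<alpha>.\<close>

lemma Besov_seminorm_doubling:
  assumes \<sigma>: "0 < \<sigma>" "\<sigma> \<le> 1" "ennreal \<sigma> \<le> p" and q: "0 < q" and \<alpha>: "0 < \<alpha>"
    and f: "\<And>i. (\<lambda>t. f t i) \<in> borel_measurable borel"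
  shows "Besov_seminorm T m \<alpha> p q f \<le> ennreal (2 * 2 powr (1 / \<sigma>)) * Besov_scale (T / 2) \<alpha> q (Omega T m p (incr f))"
proof -
  let ?w = "Omega T m p (incr f)"
  have m2: "(\<lambda>\<tau>. ?w ((1 / 2) * \<tau>)) \<in> borel_measurable borel"
    by (rule measurable_compose[OF _ Omega_borel]) measurable
  have "Besov_seminorm T m \<alpha> p q f \<le> Besov_scale T \<alpha> q (\<lambda>\<tau>. ennreal (2 * 2 powr (1 / \<sigma>)) * ?w ((1 / 2) * \<tau>))"
    unfolding Besov_seminorm_def omega_eq_Omega
    using m2 by (intro Besov_scale_mono' q Omega_borel borel_measurable_times_ennreal Omega_doubling \<sigma> f) auto
  also have "\<dots> \<le> ennreal (2 * 2 powr (1 / \<sigma>)) * Besov_scale T \<alpha> q (\<lambda>\<tau>. ?w ((1 / 2) * \<tau>))"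
    by (intro Besov_scale_cmult q m2)
  also have "\<dots> \<le> ennreal (2 * 2 powr (1 / \<sigma>)) * (ennreal ((1 / 2) powr \<alpha>) * Besov_scale (T / 2) \<alpha> q ?w)"
    using q by (intro mult_left_mono Besov_scale_rescale Omega_borel) auto
  also have "\<dots> \<le> ennreal (2 * 2 powr (1 / \<sigma>)) * (1 * Besov_scale (T / 2) \<alpha> q ?w)"
  proof (intro mult_left_mono mult_right_mono)
    have "(1 / 2 :: real) powr \<alpha> \<le> 1" using \<alpha> by (intro powr_le1) auto
    then show "ennreal ((1 / 2) powr \<alpha>) \<le> 1" by (simp add: ennreal_le_1)
  qed auto
  finally show ?thesis by simp
qed

text \<open>The quantifier order makes \<open>C\<close> independent of \<alpha>, \<open>m\<close>
  and \<open>A\<close>. The bound concerns any Borel path, with the remainder in place of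
  \<open>delta A\<close>, and so does not refer to the construction of the path.\<close>

definition increment_constant :: "real \<Rightarrow> ennreal \<Rightarrow> ennreal \<Rightarrow> ennreal \<Rightarrow> ennreal \<Rightarrow> real \<Rightarrow> real \<Rightarrow> bool" where
  "increment_constant T p1 p2 q1 q2 \<gamma> C \<longleftrightarrow> 0 \<le> C \<and>
    (\<forall>\<alpha> m A f. 0 < \<alpha> \<longrightarrow> \<alpha> < 1 \<longrightarrow> \<alpha> \<le> \<gamma> \<longrightarrow> measurable2 T m A \<longrightarrow>
      (\<forall>i. (\<lambda>t. f t i) \<in> borel_measurable borel) \<longrightarrow>
      Besov_seminorm T m \<alpha> (min p1 p2) (max q1 q2) f \<le> ennreal C * (BB_norm T m \<alpha> p1 q1 A
        + ennreal (T powr (\<gamma> - \<alpha>)) * BB_norm T m \<gamma> p2 q2 (incr f - A)))"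

lemma increment_constant_exists:
  assumes T: "0 < T" and p: "0 < p1" "0 < p2" and q: "0 < q1" "0 < q2"
  shows "\<exists>C. increment_constant T p1 p2 q1 q2 \<gamma> C"
proof -
  let ?p = "min p1 p2" and ?q = "max q1 q2"
  have p0: "0 < ?p" and q0: "0 < ?q" using p q by (auto simp: less_max_iff_disj)
  obtain \<sigma> where \<sigma>: "0 < \<sigma>" "\<sigma> \<le> 1" "ennreal \<sigma> \<le> ?p"
    using exists_rho[of 0 ?p] p0 by (metis ennreal_0 less_imp_le order_refl zero_less_one)
  obtain \<kappa> where \<kappa>: "0 < \<kappa>" "\<kappa> \<le> 1" "ennreal \<kappa> \<le> ?q"
    using exists_rho[of 0 ?q] q0 by (metis ennreal_0 less_imp_le order_refl zero_less_one)
  obtain C1 where C1: "0 \<le> C1" "\<And>m B \<tau>. measurable2 T m B \<Longrightarrow> \<tau> \<le> T \<Longrightarrow> Omega T m ?p B \<tau> \<le> ennreal C1 * Omega T m p1 B \<tau>"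
    using Omega_inclusion[OF p0, of p1 T] by auto
  obtain C2 where C2: "0 \<le> C2" "\<And>m B \<tau>. measurable2 T m B \<Longrightarrow> \<tau> \<le> T \<Longrightarrow> Omega T m ?p B \<tau> \<le> ennreal C2 * Omega T m p2 B \<tau>"
    using Omega_inclusion[OF p0, of p2 T] by auto
  define s where "s = 2 powr (1 / \<sigma>)"
  define k where "k = 2 powr (1 / \<kappa>)"
  \<comment> \<open>As \<alpha> < 1, the factor 2^\<alpha> of the embedding is bounded by
    2^1.\<close>
  define e1 where "e1 = 2 powr 1 * 2 powr (1 / enn2real q1)"
  define e2 where "e2 = 2 powr 1 * 2 powr (1 / enn2real q2)"
  have pos: "0 \<le> s" "0 \<le> k" "0 \<le> e1" "0 \<le> e2" by (auto simp: s_def k_def e1_def e2_def)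
  \<comment> \<open>From outside to inside: splitting increments (2 s), the triangle inequality for
    A + R in the modulus (s) and in the scale (k), then inclusion in p and embedding in q for each
    summand.\<close>
  define C where "C = 2 * s * (s * (k * (C1 * e1 + C2 * e2)))"
  show ?thesis
    unfolding increment_constant_def
  proof (intro exI[of _ C] conjI allI impI)
    show "0 \<le> C" using pos C1(1) C2(1) by (simp add: C_def)
    fix \<alpha> :: real and m :: nat and A :: "real \<Rightarrow> real \<Rightarrow> nat \<Rightarrow> real" and f :: "real \<Rightarrow> nat \<Rightarrow> real"
    assume \<alpha>: "0 < \<alpha>" "\<alpha> < 1" "\<alpha> \<le> \<gamma>" and A: "measurable2 T m A" and f: "\<forall>i. (\<lambda>t. f t i) \<in> borel_measurable borel"
    define R where "R = incr f - A"
    have R: "measurable2 T m R" unfolding R_def using f A by (intro measurable2_incr_minus) auto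
    have AR: "A + R = incr f" by (simp add: R_def)
    define a where "a = Omega T m p1 A"
    define b where "b = Omega T m p2 R"
    have [measurable]: "a \<in> borel_measurable borel" "b \<in> borel_measurable borel" by (simp_all add: a_def b_def)
    define X where "X = BB_norm T m \<alpha> p1 q1 A"
    define Y where "Y = ennreal (T powr (\<gamma> - \<alpha>)) * BB_norm T m \<gamma> p2 q2 R"
    have XA: "Besov_scale (T / 2) \<alpha> ?q a \<le> ennreal e1 * X"
      unfolding a_def e1_def X_def BB_norm_def using q \<alpha> T by (intro Besov_scale_embedding Omega_mono) auto
    have YB: "Besov_scale (T / 2) \<alpha> ?q b \<le> ennreal e2 * Y"
    proof -
      have "Besov_scale (T / 2) \<alpha> ?q b \<le> ennreal e2 * Besov_scale T \<alpha> q2 b"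
        unfolding b_def e2_def using q \<alpha> T by (intro Besov_scale_embedding Omega_mono) auto
      \<comment> \<open>Trading the weight \<tau>^(-\<alpha>) for \<tau>^(-\<gamma>) costs
        \<tau>^(\<gamma>-\<alpha>), at most T^(\<gamma>-\<alpha>).\<close>
      also have "Besov_scale T \<alpha> q2 b \<le> Besov_scale T \<gamma> q2 (\<lambda>\<tau>. ennreal (T powr (\<gamma> - \<alpha>)) * b \<tau>)"
      proof (rule Besov_scale_mono)
        fix \<tau> assume \<tau>: "0 < \<tau>" "\<tau> \<le> T"
        have "inverse (\<tau> powr \<alpha>) = \<tau> powr (\<gamma> - \<alpha>) * inverse (\<tau> powr \<gamma>)"
          using \<tau> by (simp add: powr_diff field_simps)
        also have "\<dots> \<le> T powr (\<gamma> - \<alpha>) * inverse (\<tau> powr \<gamma>)"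
          using \<tau> \<alpha> by (intro mult_right_mono powr_mono2) auto
        finally have "ennreal (inverse (\<tau> powr \<alpha>)) \<le> ennreal (T powr (\<gamma> - \<alpha>)) * ennreal (inverse (\<tau> powr \<gamma>))"
          by (simp add: ennreal_mult[symmetric] ennreal_leI)
        then have "b \<tau> * ennreal (inverse (\<tau> powr \<alpha>)) \<le> b \<tau> * (ennreal (T powr (\<gamma> - \<alpha>)) * ennreal (inverse (\<tau> powr \<gamma>)))"
          by (rule mult_left_mono) auto
        then show "b \<tau> / ennreal (\<tau> powr \<alpha>) \<le> ennreal (T powr (\<gamma> - \<alpha>)) * b \<tau> / ennreal (\<tau> powr \<gamma>)"
          using \<tau> by (simp add: divide_ennreal_pos mult_ac)
      qed (use q in auto)
      also have "\<dots> \<le> Y"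
        unfolding Y_def b_def BB_norm_def using q by (intro Besov_scale_cmult Omega_borel) auto
      finally show ?thesis by (simp add: mult_left_mono)
    qed
    have "Besov_scale (T / 2) \<alpha> ?q (Omega T m ?p (incr f)) \<le>
        Besov_scale (T / 2) \<alpha> ?q (\<lambda>\<tau>. ennreal s * (ennreal C1 * a \<tau> + ennreal C2 * b \<tau>))"
    proof (rule Besov_scale_mono'[OF q0 Omega_borel])
      fix \<tau> assume "0 < \<tau>" "\<tau> \<le> T / 2"
      then have \<tau>: "\<tau> \<le> T" using T by simp
      have "Omega T m ?p (A + R) \<tau> \<le> ennreal s * (Omega T m ?p A \<tau> + Omega T m ?p R \<tau>)"
        unfolding s_def using A R AR f \<tau> by (intro Omega_add_le \<sigma>) (auto intro: measurable2_incr)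
      also have "\<dots> \<le> ennreal s * (ennreal C1 * a \<tau> + ennreal C2 * b \<tau>)"
        unfolding a_def b_def using A R \<tau> by (intro mult_left_mono add_mono C1(2) C2(2)) auto
      finally show "Omega T m ?p (incr f) \<tau> \<le> ennreal s * (ennreal C1 * a \<tau> + ennreal C2 * b \<tau>)" by (simp add: AR)
    qed measurable
    also have "\<dots> \<le> ennreal s * Besov_scale (T / 2) \<alpha> ?q (\<lambda>\<tau>. ennreal C1 * a \<tau> + ennreal C2 * b \<tau>)"
      by (intro Besov_scale_cmult q0) measurable
    also have "\<dots> \<le> ennreal s * (ennreal k * (Besov_scale (T / 2) \<alpha> ?q (\<lambda>\<tau>. ennreal C1 * a \<tau>) + Besov_scale (T / 2) \<alpha> ?q (\<lambda>\<tau>. ennreal C2 * b \<tau>)))"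
      unfolding k_def by (intro mult_left_mono Besov_scale_add_le \<kappa>) auto
    also have "\<dots> \<le> ennreal s * (ennreal k * (ennreal C1 * (ennreal e1 * X) + ennreal C2 * (ennreal e2 * Y)))"
      using XA YB q0
      by (intro mult_left_mono add_mono order_trans[OF Besov_scale_cmult]) auto
    also have "\<dots> \<le> ennreal s * (ennreal k * (ennreal (C1 * e1 + C2 * e2) * (X + Y)))"
    proof (intro mult_left_mono)
      have "ennreal C1 * (ennreal e1 * X) + ennreal C2 * (ennreal e2 * Y) = ennreal (C1 * e1) * X + ennreal (C2 * e2) * Y"
        using C1(1) C2(1) pos by (simp add: ennreal_mult mult.assoc)
      also have "\<dots> \<le> ennreal (C1 * e1 + C2 * e2) * X + ennreal (C1 * e1 + C2 * e2) * Y"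
        using C1(1) C2(1) pos by (intro add_mono mult_right_mono ennreal_leI) auto
      finally show "ennreal C1 * (ennreal e1 * X) + ennreal C2 * (ennreal e2 * Y) \<le> ennreal (C1 * e1 + C2 * e2) * (X + Y)"
        by (simp add: distrib_left)
    qed auto
    finally have *: "Besov_scale (T / 2) \<alpha> ?q (Omega T m ?p (incr f)) \<le> ennreal s * (ennreal k * (ennreal (C1 * e1 + C2 * e2) * (X + Y)))" .
    have "Besov_seminorm T m \<alpha> ?p ?q f \<le> ennreal (2 * s) * Besov_scale (T / 2) \<alpha> ?q (Omega T m ?p (incr f))"
      unfolding s_def using f by (intro Besov_seminorm_doubling \<sigma> q0 \<alpha>) auto
    also have "\<dots> \<le> ennreal (2 * s) * (ennreal s * (ennreal k * (ennreal (C1 * e1 + C2 * e2) * (X + Y))))"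
      by (intro mult_left_mono *) auto
    also have "\<dots> = ennreal C * (X + Y)"
      using pos C1(1) C2(1) unfolding C_def by (simp add: ennreal_mult mult.assoc del: ennreal_plus)
    finally show "Besov_seminorm T m \<alpha> ?p ?q f \<le> ennreal C * (BB_norm T m \<alpha> p1 q1 A
        + ennreal (T powr (\<gamma> - \<alpha>)) * BB_norm T m \<gamma> p2 q2 (incr f - A))"
      by (simp add: X_def Y_def R_def)
  qed
qed

section \<open>Integrability of the path\<close>

lemma exists_base_point:
  fixes g :: "real \<Rightarrow> real \<Rightarrow> ennreal"
  assumes g: "(\<lambda>z. g (fst z) (snd z)) \<in> borel_measurable (borel \<Otimes>\<^sub>M borel)"
    and sym: "\<And>s t. g s t = g t s" and T: "0 < T" and B: "B < top"
    and le: "\<And>h. 0 < h \<Longrightarrow> h \<le> T \<Longrightarrow> (\<integral>\<^sup>+r. g r (r + h) * indicator {0..T - h} r \<partial>lborel) \<le> B"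
  obtains c where "0 < c" "c < T" "(\<integral>\<^sup>+t. g c t * indicator ({0..T} - {c}) t \<partial>lborel) < top"
proof -
  have g': "(\<lambda>x. g (a x) (b x)) \<in> borel_measurable N"
    if "a \<in> borel_measurable N" "b \<in> borel_measurable N" for a b and N :: "'n measure"
    using measurable_compose[OF measurable_Pair[OF that] g] by (simp only: fst_conv snd_conv)
  note [measurable] = g'
  define F where "F r t = (if 0 \<le> r \<and> r < t \<and> t \<le> T then g r t else 0)" for r t
  have F': "(\<lambda>x. F (a x) (b x)) \<in> borel_measurable N"
    if [measurable]: "a \<in> borel_measurable N" "b \<in> borel_measurable N" for a b and N :: "'n measure"
    unfolding F_def by measurable
  note [measurable] = F'
  have inner: "(\<integral>\<^sup>+h. F r (r + h) \<partial>lborel) = (\<integral>\<^sup>+t. F r t \<partial>lborel)" for r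
    using nn_integral_real_affine[of "F r" 1 r] by simp
  have "(\<integral>\<^sup>+h. \<integral>\<^sup>+r. F r (r + h) \<partial>lborel \<partial>lborel) \<le> (\<integral>\<^sup>+h. B * indicator {0..T} h \<partial>lborel)"
  proof (rule nn_integral_mono)
    fix h :: real
    show "(\<integral>\<^sup>+r. F r (r + h) \<partial>lborel) \<le> B * indicator {0..T} h"
    proof (cases "0 < h \<and> h \<le> T")
      case True
      have "(\<integral>\<^sup>+r. F r (r + h) \<partial>lborel) \<le> (\<integral>\<^sup>+r. g r (r + h) * indicator {0..T - h} r \<partial>lborel)"
        by (intro nn_integral_mono) (auto simp: F_def split: split_indicator)
      then show ?thesis using le[of h] True by (auto intro: order_trans)
    next
      case False
      then have "F r (r + h) = 0" for r by (auto simp: F_def)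
      then show ?thesis by simp
    qed
  qed
  also have "\<dots> = B * ennreal T" using T by (subst nn_integral_cmult_indicator) auto
  also have "\<dots> < top" using B by (simp add: ennreal_mult_less_top)
  finally have "(\<integral>\<^sup>+r. \<integral>\<^sup>+h. F r (r + h) \<partial>lborel \<partial>lborel) < top"
    by (subst (asm) lborel_pair.Fubini') measurable
  then have fin: "(\<integral>\<^sup>+r. \<integral>\<^sup>+t. F r t \<partial>lborel \<partial>lborel) < top" unfolding inner .
  then have fin': "(\<integral>\<^sup>+t. \<integral>\<^sup>+r. F r t \<partial>lborel \<partial>lborel) < top"
    by (subst (asm) lborel_pair.Fubini') measurable
  \<comment> \<open>Integrability over the triangle is used in both orders: c needs finite integrals
    over the points after it and over those before it. Symmetry of \<open>g\<close> then joins the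
    two.\<close>
  have "AE c in lborel. (\<integral>\<^sup>+t. F c t \<partial>lborel) \<noteq> \<infinity>"
    using fin by (intro nn_integral_noteq_infinite) auto
  moreover have "AE c in lborel. (\<integral>\<^sup>+r. F r c \<partial>lborel) \<noteq> \<infinity>"
    using fin' by (intro nn_integral_noteq_infinite) auto
  ultimately have "AE c in lborel. (\<integral>\<^sup>+t. F c t \<partial>lborel) \<noteq> \<infinity> \<and> (\<integral>\<^sup>+r. F r c \<partial>lborel) \<noteq> \<infinity>"
    by eventually_elim auto
  from AE_lborel_interval_point[OF this T]
  obtain c where c: "0 < c" "c < T" "(\<integral>\<^sup>+t. F c t \<partial>lborel) \<noteq> \<infinity>" "(\<integral>\<^sup>+r. F r c \<partial>lborel) \<noteq> \<infinity>" by blast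
  have "(\<integral>\<^sup>+t. g c t * indicator ({0..T} - {c}) t \<partial>lborel) \<le> (\<integral>\<^sup>+t. F c t + F t c \<partial>lborel)"
    using c sym by (intro nn_integral_mono) (auto simp: F_def split: split_indicator)
  also have "\<dots> = (\<integral>\<^sup>+t. F c t \<partial>lborel) + (\<integral>\<^sup>+t. F t c \<partial>lborel)"
    by (intro nn_integral_add) measurable
  also have "\<dots> < top" using c by (simp add: less_top)
  finally show ?thesis using that c by blast
qed

text \<open>The increments have a common bound for all lags up to \<open>T\<close>; Fubini turns it
  into integrability from almost every fixed base point c.\<close>

lemma Lp_norm_increments_finite:
  assumes p: "0 < p" and f: "\<And>i. (\<lambda>t. f t i) \<in> borel_measurable borel" and T: "0 < T"
    and fin: "Omega T m p (incr f) T < top"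
  obtains c where "Lp_norm p (lebesgue_on {0..T}) (\<lambda>t. ennreal (vnorm m (f t - f c))) < top"
proof -
  define W where "W = Omega T m p (incr f) T"
  \<comment> \<open>For infinite p the bound by \<open>W\<close> is expressed by an integral too:
    the penalty is 0 up to \<open>W\<close> and infinite beyond, so both cases go through the same
    Fubini argument.\<close>
  define \<phi> where "\<phi> x = (if p = top then if x \<le> W then 0 else top else epowr x (enn2real p))" for x :: ennreal
  have [measurable]: "\<phi> \<in> borel_measurable borel"
  proof (cases "p = top")
    case False
    then have "0 < enn2real p" using p by (simp add: enn2real_pos)
    then show ?thesis using False unfolding \<phi>_def by simp
  next
    case True
    then have "\<phi> = (\<lambda>x. if x \<le> W then 0 else top)" by (auto simp: \<phi>_def)
    then show ?thesis by simp
  qed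
  define g where "g s t = \<phi> (ennreal (vnorm m (f t - f s)))" for s t
  have gm: "(\<lambda>z. g (fst z) (snd z)) \<in> borel_measurable (borel \<Otimes>\<^sub>M borel)"
  proof -
    note [measurable] = measurable_compose[OF measurable_fst f] measurable_compose[OF measurable_snd f]
    have "(\<lambda>z. vnorm m (f (snd z) - f (fst z))) \<in> borel_measurable (borel \<Otimes>\<^sub>M borel)"
      unfolding fun_diff_def by (rule borel_measurable_vnorm) measurable
    then show ?thesis unfolding g_def by measurable
  qed
  have mf: "measurable2 T m (incr f)" by (rule measurable2_incr) (rule f)
  have Lp_le: "(\<integral>\<^sup>+r. \<phi> (u r) * indicator {a..b} r \<partial>lborel) \<le> (if p = top then 0 else epowr W (enn2real p))"
    if u: "u \<in> borel_measurable (lebesgue_on {a..b})" and le: "Lp_norm p (lebesgue_on {a..b}) u \<le> W" for u and a b :: real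
  proof (cases "p = top")
    case True
    then have "AE r in lebesgue_on {a..b}. u r \<le> W" using le u p by (simp add: Lp_norm_le_iff)
    then have "AE r in lborel. a \<le> r \<and> r \<le> b \<longrightarrow> u r \<le> W" by (simp add: AE_lebesgue_on_interval)
    then have "AE r in lborel. \<phi> (u r) * indicator {a..b} r = 0"
      by eventually_elim (auto simp: \<phi>_def True split: split_indicator)
    from nn_integral_cong_AE[OF this] show ?thesis using True by simp
  next
    case False
    have "(\<integral>\<^sup>+r. \<phi> (u r) * indicator {a..b} r \<partial>lborel) = (\<integral>\<^sup>+r. \<phi> (u r) \<partial>lebesgue_on {a..b})"
      by (simp add: nn_integral_restrict_space nn_integral_completion)
    then show ?thesis using le u p False by (simp add: Lp_norm_le_iff \<phi>_def)
  qed
  have B: "(if p = top then 0 else epowr W (enn2real p)) < top"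
    using fin by (simp add: W_def less_top[symmetric])
  obtain c where c: "0 < c" "c < T" "(\<integral>\<^sup>+t. g c t * indicator ({0..T} - {c}) t \<partial>lborel) < top"
  proof (rule exists_base_point[OF gm _ T B])
    show "g s t = g t s" for s t unfolding g_def by (subst vnorm_minus_commute) simp
    fix h assume h: "0 < h" "h \<le> T"
    have "line_norm T m p h (\<lambda>r. incr f r (r + h)) \<le> W"
      unfolding W_def using h by (intro Omega_le) auto
    from Lp_le[OF measurable2_vnorm[OF mf] this]
    show "(\<integral>\<^sup>+r. g r (r + h) * indicator {0..T - h} r \<partial>lborel) \<le> (if p = top then 0 else epowr W (enn2real p))"
      using h by (simp add: g_def incr_def)
  qed blast
  let ?u = "\<lambda>t. ennreal (vnorm m (f t - f c))"
  have "?u \<in> borel_measurable borel"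
    unfolding fun_diff_def using f by (intro measurable_compose[OF _ measurable_ennreal] borel_measurable_vnorm borel_measurable_diff) auto
  then have um: "?u \<in> borel_measurable (lebesgue_on {0..T})"
    by (intro measurable_restrict_space1 measurable_completion) simp
  have AEc: "AE t in lborel. t \<noteq> c" by (rule AE_lborel_singleton)
  have "(\<integral>\<^sup>+t. g c t * indicator ({0..T} - {c}) t \<partial>lborel) = (\<integral>\<^sup>+t. g c t * indicator {0..T} t \<partial>lborel)"
    using AEc by (intro nn_integral_cong_AE) (auto elim!: eventually_mono split: split_indicator)
  then have int: "(\<integral>\<^sup>+t. g c t * indicator {0..T} t \<partial>lborel) < top" using c by simp
  have "Lp_norm p (lebesgue_on {0..T}) ?u < top"
  proof (cases "p = top")
    case True
    have [measurable]: "g c \<in> borel_measurable borel"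
      using measurable_compose[OF measurable_Pair[OF measurable_const measurable_ident] gm, of c] by simp
    have "AE t in lborel. g c t * indicator {0..T} t \<noteq> \<infinity>"
      using int by (intro nn_integral_noteq_infinite) auto
    then have "AE t in lborel. 0 \<le> t \<and> t \<le> T \<longrightarrow> ?u t \<le> W"
      by eventually_elim (auto simp: g_def \<phi>_def True ennreal_top_mult split: if_splits)
    then have "Lp_norm p (lebesgue_on {0..T}) ?u \<le> W"
      using True p um by (simp add: Lp_norm_le_iff AE_lebesgue_on_interval)
    then show ?thesis using fin by (simp add: W_def le_less_trans)
  next
    case False
    have "epowr (Lp_norm p (lebesgue_on {0..T}) ?u) (enn2real p) = (\<integral>\<^sup>+t. g c t * indicator {0..T} t \<partial>lborel)"
      using p False by (simp add: Lp_norm_finite_pow nn_integral_restrict_space nn_integral_completion g_def \<phi>_def)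
    with int have "epowr (Lp_norm p (lebesgue_on {0..T}) ?u) (enn2real p) \<noteq> top"
      by (metis less_irrefl)
    then show ?thesis by (simp add: less_top[symmetric])
  qed
  then show ?thesis using that by blast
qed

text \<open>The seminorm already forces p-integrability: the modulus is finite at some \<tau>
  between T / 2 and \<open>T\<close>, doubling makes it finite at \<open>T\<close>, and then f - f c
  is p-integrable for a suitable c, as is the constant f c.\<close>

lemma Besov_memI:
  assumes p: "0 < p" and q: "0 < q" and T: "0 < T" and \<alpha>: "0 < \<alpha>"
    and f: "\<And>i. (\<lambda>t. f t i) \<in> borel_measurable borel" and fin: "Besov_seminorm T m \<alpha> p q f < top"
  shows "f \<in> Besov T m \<alpha> p q"
proof -
  let ?w = "Omega T m p (incr f)"
  obtain \<sigma> where \<sigma>: "0 < \<sigma>" "\<sigma> \<le> 1" "ennreal \<sigma> \<le> p"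
    using exists_rho[of 0 p] p by (metis ennreal_0 less_imp_le order_refl zero_less_one)
  have "AE \<tau> in log_measure T. ?w \<tau> / ennreal (\<tau> powr \<alpha>) < top"
    using fin unfolding Besov_seminorm_def Besov_scale_def omega_eq_Omega
    by (intro Lp_norm_finite_AE[OF q log_measure_measurable]) auto
  then have "AE \<tau> in lborel. 0 < \<tau> \<and> \<tau> \<le> T \<longrightarrow> ?w \<tau> / ennreal (\<tau> powr \<alpha>) < top"
    by (simp add: AE_log_measure)
  from AE_lborel_interval_point[OF this, of "T / 2" T] T
  obtain \<tau> where \<tau>: "T / 2 < \<tau>" "\<tau> < T" "?w \<tau> / ennreal (\<tau> powr \<alpha>) < top" by auto
  have "?w \<tau> \<noteq> top"
  proof
    assume "?w \<tau> = top"
    then show False using \<tau> T by (simp add: divide_ennreal_pos ennreal_top_mult)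
  qed
  then have half: "?w ((1 / 2) * T) < top"
    using monoD[OF Omega_mono, of "(1 / 2) * T" \<tau> T m p "incr f"] \<tau> by (simp add: less_top[symmetric] neq_top_trans)
  have "?w T \<le> ennreal (2 * 2 powr (1 / \<sigma>)) * ?w ((1 / 2) * T)"
    using f by (intro Omega_doubling \<sigma>) auto
  also have "\<dots> < top" using half by (intro ennreal_mult_less_top[THEN iffD2]) auto
  finally have "?w T < top" .
  then obtain c where c: "Lp_norm p (lebesgue_on {0..T}) (\<lambda>t. ennreal (vnorm m (f t - f c))) < top"
    using Lp_norm_increments_finite[where f = f and T = T and p = p and m = m] p f T by metis
  have fm: "(\<lambda>t. f t i) \<in> borel_measurable (lebesgue_on {0..T})" for i
    using f[of i] by (intro measurable_restrict_space1 measurable_completion) simp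
  let ?L = "Lp_norm p (lebesgue_on {0..T})"
  have "epowr (?L (\<lambda>t. ennreal (vnorm m (f t)))) \<sigma> \<le>
      epowr (?L (\<lambda>t. ennreal (vnorm m (f t - f c)))) \<sigma> + epowr (?L (\<lambda>t. ennreal (vnorm m (f c)))) \<sigma>"
  proof (rule Lp_norm_add_le[OF \<sigma>])
    show "(\<lambda>t. ennreal (vnorm m (f t - f c))) \<in> borel_measurable (lebesgue_on {0..T})"
      unfolding fun_diff_def using fm by (intro measurable_compose[OF _ measurable_ennreal] borel_measurable_vnorm borel_measurable_diff) auto
    show "(\<lambda>t. ennreal (vnorm m (f t))) \<in> borel_measurable (lebesgue_on {0..T})"
      using fm by (intro measurable_compose[OF _ measurable_ennreal] borel_measurable_vnorm) auto
    show "AE t in lebesgue_on {0..T}. ennreal (vnorm m (f t)) \<le> ennreal (vnorm m (f t - f c)) + ennreal (vnorm m (f c))"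
    proof (rule AE_I2)
      fix t show "ennreal (vnorm m (f t)) \<le> ennreal (vnorm m (f t - f c)) + ennreal (vnorm m (f c))"
        using vnorm_ennreal_triangle[of m "f t - f c" "f c"] by simp
    qed
  qed simp
  then have *: "?L (\<lambda>t. ennreal (vnorm m (f t))) \<le> ennreal (2 powr (1 / \<sigma>)) *
      (?L (\<lambda>t. ennreal (vnorm m (f t - f c))) + ?L (\<lambda>t. ennreal (vnorm m (f c))))"
    by (rule epowr_add_leD[OF \<sigma>(1)])
  obtain C where C: "\<forall>(M :: real measure) g. emeasure M (space M) \<le> ennreal T \<longrightarrow> g \<in> borel_measurable M \<longrightarrow>
      Lp_norm p M g \<le> ennreal C * Lp_norm top M g"
    using Lp_norm_inclusion[OF p top_greatest, of T] by blast
  have "?L (\<lambda>t. ennreal (vnorm m (f c))) \<le> ennreal C * Lp_norm top (lebesgue_on {0..T}) (\<lambda>t. ennreal (vnorm m (f c)))"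
    using C T by (simp add: emeasure_restrict_space)
  also have "\<dots> \<le> ennreal C * ennreal (vnorm m (f c))"
    by (intro mult_left_mono) (auto simp: Lp_norm_le_iff)
  also have "\<dots> < top" by (simp add: ennreal_mult_less_top)
  finally have "?L (\<lambda>t. ennreal (vnorm m (f c))) < top" .
  with c have "ennreal (2 powr (1 / \<sigma>)) *
      (?L (\<lambda>t. ennreal (vnorm m (f t - f c))) + ?L (\<lambda>t. ennreal (vnorm m (f c)))) < top"
    by (intro ennreal_mult_less_top[THEN iffD2]) auto
  with * have "?L (\<lambda>t. ennreal (vnorm m (f t))) < top" by (rule le_less_trans)
  then show ?thesis using fm fin by (simp add: Besov_def)
qed

section \<open>Convergence of Riemann sums over arbitrary partitions\<close>

lemma riemann_sum_error:
  assumes "unit_partition P"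
  shows "(riemann_sum P A - incr f) s t =
    (\<Sum>i = 1..<length P. - (incr f - A) (s + P ! (i - 1) * (t - s)) (s + P ! i * (t - s)))"
proof -
  define x where "x i = s + P ! i * (t - s)" for i
  have ne: "P \<noteq> []" and ends: "P ! 0 = 0" "P ! (length P - 1) = 1"
    using assms by (auto simp: unit_partition_def hd_conv_nth last_conv_nth)
  have tel: "(\<Sum>i = 1..<Suc n. f (x i) - f (x (i - 1))) = f (x n) - f (x 0)" for n
    by (induction n) (simp_all only: sum.atLeastLessThan_Suc, auto simp: fun_eq_iff)
  have "(\<Sum>i = 1..<length P. f (x i) - f (x (i - 1))) = incr f s t"
    using tel[of "length P - 1"] ne ends by (simp add: x_def incr_def)
  then have "(riemann_sum P A - incr f) s t = (\<Sum>i = 1..<length P. A (x (i - 1)) (x i)) - (\<Sum>i = 1..<length P. f (x i) - f (x (i - 1)))"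
    by (simp add: riemann_sum_def x_def)
  also have "\<dots> = (\<Sum>i = 1..<length P. A (x (i - 1)) (x i) - (f (x i) - f (x (i - 1))))"
    by (simp only: sum_subtractf)
  also have "\<dots> = (\<Sum>i = 1..<length P. - (incr f - A) (x (i - 1)) (x i))"
    by (intro sum.cong refl) (simp add: incr_def fun_eq_iff)
  finally show ?thesis by (simp only: x_def)
qed

lemma partition_increments:
  assumes P: "unit_partition P" and i: "i \<in> {1..<length P}"
  shows "0 \<le> P ! (i - 1)" "P ! (i - 1) < P ! i" "P ! i \<le> 1" "P ! i - P ! (i - 1) \<le> mesh P"
proof -
  have sorted: "P ! j < P ! k" if "j < k" "k < length P" for j k
    using P that by (auto simp: unit_partition_def sorted_wrt_iff_nth_less)
  have le: "P ! j \<le> P ! k" if "j \<le> k" "k < length P" for j k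
    using sorted[of j k] that by (cases "j = k") auto
  have ne: "P \<noteq> []" and ends: "P ! 0 = 0" "P ! (length P - 1) = 1"
    using P by (auto simp: unit_partition_def hd_conv_nth last_conv_nth)
  show "0 \<le> P ! (i - 1)" using le[of 0 "i - 1"] i ends by auto
  show "P ! (i - 1) < P ! i" using sorted[of "i - 1" i] i by auto
  show "P ! i \<le> 1" using le[of i "length P - 1"] i ends by auto
  show "P ! i - P ! (i - 1) \<le> mesh P" unfolding mesh_def using i by (intro Max_ge) auto
qed

lemma sum_partition_increments:
  assumes "unit_partition P"
  shows "(\<Sum>i = 1..<length P. P ! i - P ! (i - 1)) = 1"
proof -
  have ne: "P \<noteq> []" and ends: "P ! 0 = 0" "P ! (length P - 1) = 1"
    using assms by (auto simp: unit_partition_def hd_conv_nth last_conv_nth)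
  have "(\<Sum>i = 1..<Suc n. P ! i - P ! (i - 1)) = P ! n - P ! 0" for n by (induction n) auto
  from this[of "length P - 1"] show ?thesis using ne ends by simp
qed

text \<open>The remainder of the pieces scales like \<open>c\<^sup>\<gamma>\<close> with their length \<open>c\<close>, and \<open>\<Sum> c\<^sup>\<gamma>\<^sup>\<rho> \<le> \<parallel>P\<parallel>\<^sup>\<gamma>\<^sup>\<rho>\<^sup>-\<^sup>1\<close>.\<close>

lemma riemann_sum_error_bound:
  assumes \<rho>: "0 < \<rho>" "\<rho> \<le> 1" "ennreal \<rho> \<le> p" "ennreal \<rho> \<le> r" "1 < \<gamma> * \<rho>"
    and T: "0 < T" and f: "\<And>i. (\<lambda>t. f t i) \<in> borel_measurable borel" and A: "measurable2 T m A"
    and P: "unit_partition P" "mesh P \<le> 1 / 2"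
  shows "BB_norm T m \<gamma> p r (riemann_sum P A - incr f) \<le>
    ennreal (mesh P powr ((\<gamma> * \<rho> - 1) / \<rho>)) * Besov_scale (T / 2) \<gamma> r (Omega T m p (incr f - A))"
proof -
  define R where "R = incr f - A"
  have R: "measurable2 T m R" unfolding R_def by (intro measurable2_incr_minus A f)
  have p: "0 < p" and r: "0 < r" using \<rho> by (auto intro: less_le_trans[of _ "ennreal \<rho>"])
  define I where "I = {1..<length P}"
  define c where "c i = P ! i - P ! (i - 1)" for i
  have c: "0 < c i" "c i \<le> mesh P" "c i \<le> 1 / 2" if "i \<in> I" for i
    using partition_increments[OF P(1), of i] that P(2) by (auto simp: c_def I_def)
  define E where "E = riemann_sum P A - incr f"
  have OE: "epowr (Omega T m p E \<tau>) \<rho> \<le> (\<Sum>i\<in>I. epowr (Omega T m p R (c i * \<tau>)) \<rho>)" if \<tau>: "0 < \<tau>" "\<tau> \<le> T" for \<tau>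
  proof -
    have "Omega T m p E \<tau> \<le> epowr (\<Sum>i\<in>I. epowr (Omega T m p R (c i * \<tau>)) \<rho>) (1 / \<rho>)"
      unfolding Omega_def[of _ _ _ E]
    proof (rule SUP_least)
      fix h assume h: "h \<in> {0..\<tau>}"
      define piece where "piece i s = R (s + P ! (i - 1) * h) (s + P ! (i - 1) * h + c i * h)" for i s
      have Es: "E s (s + h) = (\<Sum>i\<in>I. - piece i s)" for s
        using riemann_sum_error[OF P(1), of A f s "s + h"]
        by (simp add: E_def I_def piece_def R_def c_def algebra_simps)
      have seg: "0 \<le> P ! (i - 1) * h" "0 \<le> c i * h" "P ! (i - 1) * h + c i * h \<le> h" "h \<le> T" if i: "i \<in> I" for i
      proof -
        have "P ! i * h \<le> 1 * h" using partition_increments[OF P(1), of i] i h by (intro mult_right_mono) (auto simp: I_def)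
        then show "P ! (i - 1) * h + c i * h \<le> h" by (simp add: c_def algebra_simps)
      qed (use partition_increments[OF P(1), of i] i h \<tau> c[OF i] in \<open>auto simp: I_def\<close>)
      have meas: "(\<lambda>s. ennreal (vnorm m (piece i s))) \<in> borel_measurable (segment T h)" if "i \<in> I" for i
        unfolding piece_def using seg[OF that] by (intro segment_measurable R)
      have vsum: "ennreal (vnorm m (E s (s + h))) \<le> (\<Sum>i\<in>I. ennreal (vnorm m (piece i s)))" for s
      proof -
        have "vnorm m (E s (s + h)) \<le> (\<Sum>i\<in>I. vnorm m (- piece i s))" unfolding Es by (rule vnorm_sum_le)
        also have "\<dots> = (\<Sum>i\<in>I. vnorm m (piece i s))" by (simp only: vnorm_minus)
        finally show ?thesis by (simp add: sum_ennreal ennreal_leI)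
      qed
      let ?L = "\<lambda>g. line_norm T m p h g"
      have "epowr (?L (\<lambda>s. E s (s + h))) \<rho> \<le> (\<Sum>i\<in>I. epowr (?L (piece i)) \<rho>)"
      proof (rule Lp_norm_rho_sum[OF \<rho>(1,3)])
        have Em: "(\<lambda>s. E s (s + h) j) \<in> borel_measurable (segment T h)" if j: "j < m" for j
        proof -
          have "(\<lambda>s. R (s + P ! (i - 1) * h) (s + P ! (i - 1) * h + c i * h) j) \<in> borel_measurable (segment T h)" if i: "i \<in> I" for i
          proof -
            have "c i * h \<le> T" using seg[OF i] by linarith
            then have "(\<lambda>s. R s (s + c i * h) j) \<in> borel_measurable (lebesgue_on {0..T - c i * h})"
              using R j seg(2)[OF i] by (simp add: measurable2_def)
            from measurable_shift[OF seg(1,3)[OF i] this] show ?thesis .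
          qed
          then show ?thesis unfolding Es sum_fun_apply piece_def by (auto intro!: borel_measurable_sum)
        qed
        then show "(\<lambda>s. ennreal (vnorm m (E s (s + h)))) \<in> borel_measurable (segment T h)"
          by (intro measurable_compose[OF _ measurable_ennreal] borel_measurable_vnorm)
        show "AE s in segment T h. epowr (ennreal (vnorm m (E s (s + h)))) \<rho> \<le> (\<Sum>i\<in>I. epowr (ennreal (vnorm m (piece i s))) \<rho>)"
          by (intro AE_I2 order_trans[OF epowr_mono[OF \<rho>(1) vsum] epowr_sum_le[OF \<rho>(1,2)]])
      qed (use meas in \<open>auto simp: I_def\<close>)
      also have "\<dots> \<le> (\<Sum>i\<in>I. epowr (Omega T m p R (c i * \<tau>)) \<rho>)"
      proof (intro sum_mono epowr_mono \<rho>(1))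
        fix i assume i: "i \<in> I"
        have "?L (piece i) \<le> Omega T m p R (c i * h)"
          unfolding piece_def using seg[OF i] by (intro Lp_norm_segment_shift p R)
        also have "\<dots> \<le> Omega T m p R (c i * \<tau>)"
          using c[OF i] h by (intro monoD[OF Omega_mono] mult_left_mono) auto
        finally show "?L (piece i) \<le> Omega T m p R (c i * \<tau>)" .
      qed
      finally show "?L (\<lambda>s. E s (s + h)) \<le> epowr (\<Sum>i\<in>I. epowr (Omega T m p R (c i * \<tau>)) \<rho>) (1 / \<rho>)"
        using \<rho> by (simp add: epowr_le_cong)
    qed
    then show ?thesis using \<rho> by (simp add: epowr_le_cong)
  qed
  define M where "M = Besov_scale (T / 2) \<gamma> r (Omega T m p R)"
  have mscaled: "(\<lambda>\<tau>. Omega T m p R (c i * \<tau>)) \<in> borel_measurable borel" for i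
    by (rule measurable_compose[OF _ Omega_borel]) measurable
  \<comment> \<open>A second triangle inequality, now in the scale, needs \<rho> \<le> r, just as
    the first one, in the modulus, needed \<rho> \<le> p.\<close>
  have "epowr (Besov_scale T \<gamma> r (Omega T m p E)) \<rho> \<le> (\<Sum>i\<in>I. epowr (Besov_scale T \<gamma> r (\<lambda>\<tau>. Omega T m p R (c i * \<tau>))) \<rho>)"
    unfolding Besov_scale_def
  proof (rule Lp_norm_rho_sum[OF \<rho>(1,4)])
    show "AE \<tau> in log_measure T. epowr (Omega T m p E \<tau> / ennreal (\<tau> powr \<gamma>)) \<rho> \<le> (\<Sum>i\<in>I. epowr (Omega T m p R (c i * \<tau>) / ennreal (\<tau> powr \<gamma>)) \<rho>)"
      unfolding AE_log_measure
    proof (intro AE_I2 impI)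
      fix \<tau> :: real assume \<tau>: "0 < \<tau> \<and> \<tau> \<le> T"
      have "epowr (Omega T m p E \<tau> / ennreal (\<tau> powr \<gamma>)) \<rho> = epowr (Omega T m p E \<tau>) \<rho> * epowr (ennreal (inverse (\<tau> powr \<gamma>))) \<rho>"
        using \<tau> \<rho> by (simp add: divide_ennreal_pos epowr_mult del: epowr_ennreal)
      also have "\<dots> \<le> (\<Sum>i\<in>I. epowr (Omega T m p R (c i * \<tau>)) \<rho>) * epowr (ennreal (inverse (\<tau> powr \<gamma>))) \<rho>"
        using OE \<tau> by (intro mult_right_mono) auto
      also have "\<dots> = (\<Sum>i\<in>I. epowr (Omega T m p R (c i * \<tau>) / ennreal (\<tau> powr \<gamma>)) \<rho>)"
        using \<tau> \<rho> by (simp add: divide_ennreal_pos epowr_mult sum_distrib_right del: epowr_ennreal)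
      finally show "epowr (Omega T m p E \<tau> / ennreal (\<tau> powr \<gamma>)) \<rho> \<le> (\<Sum>i\<in>I. epowr (Omega T m p R (c i * \<tau>) / ennreal (\<tau> powr \<gamma>)) \<rho>)" .
    qed
    show "(\<lambda>\<tau>. Omega T m p R (c i * \<tau>) / ennreal (\<tau> powr \<gamma>)) \<in> borel_measurable (log_measure T)" for i
      by (intro log_measure_measurable borel_measurable_divide_ennreal mscaled) measurable
    show "(\<lambda>\<tau>. Omega T m p E \<tau> / ennreal (\<tau> powr \<gamma>)) \<in> borel_measurable (log_measure T)"
      by (intro log_measure_measurable) measurable
  qed (simp add: I_def)
  also have "\<dots> \<le> (\<Sum>i\<in>I. ennreal (c i powr (\<gamma> * \<rho>)) * epowr M \<rho>)"
  proof (intro sum_mono)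
    fix i assume i: "i \<in> I"
    \<comment> \<open>Pieces of relative length at most 1/2 only see lags up to T / 2, which is why
      the scale on the right stops there.\<close>
    have "Besov_scale T \<gamma> r (\<lambda>\<tau>. Omega T m p R (c i * \<tau>)) \<le> ennreal (c i powr \<gamma>) * M"
      unfolding M_def using c[OF i] T mult_right_mono[of "c i" "1 / 2" T]
      by (intro Besov_scale_rescale r Omega_borel) auto
    then have "epowr (Besov_scale T \<gamma> r (\<lambda>\<tau>. Omega T m p R (c i * \<tau>))) \<rho> \<le> epowr (ennreal (c i powr \<gamma>) * M) \<rho>"
      using \<rho> by (intro epowr_mono) auto
    then show "epowr (Besov_scale T \<gamma> r (\<lambda>\<tau>. Omega T m p R (c i * \<tau>))) \<rho> \<le> ennreal (c i powr (\<gamma> * \<rho>)) * epowr M \<rho>"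
      using \<rho> by (simp add: epowr_mult powr_powr)
  qed
  also have "\<dots> = ennreal (\<Sum>i\<in>I. c i powr (\<gamma> * \<rho>)) * epowr M \<rho>"
    by (simp add: sum_distrib_right[symmetric] sum_ennreal)
  also have "\<dots> \<le> ennreal (mesh P powr (\<gamma> * \<rho> - 1)) * epowr M \<rho>"
  proof (intro mult_right_mono ennreal_leI)
    have "(\<Sum>i\<in>I. c i powr (\<gamma> * \<rho>)) \<le> (\<Sum>i\<in>I. mesh P powr (\<gamma> * \<rho> - 1) * c i)"
    proof (intro sum_mono)
      fix i assume i: "i \<in> I"
      have "c i powr (\<gamma> * \<rho>) = c i powr (\<gamma> * \<rho> - 1) * c i"
        using c[OF i] by (simp add: powr_diff)
      also have "\<dots> \<le> mesh P powr (\<gamma> * \<rho> - 1) * c i"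
        using c[OF i] \<rho> by (intro mult_right_mono powr_mono2) auto
      finally show "c i powr (\<gamma> * \<rho>) \<le> mesh P powr (\<gamma> * \<rho> - 1) * c i" .
    qed
    also have "\<dots> = mesh P powr (\<gamma> * \<rho> - 1)"
      using sum_partition_increments[OF P(1)] by (simp add: sum_distrib_left[symmetric] I_def c_def)
    finally show "(\<Sum>i\<in>I. c i powr (\<gamma> * \<rho>)) \<le> mesh P powr (\<gamma> * \<rho> - 1)" .
  qed auto
  also have "\<dots> = epowr (ennreal (mesh P powr ((\<gamma> * \<rho> - 1) / \<rho>)) * M) \<rho>"
    using \<rho> by (simp add: epowr_mult powr_powr)
  finally show ?thesis
    using \<rho> by (simp only: epowr_le_iff BB_norm_def E_def M_def R_def)
qed

text \<open>A fresh \<rho> below r is chosen, possibly different from the one that produced the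
  path; of the path, only measurability and the finite norm of its remainder are used. The embedding
  from q into r, available on half of the interval, makes the factor of the mesh power
  finite.\<close>

lemma riemann_sum_tendsto:
  assumes p: "0 < p" and q: "0 < q" "q \<le> r" "ennreal (1 / \<gamma>) < r" and \<gamma>: "max 1 (1 / p) < ennreal \<gamma>"
    and T: "0 < T" and f: "\<And>i. (\<lambda>t. f t i) \<in> borel_measurable borel" and A: "measurable2 T m A"
    and fin: "BB_norm T m \<gamma> p q (incr f - A) < top"
  shows "((\<lambda>P. BB_norm T m \<gamma> p r (riemann_sum P A - incr f)) \<longlongrightarrow> 0) mesh_to_0"
proof -
  have r: "0 < r" using q by auto
  obtain \<rho> where \<rho>: "0 < \<rho>" "\<rho> < 1" "ennreal \<rho> < p" "ennreal \<rho> < r" "1 < \<gamma> * \<rho>"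
    using exists_sewing_exponent[OF \<gamma> p r q(3)] by auto
  then have "0 < \<gamma> * \<rho>" by linarith
  then have \<gamma>0: "0 \<le> \<gamma>" using \<rho>(1) by (simp add: zero_less_mult_iff)
  define M where "M = Besov_scale (T / 2) \<gamma> r (Omega T m p (incr f - A))"
  have "M \<le> ennreal (2 powr \<gamma> * 2 powr (1 / enn2real q)) * BB_norm T m \<gamma> p q (incr f - A)"
    unfolding M_def BB_norm_def using q \<gamma>0 T by (intro Besov_scale_embedding Omega_mono) auto
  also have "\<dots> < top" using fin by (intro ennreal_mult_less_top[THEN iffD2]) auto
  finally have "M < top" .
  then obtain n where n: "M = ennreal n" "0 \<le> n" by (cases M) auto
  define e where "e = (\<gamma> * \<rho> - 1) / \<rho>"
  have e: "0 < e" using \<rho> by (simp add: e_def)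
  have bound: "BB_norm T m \<gamma> p r (riemann_sum P A - incr f) \<le> ennreal (mesh P powr e * n)"
    if "unit_partition P" "mesh P \<le> 1 / 2" for P
  proof -
    have "BB_norm T m \<gamma> p r (riemann_sum P A - incr f) \<le> ennreal (mesh P powr e) * M"
      unfolding M_def e_def using \<rho> by (intro riemann_sum_error_bound that T f A) auto
    then show ?thesis using n by (simp add: ennreal_mult)
  qed
  have mesh0: "(mesh \<longlongrightarrow> 0) mesh_to_0"
  proof (rule tendstoI)
    fix d :: real assume d: "0 < d"
    show "\<forall>\<^sub>F P in mesh_to_0. dist (mesh P) 0 < d"
      unfolding eventually_mesh_to_0 using d
      by (intro exI[of _ d]) (auto simp: dist_real_def abs_of_pos[OF mesh_pos])
  qed
  have "((\<lambda>P. mesh P powr e * n) \<longlongrightarrow> 0 * n) mesh_to_0"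
  proof (intro tendsto_mult_right tendsto_zero_powrI[OF mesh0 tendsto_const _ e])
    show "\<forall>\<^sub>F P in mesh_to_0. 0 \<le> mesh P"
      unfolding eventually_mesh_to_0 using mesh_pos by (intro exI[of _ 1]) (auto intro: less_imp_le)
  qed
  from tendsto_ennrealI[OF this] have lim: "((\<lambda>P. ennreal (mesh P powr e * n)) \<longlongrightarrow> 0) mesh_to_0" by simp
  show ?thesis
  proof (rule tendsto_sandwich[OF _ _ tendsto_const lim])
    show "\<forall>\<^sub>F P in mesh_to_0. BB_norm T m \<gamma> p r (riemann_sum P A - incr f) \<le> ennreal (mesh P powr e * n)"
      unfolding eventually_mesh_to_0 using bound by (intro exI[of _ "1 / 2"]) (auto intro: less_imp_le)
  qed auto
qed

theorem theorem3p1: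
  shows "\<exists>(C1 :: ennreal \<Rightarrow> ennreal \<Rightarrow> real \<Rightarrow> real)
          (C2 :: real \<Rightarrow> ennreal \<Rightarrow> ennreal \<Rightarrow> ennreal \<Rightarrow> ennreal \<Rightarrow> real \<Rightarrow> real).
    \<forall>(T :: real) (p1 :: ennreal) (p2 :: ennreal) (q1 :: ennreal) (q2 :: ennreal)
       (\<alpha> :: real) (\<gamma> :: real) (m :: nat) (A :: real \<Rightarrow> real \<Rightarrow> nat \<Rightarrow> real).
      0 < T \<and> 0 < p1 \<and> 0 < p2 \<and> 0 < q1 \<and> 0 < q2 \<and> 0 < \<alpha> \<and> \<alpha> < 1 \<and>
      max 1 (1 / p2) < ennreal \<gamma> \<and>
      measurable2 T m A \<and>
      BB_norm T m \<alpha> p1 q1 A + BB_bar_norm T m \<gamma> p2 q2 (delta A) < \<infinity>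
      \<longrightarrow>
      (\<exists>IA \<in> Besov T m \<alpha> (min p1 p2) (max q1 q2). \<exists>RA \<in> BB T m \<gamma> p2 q2.
        (\<forall>r. q2 \<le> r \<and> ennreal (1 / \<gamma>) < r \<longrightarrow>
          ((\<lambda>P. BB_norm T m \<gamma> p2 r (riemann_sum P A - incr IA)) \<longlongrightarrow> 0) mesh_to_0 \<and>
          ((\<lambda>P. BB_norm T m \<gamma> p2 r (riemann_rem P A - RA)) \<longlongrightarrow> 0) mesh_to_0) \<and>
        BB_norm T m \<gamma> p2 q2 RA
          \<le> ennreal (C1 p2 q2 \<gamma>) * BB_bar_norm T m \<gamma> p2 q2 (delta A) \<and>
        Besov_seminorm T m \<alpha> (min p1 p2) (max q1 q2) IA
          \<le> ennreal (C2 T p1 p2 q1 q2 \<gamma>) *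
             (BB_norm T m \<alpha> p1 q1 A
              + ennreal (T powr (\<gamma> - \<alpha>)) * BB_bar_norm T m \<gamma> p2 q2 (delta A)))"
proof -
  obtain C1 where C1: "0 < p \<Longrightarrow> 0 < q \<Longrightarrow> max 1 (1 / p) < ennreal \<gamma> \<Longrightarrow> sewing_constant p q \<gamma> (C1 p q \<gamma>)" for p q \<gamma>
    using sewing_constant_exists by metis
  obtain C2 where C2: "0 < T \<Longrightarrow> 0 < p1 \<Longrightarrow> 0 < p2 \<Longrightarrow> 0 < q1 \<Longrightarrow> 0 < q2 \<Longrightarrow>
      increment_constant T p1 p2 q1 q2 \<gamma> (C2 T p1 p2 q1 q2 \<gamma>)" for T p1 p2 q1 q2 \<gamma>
    using increment_constant_exists by metis
  show ?thesis
  \<comment> \<open>The factor \<open>max 1 (C1 p2 q2 \<gamma>)\<close> absorbs the bound of the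
    remainder by \<open>delta A\<close> while keeping a coefficient of at least 1 in front of the
    norm of \<open>A\<close>.\<close>
  proof (intro exI[of _ C1] exI[of _ "\<lambda>T p1 p2 q1 q2 \<gamma>. C2 T p1 p2 q1 q2 \<gamma> * max 1 (C1 p2 q2 \<gamma>)"] allI impI, elim conjE)
    fix T :: real and p1 p2 q1 q2 :: ennreal and \<alpha> \<gamma> :: real and m :: nat and A
    assume T: "0 < T" and p: "0 < p1" "0 < p2" and q: "0 < q1" "0 < q2" and \<alpha>: "0 < \<alpha>" "\<alpha> < 1"
      and \<gamma>: "max 1 (1 / p2) < ennreal \<gamma>" and A: "measurable2 T m A"
      and fin: "BB_norm T m \<alpha> p1 q1 A + BB_bar_norm T m \<gamma> p2 q2 (delta A) < \<infinity>"
    let ?a = "BB_norm T m \<alpha> p1 q1 A" and ?d = "BB_bar_norm T m \<gamma> p2 q2 (delta A)"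
    let ?c1 = "C1 p2 q2 \<gamma>" and ?c2 = "C2 T p1 p2 q1 q2 \<gamma>" and ?t = "ennreal (T powr (\<gamma> - \<alpha>))"
    have fins: "?a < top" "?d < top" using fin by auto
    have "ennreal 1 < ennreal \<gamma>" using \<gamma> by simp
    then have \<gamma>1: "1 < \<gamma>" by (subst (asm) ennreal_less_iff) auto
    have sew: "sewing_constant p2 q2 \<gamma> ?c1" and inc: "increment_constant T p1 p2 q1 q2 \<gamma> ?c2"
      using C1 C2 T p q \<gamma> by blast+
    have c1: "0 \<le> ?c1" and c2: "0 \<le> ?c2"
      using sew inc by (simp_all add: sewing_constant_def increment_constant_def)
    obtain f where f: "\<forall>i. (\<lambda>t. f t i) \<in> borel_measurable borel"
      and R: "BB_norm T m \<gamma> p2 q2 (incr f - A) \<le> ennreal ?c1 * ?d"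
      using sew T A fins(2) unfolding sewing_constant_def by blast
    have Rfin: "BB_norm T m \<gamma> p2 q2 (incr f - A) < top"
      using fins(2) by (intro le_less_trans[OF R] ennreal_mult_less_top[THEN iffD2]) auto
    have semi: "Besov_seminorm T m \<alpha> (min p1 p2) (max q1 q2) f \<le> ennreal ?c2 * (?a + ?t * BB_norm T m \<gamma> p2 q2 (incr f - A))"
      using inc \<alpha> \<gamma>1 A f unfolding increment_constant_def by simp
    show "\<exists>IA \<in> Besov T m \<alpha> (min p1 p2) (max q1 q2). \<exists>RA \<in> BB T m \<gamma> p2 q2.
        (\<forall>r. q2 \<le> r \<and> ennreal (1 / \<gamma>) < r \<longrightarrow>
          ((\<lambda>P. BB_norm T m \<gamma> p2 r (riemann_sum P A - incr IA)) \<longlongrightarrow> 0) mesh_to_0 \<and>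
          ((\<lambda>P. BB_norm T m \<gamma> p2 r (riemann_rem P A - RA)) \<longlongrightarrow> 0) mesh_to_0) \<and>
        BB_norm T m \<gamma> p2 q2 RA \<le> ennreal ?c1 * ?d \<and>
        Besov_seminorm T m \<alpha> (min p1 p2) (max q1 q2) IA
          \<le> ennreal (?c2 * max 1 ?c1) * (?a + ?t * ?d)"
    proof (intro bexI[of _ f] bexI[of _ "incr f - A"] conjI allI impI R)
      fix r assume r: "q2 \<le> r \<and> ennreal (1 / \<gamma>) < r"
      show lim: "((\<lambda>P. BB_norm T m \<gamma> p2 r (riemann_sum P A - incr f)) \<longlongrightarrow> 0) mesh_to_0"
        by (rule riemann_sum_tendsto[OF p(2) q(2) _ _ \<gamma> T _ A Rfin]) (use r f in auto)
      \<comment> \<open>Subtracting \<open>A\<close> on both sides makes the two limits literally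
        the same.\<close>
      have eq: "riemann_rem P A - (incr f - A) = riemann_sum P A - incr f" for P
        by (simp add: fun_eq_iff riemann_rem_def)
      show "((\<lambda>P. BB_norm T m \<gamma> p2 r (riemann_rem P A - (incr f - A))) \<longlongrightarrow> 0) mesh_to_0"
        unfolding eq by (rule lim)
    next
      have "ennreal ?c2 * (?a + ?t * BB_norm T m \<gamma> p2 q2 (incr f - A)) \<le> ennreal ?c2 * (ennreal (max 1 ?c1) * (?a + ?t * ?d))"
      proof (rule mult_left_mono)
        have "?a + ?t * BB_norm T m \<gamma> p2 q2 (incr f - A) \<le> 1 * ?a + ?t * (ennreal ?c1 * ?d)"
          using R by (auto intro!: add_left_mono mult_left_mono)
        also have "\<dots> \<le> ennreal (max 1 ?c1) * ?a + ?t * (ennreal (max 1 ?c1) * ?d)"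
          by (intro add_mono mult_mono mult_left_mono mult_right_mono) (auto simp: ennreal_leI)
        finally show "?a + ?t * BB_norm T m \<gamma> p2 q2 (incr f - A) \<le> ennreal (max 1 ?c1) * (?a + ?t * ?d)"
          by (simp add: distrib_left mult.left_commute)
      qed simp
      with semi show "Besov_seminorm T m \<alpha> (min p1 p2) (max q1 q2) f \<le> ennreal (?c2 * max 1 ?c1) * (?a + ?t * ?d)"
        using c1 c2 by (simp add: ennreal_mult mult.assoc)
    next
      show "incr f - A \<in> BB T m \<gamma> p2 q2"
        using Rfin measurable2_incr_minus[OF _ A, of f] f by (simp add: BB_def)
    next
      have "?t * BB_norm T m \<gamma> p2 q2 (incr f - A) < top" using Rfin by (simp add: ennreal_mult_less_top)
      then have "ennreal ?c2 * (?a + ?t * BB_norm T m \<gamma> p2 q2 (incr f - A)) < top"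
        using fins(1) by (simp add: ennreal_mult_less_top)
      then have "Besov_seminorm T m \<alpha> (min p1 p2) (max q1 q2) f < top" using semi by (rule le_less_trans[rotated])
      then show "f \<in> Besov T m \<alpha> (min p1 p2) (max q1 q2)"
        using p q T \<alpha> f by (intro Besov_memI) (auto simp: less_max_iff_disj)
    qed
  qed
qed

end
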